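(* Consider configurations of $n$ hard disks of radius $r$ in the two-dimensional unit torus $[0,1]^2$, i.e. the state space $\Omega$ of $n$-tuples $(x_1,\dots,x_n)$ of points of the torus with $\|x_i-x_j\|\ge 2r$ for all $i\ne j$ (distance measured on the torus), equipped with the uniform (Lebesgue) distribution, and let $\rho = n\pi r^2$ be the density. If $\rho \le 0.154483$, then the single-disk global-move dynamics on $\Omega$ has mixing time $\tau = O(n\log n)$. Consequently, the critical density $\rho_c$ satisfies $\rho_c \ge 0.154483$.
   Context: The single-disk global-move dynamics is the Markov chain on $\Omega$ which, at each step, chooses a disk index $j\in\{1,\dots,n\}$ uniformly at random and a point $z$ uniformly at random in $[0,1]^2$; if replacing $x_j$ by $z$ yields a valid configuration (i.e. $\|z-x_i\|\ge 2r$ for all $i\neq j$), the move is performed, otherwise the configuration is left unchanged. Its stationary distribution is uniform on $\Omega$. The asymptotic statement is as $n\to\infty$ with the density $\rho$ held fixed (so $r$ is determined by $n$ and $\rho$). The critical density $\rho_c$ denotes the density marking the end of the gaseous phase, i.e. the threshold such that for all densities below it this dynamics mixes rapidly (in time polynomial in $n$). *)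

theory Defs
  imports "HOL-Probability.Probability" "HOL-Library.Landau_Symbols"
begin

text \<open>
  Points of the unit torus are represented by the fundamental domain $[0,1)^2$; the torus
  distance is the distance of the difference vector to the lattice of integer vectors.
\<close>

definition unit_torus :: "(real \<times> real) set" where
  "unit_torus = {0..<1} \<times> {0..<1}"

definition torus_dist :: "real \<times> real \<Rightarrow> real \<times> real \<Rightarrow> real" where
  "torus_dist x y = infdist (x - y) (\<int> \<times> \<int>)"

definition torus_measure :: "(real \<times> real) measure" where
  "torus_measure = restrict_space lborel unit_torus"

definition configurations :: "nat \<Rightarrow> real \<Rightarrow> (nat \<Rightarrow> real \<times> real) set" where
  "configurations n r =
     {x \<in> {..<n} \<rightarrow>\<^sub>E unit_torus. \<forall>i<n. \<forall>j<n. i \<noteq> j \<longrightarrow> 2 * r \<le> torus_dist (x i) (x j)}"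

definition config_measure :: "nat \<Rightarrow> real \<Rightarrow> (nat \<Rightarrow> real \<times> real) measure" where
  "config_measure n r =
     restrict_space (\<Pi>\<^sub>M i\<in>{..<n}. torus_measure) (configurations n r)"

definition uniform_config :: "nat \<Rightarrow> real \<Rightarrow> (nat \<Rightarrow> real \<times> real) measure" where
  "uniform_config n r = uniform_measure (config_measure n r) (configurations n r)"

text \<open>
  The transition kernel of the single-disk global-move dynamics. Only the measurable space
  of \<^term>\<open>config_measure n r\<close> matters in the codomain of \<^const>\<open>distr\<close>.
\<close>

definition disk_step ::
    "nat \<Rightarrow> real \<Rightarrow> (nat \<Rightarrow> real \<times> real) \<Rightarrow> (nat \<Rightarrow> real \<times> real) measure" where
  "disk_step n r x =
     distr (uniform_count_measure {..<n} \<Otimes>\<^sub>M torus_measure) (config_measure n r)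
       (\<lambda>(j, z). if \<forall>i<n. i \<noteq> j \<longrightarrow> 2 * r \<le> torus_dist z (x i) then x(j := z) else x)"

primrec disk_chain ::
    "nat \<Rightarrow> real \<Rightarrow> (nat \<Rightarrow> real \<times> real) \<Rightarrow> nat \<Rightarrow> (nat \<Rightarrow> real \<times> real) measure" where
  "disk_chain n r x 0 = return (config_measure n r) x"
| "disk_chain n r x (Suc t) = disk_chain n r x t \<bind> disk_step n r"

definition tv_dist :: "'a measure \<Rightarrow> 'a measure \<Rightarrow> real" where
  "tv_dist M N = (SUP A\<in>sets M. \<bar>measure M A - measure N A\<bar>)"

text \<open>
  The mixing time takes values in \<^typ>\<open>enat\<close> so that it is infinite, rather than
  unspecified, if the chain never gets \<open>\<epsilon>\<close>-close to the uniform distribution.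
\<close>

definition mixing_time :: "nat \<Rightarrow> real \<Rightarrow> real \<Rightarrow> enat" where
  "mixing_time n r \<epsilon> =
     (INF t \<in> {t. \<forall>x\<in>configurations n r. tv_dist (disk_chain n r x t) (uniform_config n r) \<le> \<epsilon>}.
        enat t)"

text \<open>The radius determined by the relation $\rho = n \pi r^2$.\<close>

definition disk_radius :: "nat \<Rightarrow> real \<Rightarrow> real" where
  "disk_radius n \<rho> = sqrt (\<rho> / (real n * pi))"

text \<open>
  The bound is required for every fixed threshold \<open>\<epsilon>\<close>, so that it does not depend on the choice
  of the constant in the definition of the mixing time. Finiteness is stated separately
  because \<^const>\<open>the_enat\<close> is unspecified at infinity.
\<close>

definition mixing_time_bigo :: "real \<Rightarrow> (nat \<Rightarrow> real) \<Rightarrow> bool" where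
  "mixing_time_bigo \<rho> f \<longleftrightarrow>
     (\<forall>\<epsilon>. 0 < \<epsilon> \<and> \<epsilon> < 1 \<longrightarrow>
       (\<forall>\<^sub>F n in sequentially. mixing_time n (disk_radius n \<rho>) \<epsilon> \<noteq> \<infinity>) \<and>
       (\<lambda>n. real (the_enat (mixing_time n (disk_radius n \<rho>) \<epsilon>))) \<in> O(f))"

text \<open>
  The positivity requirement excludes densities beyond the packing density, where there are
  no configurations and any mixing time bound would hold vacuously.
\<close>

definition rapidly_mixing :: "real \<Rightarrow> bool" where
  "rapidly_mixing \<rho> \<longleftrightarrow>
     (\<forall>\<^sub>F n in sequentially.
        0 < emeasure (config_measure n (disk_radius n \<rho>)) (configurations n (disk_radius n \<rho>))) \<and>
     (\<exists>k. mixing_time_bigo \<rho> (\<lambda>n. real n ^ k))"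

definition critical_density :: ereal where
  "critical_density =
     Sup (ereal ` {\<rho>. \<forall>\<rho>'. 0 < \<rho>' \<and> \<rho>' < \<rho> \<longrightarrow> rapidly_mixing \<rho>'})"

end

theory Submission
  imports Defs
begin

text \<open>
  Path coupling, as contraction estimates for the transition operator \<open>P\<close> on bounded functions.
  The cost of two configurations that differ only in disk \<open>i\<close> is a function \<open>f \<le> 1\<close> of
  the distance of the two positions \<open>x\<^sub>i\<close> and \<open>y\<^sub>i\<close>. A proposal \<open>z\<close> for another disk that only one of
  the chains accepts lies in the crescent of the points closer than \<open>2r\<close> to, say, \<open>y\<^sub>i\<close> but not to
  \<open>x\<^sub>i\<close>. If the accepted disk then takes over the label \<open>i\<close>, the discrepancy at \<open>i\<close> is the one
  between \<open>z\<close> and \<open>y\<^sub>i\<close>, which is cheaper if \<open>z\<close> is near \<open>y\<^sub>i\<close>, since \<open>f\<close> is essentially increasing. This gain is why a suitable \<open>f\<close>,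
  tabulated numerically, contracts for excluded areas \<open>4\<rho>\<close> up to \<open>0.617932\<close>, beyond the value
  reached by the Hamming distance.

  Relabelling is paid for separately. Two moves of the labels \<open>i\<close> and \<open>j\<close> with free proposals
  coalesce with the same moves with the labels interchanged, and within \<open>O(n)\<close> steps such a pair
  of moves occurs with probability bounded below. Hence \<open>P\<^sup>t g\<close> is symmetric in the labels up to an
  error that decreases geometrically in \<open>t / n\<close>, so that after \<open>O(n ln n)\<close> steps the path coupling
  applies with a negligible error.
\<close>

text \<open>The threshold is a balance. Write E for \<open>exclusion\<close>, which is 4 * \<rho>. A
  move of the differing disk fails to coalesce with probability at most E, and moves of the other
  disks create new discrepancies of total cost at most k * E. The Hamming distance has k = 1 and
  needs E < 1/2. The tabulated metric has k = 382058 / 617932, and E * (1 + k) is at most 1 -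
  1/100000 as long as E \<le> 0.617932 = 4 * 0.154483. Behind k stands one inequality: the integral
  of 1 - max 0 (f d - f s) over the crescent is at most pi * k * f d at every distance d. It is
  reduced to integer inequalities on 64 cells.

  The obstacle is that the cheap matching exchanges labels, while the chain distinguishes its disks.
  No joint process is built; differences of P^t g are bounded, and an exchange of labels costs an
  additive term s. Such a term can be absorbed only since the metric never falls below 1/10000, not
  even at distance 0. It is then amplified by 10^9 * n, and again by n along a path of single
  changes, which the geometric decay of s outweighs after O(n ln n) steps.\<close>

lemma borel_measurable_fst' [measurable (raw)]:
  fixes f :: "'a \<Rightarrow> 'b::topological_space \<times> 'c::topological_space"
  assumes "f \<in> borel_measurable M"
  shows "(\<lambda>x. fst (f x)) \<in> borel_measurable M"
  using assms by (rule borel_measurable_continuous_on[rotated]) (intro continuous_intros)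

lemma borel_measurable_snd' [measurable (raw)]:
  fixes f :: "'a \<Rightarrow> 'b::topological_space \<times> 'c::topological_space"
  assumes "f \<in> borel_measurable M"
  shows "(\<lambda>x. snd (f x)) \<in> borel_measurable M"
  using assms by (rule borel_measurable_continuous_on[rotated]) (intro continuous_intros)

section \<open>Lebesgue measure of the plane under shears, reflections and rotations\<close>

lemma nn_integral_lborel_shift:
  fixes f :: "real \<Rightarrow> ennreal"
  assumes [measurable]: "f \<in> borel_measurable borel"
  shows "(\<integral>\<^sup>+x. f (x + a) \<partial>lborel) = (\<integral>\<^sup>+x. f x \<partial>lborel)"
  using nn_integral_real_affine[of f 1 a] by (simp add: add.commute)

lemma nn_integral_plane_fst:
  fixes f :: "real \<times> real \<Rightarrow> ennreal"
  assumes [measurable]: "f \<in> borel_measurable borel"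
  shows "(\<integral>\<^sup>+z. f z \<partial>lborel) = (\<integral>\<^sup>+x. \<integral>\<^sup>+y. f (x, y) \<partial>lborel \<partial>lborel)"
proof -
  have m: "f \<in> borel_measurable (lborel \<Otimes>\<^sub>M lborel)"
    by (simp add: lborel_prod)
  show ?thesis
    by (subst lborel_prod[symmetric]) (rule lborel.nn_integral_fst[OF m, symmetric])
qed

lemma nn_integral_plane_snd:
  fixes f :: "real \<times> real \<Rightarrow> ennreal"
  assumes [measurable]: "f \<in> borel_measurable borel"
  shows "(\<integral>\<^sup>+z. f z \<partial>lborel) = (\<integral>\<^sup>+y. \<integral>\<^sup>+x. f (x, y) \<partial>lborel \<partial>lborel)"
proof -
  have m: "(\<lambda>(x,y). f (x, y)) \<in> borel_measurable (lborel \<Otimes>\<^sub>M lborel)"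
    by (simp add: lborel_prod)
  show ?thesis
    unfolding nn_integral_plane_fst[OF assms]
    using lborel_pair.Fubini'[OF m] by simp
qed

text \<open>Fubini with the sheared coordinate innermost, where the shear is a translation. The
  shift may be any Borel function: linear ones compose to rotations, and - sqrt (1 - v^2)
  straightens circular arcs.\<close>

lemma nn_integral_shear_fst:
  fixes f :: "real \<times> real \<Rightarrow> ennreal" and h :: "real \<Rightarrow> real"
  assumes [measurable]: "f \<in> borel_measurable borel" "h \<in> borel_measurable borel"
  shows "(\<integral>\<^sup>+z. f (fst z + h (snd z), snd z) \<partial>lborel) = (\<integral>\<^sup>+z. f z \<partial>lborel)"
proof -
  have m: "(\<lambda>z. f (fst z + h (snd z), snd z)) \<in> borel_measurable borel"
    by measurable
  show ?thesis
    unfolding nn_integral_plane_snd[OF m] nn_integral_plane_snd[OF assms(1)]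
    by (rule nn_integral_cong) (simp add: nn_integral_lborel_shift[of "\<lambda>x. f (x, y)" for y])
qed

lemma nn_integral_shear_snd:
  fixes f :: "real \<times> real \<Rightarrow> ennreal" and h :: "real \<Rightarrow> real"
  assumes [measurable]: "f \<in> borel_measurable borel" "h \<in> borel_measurable borel"
  shows "(\<integral>\<^sup>+z. f (fst z, snd z + h (fst z)) \<partial>lborel) = (\<integral>\<^sup>+z. f z \<partial>lborel)"
proof -
  have m: "(\<lambda>z. f (fst z, snd z + h (fst z))) \<in> borel_measurable borel"
    by measurable
  show ?thesis
    unfolding nn_integral_plane_fst[OF m] nn_integral_plane_fst[OF assms(1)]
    by (rule nn_integral_cong) (simp add: nn_integral_lborel_shift[of "\<lambda>y. f (x, y)" for x])
qed

lemma nn_integral_reflect_fst: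
  fixes f :: "real \<times> real \<Rightarrow> ennreal"
  assumes [measurable]: "f \<in> borel_measurable borel"
  shows "(\<integral>\<^sup>+z. f (- fst z, snd z) \<partial>lborel) = (\<integral>\<^sup>+z. f z \<partial>lborel)"
proof -
  have m: "(\<lambda>z. f (- fst z, snd z)) \<in> borel_measurable borel"
    by measurable
  show ?thesis
    unfolding nn_integral_plane_snd[OF m] nn_integral_plane_snd[OF assms(1)]
    by (rule nn_integral_cong) (subst (2) nn_integral_real_affine[where c="-1" and t=0]; simp)
qed

text \<open>A rotation is a product of three shears, so that it preserves Lebesgue measure.\<close>

lemma nn_integral_rotate:
  fixes f :: "real \<times> real \<Rightarrow> ennreal"
  assumes [measurable]: "f \<in> borel_measurable borel" and cs: "c\<^sup>2 + s\<^sup>2 = 1"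
  shows "(\<integral>\<^sup>+z. f (c * fst z - s * snd z, s * fst z + c * snd z) \<partial>lborel) = (\<integral>\<^sup>+z. f z \<partial>lborel)"
proof (cases "s = 0")
  case True
  then have "c = 1 \<or> c = -1" using cs by (simp add: power2_eq_1_iff)
  then show ?thesis
  proof
    assume "c = 1" then show ?thesis using True by simp
  next
    assume c: "c = -1"
    let ?g = "\<lambda>z. f (fst z, - snd z)"
    have [measurable]: "?g \<in> borel_measurable borel" by measurable
    have "(\<integral>\<^sup>+z. f (- fst z, - snd z) \<partial>lborel) = (\<integral>\<^sup>+z. ?g (- fst z, snd z) \<partial>lborel)" by simp
    also have "\<dots> = (\<integral>\<^sup>+z. ?g z \<partial>lborel)" by (rule nn_integral_reflect_fst) measurable
    also have "\<dots> = (\<integral>\<^sup>+x. \<integral>\<^sup>+y. f (x, - y) \<partial>lborel \<partial>lborel)"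
      by (subst nn_integral_plane_fst) simp_all
    also have "\<dots> = (\<integral>\<^sup>+x. \<integral>\<^sup>+y. f (x, y) \<partial>lborel \<partial>lborel)"
      by (rule nn_integral_cong) (subst (2) nn_integral_real_affine[where c="-1" and t=0]; simp)
    also have "\<dots> = (\<integral>\<^sup>+z. f z \<partial>lborel)" by (subst nn_integral_plane_fst) simp_all
    finally show ?thesis using True c by simp
  qed
next
  case False
  \<comment> \<open>For the rotation by an angle \<phi> this is - tan (\<phi> / 2), the factor of
    the two outer shears; the middle one has factor \<open>s\<close>. The division is why rotations
    by 0 and pi are treated apart.\<close>
  define a where "a = (c - 1) / s"
  have as: "a * s = c - 1" using False by (simp add: a_def)
  have e1: "c * a + s = - a"
  proof -
    have "s * (c * a + s) = c * (a * s) + s\<^sup>2" by (simp add: algebra_simps power2_eq_square)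
    also have "\<dots> = c * (c - 1) + s\<^sup>2" by (simp only: as)
    also have "\<dots> = - (c - 1)" using cs by (simp add: algebra_simps power2_eq_square)
    also have "\<dots> = s * (- a)" using as by (simp add: algebra_simps)
    finally show ?thesis using False by (metis mult_left_cancel)
  qed
  define f1 where "f1 = (\<lambda>z. f (fst z + a * snd z, snd z))"
  define f2 where "f2 = (\<lambda>z. f1 (fst z, snd z + s * fst z))"
  define f3 where "f3 = (\<lambda>z. f2 (fst z + a * snd z, snd z))"
  have [measurable]: "f1 \<in> borel_measurable borel" unfolding f1_def by measurable
  have [measurable]: "f2 \<in> borel_measurable borel" unfolding f2_def by measurable
  have f3: "f3 z = f (c * fst z - s * snd z, s * fst z + c * snd z)" for z
  proof -
    have 1: "fst z + a * snd z + a * (snd z + s * (fst z + a * snd z))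
      = (1 + a * s) * fst z + (2 * a + (a * s) * a) * snd z" by (simp add: algebra_simps)
    have "2 * a + (a * s) * a = 2 * a + (c - 1) * a" by (simp only: as)
    then have 2: "2 * a + (a * s) * a = - s" using e1 by (simp add: algebra_simps)
    have 3: "snd z + s * (fst z + a * snd z) = s * fst z + (1 + a * s) * snd z"
      by (simp add: algebra_simps)
    have 4: "1 + a * s = c" using as by simp
    show ?thesis unfolding f3_def f2_def f1_def fst_conv snd_conv 1 2 unfolding 3 4 by simp
  qed
  have "(\<integral>\<^sup>+z. f3 z \<partial>lborel) = (\<integral>\<^sup>+z. f2 z \<partial>lborel)"
    unfolding f3_def by (rule nn_integral_shear_fst) measurable
  also have "\<dots> = (\<integral>\<^sup>+z. f1 z \<partial>lborel)"
    unfolding f2_def by (rule nn_integral_shear_snd) measurable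
  also have "\<dots> = (\<integral>\<^sup>+z. f z \<partial>lborel)"
    unfolding f1_def by (rule nn_integral_shear_fst) measurable
  finally show ?thesis unfolding f3 .
qed

text \<open>A rotation that takes \<open>x\<close> to the first axis preserves both norms, so
  crescents may be studied with the second centre at \<open>(d, 0)\<close>.\<close>

lemma nn_integral_two_norms:
  fixes k :: "real \<Rightarrow> real \<Rightarrow> ennreal" and x :: "real \<times> real"
  assumes k: "(\<lambda>p. k (fst p) (snd p)) \<in> borel_measurable borel"
  shows "(\<integral>\<^sup>+z. k (norm z) (norm (z - x)) \<partial>lborel)
       = (\<integral>\<^sup>+z. k (norm z) (norm (z - (norm x, 0 :: real))) \<partial>lborel)"
proof (cases "x = 0")
  case True then show ?thesis by (simp add: zero_prod_def[symmetric])
next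
  case False
  define d where "d = norm x"
  have d: "d > 0" using False by (simp add: d_def)
  have d2: "d\<^sup>2 = (fst x)\<^sup>2 + (snd x)\<^sup>2" by (simp add: d_def norm_prod_def)
  define c where "c = fst x / d"
  define s where "s = snd x / d"
  have cs: "c\<^sup>2 + s\<^sup>2 = 1"
    using d by (simp add: c_def s_def power_divide add_divide_distrib[symmetric] d2[symmetric])
  have x: "x = (c * d, s * d)" using d by (simp add: c_def s_def)
  have g: "(\<lambda>z::real\<times>real. (norm z, norm (z - x))) \<in> borel_measurable borel" by measurable
  have m[measurable]: "(\<lambda>z::real\<times>real. k (norm z) (norm (z - x))) \<in> borel_measurable borel"
    using measurable_compose[OF g k] by simp
  have n: "norm (c * fst z - s * snd z, s * fst z + c * snd z) = norm z" for z :: "real \<times> real"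
  proof -
    have "(c * fst z - s * snd z)\<^sup>2 + (s * fst z + c * snd z)\<^sup>2
      = (c\<^sup>2 + s\<^sup>2) * ((fst z)\<^sup>2 + (snd z)\<^sup>2)" by (simp add: algebra_simps power2_eq_square)
    then show ?thesis using cs by (simp add: norm_prod_def)
  qed
  have n2: "norm ((c * fst z - s * snd z, s * fst z + c * snd z) - x) = norm (z - (d, 0))" for z
  proof -
    have e: "(c * fst z - s * snd z, s * fst z + c * snd z) - x
      = (c * fst (z - (d,0)) - s * snd (z - (d,0)), s * fst (z - (d,0)) + c * snd (z - (d,0)))"
      by (simp add: x algebra_simps)
    show ?thesis unfolding e n ..
  qed
  show ?thesis
    using nn_integral_rotate[OF m cs] unfolding n n2 d_def[symmetric] by simp
qed

subsection \<open>Crescents of the unit disk\<close>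

lemma emeasure_lborel_abs_less:
  assumes "0 \<le> (V::real)"
  shows "emeasure lborel {v. \<bar>v\<bar> < V} = ennreal (2 * V)"
proof -
  have "{v. \<bar>v\<bar> < V} = {-V<..<V}" by auto
  then show ?thesis using assms by simp
qed

lemma norm_arc_point:
  fixes t v :: real
  assumes "\<bar>v\<bar> \<le> 1"
  shows "(norm (t - sqrt (1 - v\<^sup>2), v))\<^sup>2 = 1 + t\<^sup>2 - 2 * t * sqrt (1 - v\<^sup>2)"
proof -
  have "v\<^sup>2 \<le> 1" using assms by (simp add: abs_square_le_1)
  then have w: "(sqrt (1 - v\<^sup>2))\<^sup>2 = 1 - v\<^sup>2" by simp
  have "(norm (t - sqrt (1 - v\<^sup>2), v))\<^sup>2 = (t - sqrt (1 - v\<^sup>2))\<^sup>2 + v\<^sup>2" by (simp add: norm_prod_def)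
  also have "\<dots> = 1 + t\<^sup>2 - 2 * t * sqrt (1 - v\<^sup>2)" unfolding power2_diff w by simp
  finally show ?thesis .
qed

text \<open>Points of the unit disk left uncovered by a second unit disk with centre \<open>(d, 0)\<close> are
  parametrised by the position \<open>t \<le> d\<close> of the centre for which they lie on the left half of the
  boundary circle, and by their height \<open>v\<close>.\<close>

lemma crescent_parameter:
  fixes t v d :: real
  assumes d: "0 \<le> d" and n1: "norm (t - sqrt (1 - v\<^sup>2), v) < 1"
    and n2: "1 \<le> norm ((t - sqrt (1 - v\<^sup>2), v) - (d, 0))"
  shows "0 < t" "t \<le> d" "\<bar>v\<bar> < sqrt (1 - t\<^sup>2 / 4)"
proof -
  let ?w = "sqrt (1 - v\<^sup>2)"
  have "\<bar>v\<bar> < 1" using n1 norm_snd_le[of v "t - ?w"] by simp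
  then have v: "v\<^sup>2 < 1" by (simp add: abs_square_less_1)
  then have w: "0 < ?w" "?w\<^sup>2 = 1 - v\<^sup>2" by simp_all
  have "(norm (t - ?w, v))\<^sup>2 < 1" using n1 by (simp add: abs_square_less_1)
  then have "(t - ?w)\<^sup>2 + v\<^sup>2 < 1" by (simp add: norm_prod_def)
  then have sq: "(t - ?w)\<^sup>2 < ?w\<^sup>2" using w by simp
  then have b: "\<bar>t - ?w\<bar> < ?w" using w by (metis abs_of_pos power2_abs power2_less_imp_less less_imp_le)
  then show t: "0 < t" by linarith
  have "1 \<le> (norm ((t - ?w, v) - (d, 0)))\<^sup>2" using n2 by (simp add: one_le_power)
  then have "1 \<le> (t - ?w - d)\<^sup>2 + v\<^sup>2" by (simp add: norm_prod_def)
  then have "?w\<^sup>2 \<le> (t - ?w - d)\<^sup>2" using w by simp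
  then have "?w \<le> \<bar>t - ?w - d\<bar>" using w by (metis abs_le_square_iff abs_of_pos)
  then show "t \<le> d" using b d by linarith
  have "t / 2 < ?w" using b by linarith
  then have "(t / 2)\<^sup>2 < ?w\<^sup>2" using t by (intro power_strict_mono) auto
  then have "v\<^sup>2 < 1 - t\<^sup>2 / 4" using w by (simp add: power_divide)
  then show "\<bar>v\<bar> < sqrt (1 - t\<^sup>2 / 4)"
    by (metis real_sqrt_abs real_sqrt_less_iff)
qed

text \<open>In the coordinates z = (t - sqrt (1 - v^2), v), the left halves of the unit circles
  about (t, 0) become lines of constant t. The slice of the crescent at t lies in \<bar>v\<bar> <
  sqrt (1 - t^2 / 4), which yields the right-hand side. A weight below 1 is exploited in layers:
  \<open>w\<close> plus a step function with drops \<open>D k\<close> at the radii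
  \<open>\<rho> k\<close> stays below 1, and the layer k covers at least the interval of half-width
  \<open>V k t\<close> in the slice. The saving is added on the left because subtraction in
  \<open>ennreal\<close> truncates.\<close>

lemma crescent_integral_bound:
  fixes w :: "real \<Rightarrow> real" and D \<rho> :: "nat \<Rightarrow> real" and V :: "nat \<Rightarrow> real \<Rightarrow> real"
  assumes d: "0 \<le> d" and K: "finite K"
    and w[measurable]: "w \<in> borel_measurable borel"
    and D: "\<And>k. k \<in> K \<Longrightarrow> 0 \<le> D k"
    and w_le: "\<And>s. 0 \<le> s \<Longrightarrow> s < 1 \<Longrightarrow> 0 \<le> w s \<and> w s + (\<Sum>k\<in>K. D k * indicator {..<\<rho> k} s) \<le> 1"
    and V[measurable]: "\<And>k. k \<in> K \<Longrightarrow> V k \<in> borel_measurable borel"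
    and V0: "\<And>k t. k \<in> K \<Longrightarrow> 0 \<le> V k t"
    and V_in: "\<And>k t v. k \<in> K \<Longrightarrow> 0 < t \<Longrightarrow> t \<le> d \<Longrightarrow> \<bar>v\<bar> < V k t
      \<Longrightarrow> norm (t - sqrt (1 - v\<^sup>2), v) < \<rho> k"
    and \<rho>: "\<And>k. k \<in> K \<Longrightarrow> \<rho> k \<le> 1"
  shows "(\<integral>\<^sup>+z. indicator {z. norm z < 1 \<and> 1 \<le> norm (z - (d, 0::real))} z * ennreal (w (norm z)) \<partial>lborel)
      + (\<integral>\<^sup>+t. ennreal (\<Sum>k\<in>K. D k * (2 * V k t)) * indicator {0<..d} t \<partial>lborel)
    \<le> (\<integral>\<^sup>+t. ennreal (2 * sqrt (1 - t\<^sup>2 / 4)) * indicator {0<..d} t \<partial>lborel)"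
proof -
  define F :: "real \<times> real \<Rightarrow> ennreal"
    where "F = (\<lambda>z. indicator {z. norm z < 1 \<and> 1 \<le> norm (z - (d, 0::real))} z * ennreal (w (norm z)))"
  define h where "h = (\<lambda>v::real. - sqrt (1 - v\<^sup>2))"
  have [measurable]: "F \<in> borel_measurable borel" unfolding F_def by measurable
  have [measurable]: "h \<in> borel_measurable borel" unfolding h_def by measurable
  define I where "I t = (\<integral>\<^sup>+v. F (t + h v, v) \<partial>lborel)" for t
  have I_meas[measurable]: "I \<in> borel_measurable borel"
  proof -
    have "(\<lambda>(t, v). F (t + h v, v)) \<in> borel_measurable (borel \<Otimes>\<^sub>M lborel)" by measurable
    from lborel.borel_measurable_nn_integral[OF this] show ?thesis unfolding I_def by simp
  qed
  have "(\<integral>\<^sup>+z. F z \<partial>lborel) = (\<integral>\<^sup>+z. F (fst z + h (snd z), snd z) \<partial>lborel)"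
    by (rule nn_integral_shear_fst[symmetric]) measurable
  also have "\<dots> = (\<integral>\<^sup>+t. I t \<partial>lborel)"
    unfolding I_def by (subst nn_integral_plane_fst) simp_all
  finally have eq: "(\<integral>\<^sup>+z. F z \<partial>lborel) = (\<integral>\<^sup>+t. I t \<partial>lborel)" .
  define L where "L t = ennreal (\<Sum>k\<in>K. D k * (2 * V k t)) * indicator {0<..d} t" for t
  define R where "R t = ennreal (2 * sqrt (1 - t\<^sup>2 / 4)) * indicator {0<..d} t" for t
  have [measurable]: "L \<in> borel_measurable borel" unfolding L_def by measurable
  have le: "I t + L t \<le> R t" for t
  proof (cases "0 < t \<and> t \<le> d")
    case False
    have "F (t + h v, v) = 0" for v
      using crescent_parameter[OF d, of t v] False by (auto simp: F_def h_def indicator_def)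
    then have "I t = 0" by (simp add: I_def)
    then show ?thesis using False by (auto simp: L_def)
  next
    case True
    let ?G = "\<lambda>v. \<Sum>k\<in>K. ennreal (D k) * indicator {v. \<bar>v\<bar> < V k t} v"
    have pw: "F (t + h v, v) + ?G v \<le> indicator {v. \<bar>v\<bar> < sqrt (1 - t\<^sup>2 / 4)} v" for v
    proof (cases "norm (t + h v, v) < 1 \<and> 1 \<le> norm ((t + h v, v) - (d, 0))")
      case in_C: True
      let ?s = "norm (t + h v, v)"
      have G: "?G v = ennreal (\<Sum>k\<in>K. D k * indicator {v. \<bar>v\<bar> < V k t} v)"
        using D by (subst sum_ennreal[symmetric]) (auto simp: ennreal_mult' ennreal_indicator intro!: sum.cong)
      have "(\<Sum>k\<in>K. D k * indicator {v. \<bar>v\<bar> < V k t} v) \<le> (\<Sum>k\<in>K. D k * indicator {..<\<rho> k} ?s)"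
        using V_in[of _ t v] True D by (intro sum_mono mult_left_mono) (auto simp: h_def indicator_def)
      then have "w ?s + (\<Sum>k\<in>K. D k * indicator {v. \<bar>v\<bar> < V k t} v) \<le> 1"
        using w_le[of ?s] in_C by simp
      moreover have "F (t + h v, v) = ennreal (w ?s)" using in_C by (simp add: F_def)
      ultimately have "F (t + h v, v) + ?G v \<le> 1"
        unfolding G using w_le[of ?s] in_C D
        by (simp add: ennreal_plus[symmetric] sum_nonneg del: ennreal_plus)
      then show ?thesis using crescent_parameter(3)[OF d, of t v] in_C by (simp add: h_def)
    next
      case out: False
      \<comment> \<open>The layers contain only points of the crescent: \<rho> k \<le> 1 puts the
        point into the first disk, and t \<le> d keeps it on or beyond the left boundary of the
        second.\<close>
      have "\<not> \<bar>v\<bar> < V k t" if k: "k \<in> K" for k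
      proof
        assume "\<bar>v\<bar> < V k t"
        from V_in[OF k _ _ this] True \<rho>[OF k] have n1: "norm (t + h v, v) < 1" by (simp add: h_def)
        then have "\<bar>v\<bar> < 1" using norm_snd_le[of v "t + h v"] by simp
        then have "v\<^sup>2 < 1" by (simp add: abs_square_less_1)
        then have w: "0 < sqrt (1 - v\<^sup>2)" "(sqrt (1 - v\<^sup>2))\<^sup>2 = 1 - v\<^sup>2" by simp_all
        have "sqrt (1 - v\<^sup>2) \<le> sqrt (1 - v\<^sup>2) + (d - t)" using True by simp
        then have "(sqrt (1 - v\<^sup>2))\<^sup>2 \<le> (sqrt (1 - v\<^sup>2) + (d - t))\<^sup>2"
          using w by (intro power_mono) auto
        then have "1 \<le> (t + h v - d)\<^sup>2 + v\<^sup>2"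
          unfolding w h_def by (simp add: power2_eq_square algebra_simps)
        then have "1 \<le> norm ((t + h v, v) - (d, 0))" by (simp add: norm_prod_def)
        with n1 out show False by simp
      qed
      then have "?G v = 0" by (auto intro!: sum.neutral)
      moreover have "F (t + h v, v) = 0" using out by (auto simp: F_def indicator_def)
      ultimately show ?thesis by simp
    qed
    have "(\<integral>\<^sup>+v. ?G v \<partial>lborel) = (\<Sum>k\<in>K. ennreal (D k) * ennreal (2 * V k t))"
      using V0 by (subst nn_integral_sum) (auto simp: nn_integral_cmult emeasure_lborel_abs_less intro!: sum.cong)
    also have "\<dots> = L t"
      using True V0 D by (subst sum_ennreal[symmetric] | simp add: L_def ennreal_mult')+
    finally have G: "(\<integral>\<^sup>+v. ?G v \<partial>lborel) = L t" .
    have "I t + L t = (\<integral>\<^sup>+v. F (t + h v, v) + ?G v \<partial>lborel)"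
      unfolding I_def G[symmetric] by (subst nn_integral_add) simp_all
    also have "\<dots> \<le> (\<integral>\<^sup>+v. indicator {v. \<bar>v\<bar> < sqrt (1 - t\<^sup>2 / 4)} v \<partial>lborel)"
      by (intro nn_integral_mono pw)
    also have "\<dots> \<le> R t"
    proof (cases "0 \<le> 1 - t\<^sup>2 / 4")
      case True2: True
      then show ?thesis using True by (auto simp: R_def emeasure_lborel_abs_less)
    next
      case False
      \<comment> \<open>The real square root is extended as an odd function, so for t > 2 the
        half-width is negative and the slice empty.\<close>
      then have "sqrt (1 - t\<^sup>2 / 4) < 0" by (simp add: real_sqrt_lt_0_iff)
      then have "\<not> \<bar>v\<bar> < sqrt (1 - t\<^sup>2 / 4)" for v using abs_ge_zero[of v] by linarith
      then have "{v. \<bar>v\<bar> < sqrt (1 - t\<^sup>2 / 4)} = {}" by auto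
      then show ?thesis by simp
    qed
    finally show ?thesis .
  qed
  have "(\<integral>\<^sup>+z. F z \<partial>lborel) + (\<integral>\<^sup>+t. L t \<partial>lborel) = (\<integral>\<^sup>+t. I t + L t \<partial>lborel)"
    unfolding eq by (subst nn_integral_add) simp_all
  also have "\<dots> \<le> (\<integral>\<^sup>+t. R t \<partial>lborel)" by (intro nn_integral_mono le)
  finally show ?thesis unfolding F_def L_def R_def .
qed

section \<open>Polynomial bounds for chords and lunes\<close>

definition chord_poly :: "real \<Rightarrow> real" where
  "chord_poly t = 1 - t\<^sup>2 / 8 - t ^ 4 / 128"

text \<open>The antiderivative of \<open>chord_poly\<close>, which is the Taylor polynomial of sqrt
  (1 - t^2 / 4) up to order 4. The later Taylor coefficients are negative, so for d \<le> 1 the area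
  of the lune of two unit disks at distance d is at most 2 * \<open>lune_poly d\<close>, and the
  checks on the cells stay polynomial.\<close>

definition lune_poly :: "real \<Rightarrow> real" where
  "lune_poly t = t - t ^ 3 / 24 - t ^ 5 / 640"

lemma sqrt_le_chord_poly:
  assumes "0 \<le> t" "t \<le> 1"
  shows "sqrt (1 - t\<^sup>2 / 4) \<le> chord_poly t"
proof -
  have "t\<^sup>2 \<le> 1" "t ^ 4 \<le> 1" using assms by (simp_all add: power_le_one)
  then have nn: "0 \<le> chord_poly t" by (simp add: chord_poly_def)
  have "(chord_poly t)\<^sup>2 - (1 - t\<^sup>2 / 4) = t ^ 6 / 512 + t ^ 8 / 16384"
    unfolding chord_poly_def by (simp add: field_simps power2_eq_square eval_nat_numeral)
  moreover have "0 \<le> t ^ 6 / 512 + t ^ 8 / 16384" by simp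
  ultimately have "1 - t\<^sup>2 / 4 \<le> (chord_poly t)\<^sup>2" by linarith
  then show ?thesis using nn real_le_lsqrt by blast
qed

text \<open>The derivative \<open>chord_poly\<close> decreases on nonnegative arguments, so
  \<open>lune_poly\<close> lies below its tangents there. The tangent at the left end of a cell
  makes the area bound affine on the cell.\<close>

lemma lune_poly_tangent:
  assumes "0 \<le> b" "b \<le> d"
  shows "lune_poly d \<le> lune_poly b + (d - b) * chord_poly b"
proof -
  have "3 * b\<^sup>2 * (d - b) \<le> d ^ 3 - b ^ 3"
  proof -
    have "d ^ 3 - b ^ 3 - 3 * b\<^sup>2 * (d - b) = (d - b)\<^sup>2 * (d + 2 * b)"
      by (simp add: algebra_simps power2_eq_square power3_eq_cube)
    moreover have "0 \<le> (d - b)\<^sup>2 * (d + 2 * b)" using assms by simp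
    ultimately show ?thesis by linarith
  qed
  moreover have "5 * b ^ 4 * (d - b) \<le> d ^ 5 - b ^ 5"
  proof -
    have "d ^ 5 - b ^ 5 - 5 * b ^ 4 * (d - b) = (d - b)\<^sup>2 * (d ^ 3 + 2 * b * d\<^sup>2 + 3 * b\<^sup>2 * d + 4 * b ^ 3)"
      by (simp add: algebra_simps eval_nat_numeral)
    moreover have "0 \<le> (d - b)\<^sup>2 * (d ^ 3 + 2 * b * d\<^sup>2 + 3 * b\<^sup>2 * d + 4 * b ^ 3)" using assms by simp
    ultimately show ?thesis by linarith
  qed
  ultimately show ?thesis unfolding lune_poly_def chord_poly_def
    by (simp add: algebra_simps add_divide_distrib diff_divide_distrib)
qed

lemma nn_integral_chord_poly:
  assumes "0 \<le> d" "d \<le> 1"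
  shows "(\<integral>\<^sup>+t. ennreal (2 * chord_poly t) * indicator {0..d} t \<partial>lborel) = ennreal (2 * lune_poly d)"
proof -
  have nn: "0 \<le> chord_poly t" if "0 \<le> t" "t \<le> d" for t
  proof -
    have "t\<^sup>2 \<le> 1" "t ^ 4 \<le> 1" using assms that by (simp_all add: power_le_one)
    then show ?thesis by (simp add: chord_poly_def)
  qed
  have "(\<integral>\<^sup>+t. ennreal (2 * chord_poly t) * indicator {0..d} t \<partial>lborel)
      = ennreal (2 * lune_poly d - 2 * lune_poly 0)"
  proof (rule nn_integral_FTC_Icc)
    show "(\<lambda>t. 2 * chord_poly t) \<in> borel_measurable borel" unfolding chord_poly_def by measurable
    show "((\<lambda>t. 2 * lune_poly t) has_real_derivative 2 * chord_poly t) (at t)" if "t \<in> {0..d}" for t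
      unfolding lune_poly_def chord_poly_def
      by (auto intro!: derivative_eq_intros simp: algebra_simps power2_eq_square eval_nat_numeral)
  qed (use nn assms in auto)
  then show ?thesis by (simp add: lune_poly_def)
qed

text \<open>At height V the squared norm is 1 + t^2 - 2 * t * w with w = sqrt (1 - V^2), by
  \<open>norm_arc_point\<close>. Being convex in t, it stays below \<rho>^2 on [a, b] if it does so
  at both ends, and a smaller height brings the point nearer to the origin. The end conditions are
  stated in squared form: without roots they can be checked in integers.\<close>

lemma arc_point_in_disk:
  fixes \<rho> V a b t v :: real
  assumes a: "0 < a" and at: "a \<le> t" "t \<le> b" and V: "V \<le> 1" and v: "\<bar>v\<bar> < V" and \<rho>: "0 < \<rho>"
    and Va: "((1 + a\<^sup>2 - \<rho>\<^sup>2) / (2 * a))\<^sup>2 + V\<^sup>2 \<le> 1"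
    and Vb: "((1 + b\<^sup>2 - \<rho>\<^sup>2) / (2 * b))\<^sup>2 + V\<^sup>2 \<le> 1"
  shows "norm (t - sqrt (1 - v\<^sup>2), v) < \<rho>"
proof -
  define w where "w = sqrt (1 - V\<^sup>2)"
  have end_pt: "1 + x\<^sup>2 - 2 * x * w \<le> \<rho>\<^sup>2"
    if "0 < x" "((1 + x\<^sup>2 - \<rho>\<^sup>2) / (2 * x))\<^sup>2 + V\<^sup>2 \<le> 1" for x
  proof -
    have "(1 + x\<^sup>2 - \<rho>\<^sup>2) / (2 * x) \<le> w"
      unfolding w_def using that(2) by (intro real_le_rsqrt) simp
    then show ?thesis using that(1) by (simp add: field_simps)
  qed
  have ea: "1 + a\<^sup>2 - 2 * a * w \<le> \<rho>\<^sup>2" using end_pt[OF a Va] .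
  have eb: "1 + b\<^sup>2 - 2 * b * w \<le> \<rho>\<^sup>2" using end_pt[of b] Vb a at by simp
  have "1 + t\<^sup>2 - 2 * t * w \<le> \<rho>\<^sup>2"
  proof (rule ccontr)
    assume c: "\<not> ?thesis"
    have "(t - a) * (t + a - 2 * w) > 0" "(b - t) * (b + t - 2 * w) < 0"
      using c ea eb by (simp_all add: algebra_simps power2_eq_square)
    then have "t + a - 2 * w > 0" "b + t - 2 * w < 0"
      using at by (auto simp: zero_less_mult_iff mult_less_0_iff)
    then show False using at by linarith
  qed
  moreover have "w < sqrt (1 - v\<^sup>2)"
  proof -
    have "v\<^sup>2 < V\<^sup>2" using v by (metis abs_ge_zero order_le_less_trans power2_abs power_strict_mono zero_less_numeral)
    then show ?thesis by (simp add: w_def)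
  qed
  then have "2 * t * w < 2 * t * sqrt (1 - v\<^sup>2)" using a at by simp
  ultimately have "(norm (t - sqrt (1 - v\<^sup>2), v))\<^sup>2 < \<rho>\<^sup>2"
    using norm_arc_point[of v t] v V by linarith
  then show ?thesis using \<rho> by (rule power2_less_imp_less[OF _ less_imp_le])
qed

section \<open>Crescent integrals for a metric that is affine on cells\<close>

lemma le_ennreal_diffI:
  assumes "x + ennreal b \<le> ennreal u" "0 \<le> b"
  shows "x \<le> ennreal (u - b)"
proof (cases x)
  case (real r)
  then have "ennreal (r + b) \<le> ennreal u" using assms by simp
  then have "r + b \<le> u \<or> r = 0" using assms(2) real
    unfolding ennreal_le_iff2 by linarith
  then show ?thesis using real by (auto intro: ennreal_leI)
next
  case top
  then show ?thesis using assms by (simp add: top_unique)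
qed

text \<open>The drop at radius k / M of the step function that equals c - G j on each cell j < i - 1
  and 0 from radius (i - 1) / M on. The last drop uses the value c at the current distance instead
  of \<open>G (i - 1)\<close>; with it the drops from j + 1 to i - 1 telescope to c - G j, a
  minorant of the gain c - f s on cell j.\<close>

definition drop_weight :: "(nat \<Rightarrow> real) \<Rightarrow> real \<Rightarrow> nat \<Rightarrow> nat \<Rightarrow> real" where
  "drop_weight G c i k = (if k = i - 1 then c else G k) - G (k - 1)"

lemma sum_drop_weight_le:
  fixes f :: "real \<Rightarrow> real" and G :: "nat \<Rightarrow> real" and M :: nat and s :: real
  assumes M: "0 < M" and i: "i < M"
    and fG: "\<And>j. j < M \<Longrightarrow> real j / M \<le> s \<Longrightarrow> s < real (j + 1) / M \<Longrightarrow> f s \<le> G j"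
    and s: "0 \<le> s" "s < 1"
  shows "(\<Sum>k\<in>{1..<i}. drop_weight G c i k * indicator {..<real k / M} s) \<le> max 0 (c - f s)"
proof -
  define j where "j = nat \<lfloor>M * s\<rfloor>"
  have j: "real j \<le> M * s" "M * s < real j + 1" using s M unfolding j_def by (simp_all add: of_nat_nat)
  have "M * s < M" using s M by simp
  then have jM: "j < M" using j by linarith
  have fj: "f s \<le> G j" using fG[OF jM] j M by (simp add: field_simps)
  have ind: "indicator {..<real k / M} s = (if j < k then 1 else (0::real))" for k
  proof -
    have "s < real k / M \<longleftrightarrow> M * s < real k" using M by (simp add: field_simps)
    also have "\<dots> \<longleftrightarrow> j < k" using j by linarith
    finally show ?thesis by simp
  qed
  have tel: "(\<Sum>k\<in>{Suc j..<Suc m}. drop_weight G c (Suc m) k) = c - G j" if jm: "j < m" for m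
  proof -
    obtain m' where m': "m = Suc m'" "j \<le> m'" using jm by (cases m) auto
    have "(\<Sum>k\<in>{Suc j..<Suc m}. drop_weight G c (Suc m) k)
        = (\<Sum>k\<in>{Suc j..<Suc m'}. drop_weight G c (Suc m) k) + (c - G m')"
      using m' by (simp add: drop_weight_def)
    also have "(\<Sum>k\<in>{Suc j..<Suc m'}. drop_weight G c (Suc m) k) = (\<Sum>k\<in>{j..<m'}. G (Suc k) - G k)"
      unfolding sum.shift_bounds_Suc_ivl using m' by (intro sum.cong) (auto simp: drop_weight_def)
    also have "\<dots> = G m' - G j" using m' by (simp add: sum_Suc_diff')
    finally show ?thesis by simp
  qed
  have "(\<Sum>k\<in>{1..<i}. drop_weight G c i k * indicator {..<real k / M} s)
      = (\<Sum>k\<in>{Suc j..<i}. drop_weight G c i k)"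
    unfolding ind by (rule sum.mono_neutral_cong_right) auto
  also have "\<dots> \<le> max 0 (c - f s)"
  proof (cases "Suc j < i")
    case True
    then obtain m where "i = Suc m" "j < m" by (cases i) auto
    then show ?thesis using tel[of m] fj by simp
  qed simp
  finally show ?thesis .
qed

text \<open>Let e be the offset of d = \<open>norm x\<close> from the left end of its cell. All
  terms are replaced by affine functions of e: the lune area by its tangent, f d exactly, and the
  saving from below by omitting its term in e^2. The inequality for all d in the cell then splits
  into one for the value at e = 0, which is \<open>C1\<close>, and one for the slope, which is
  \<open>C2\<close>.\<close>

lemma near_crescent_bound:
  fixes M :: nat and c G :: "nat \<Rightarrow> real" and V :: "nat \<Rightarrow> nat \<Rightarrow> real" and f :: "real \<Rightarrow> real"
    and x :: "real \<times> real"
  assumes M: "0 < M" and Q: "0 < Q"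
    and f: "\<And>i (s::real). i < M \<Longrightarrow> real i / M \<le> s \<Longrightarrow> s < real (i + 1) / M \<Longrightarrow>
        f s = c i + (G i - c i) * (M * s - i)"
    and f_meas[measurable]: "f \<in> borel_measurable borel"
    and cG: "\<And>i. i < M \<Longrightarrow> 0 \<le> c i \<and> c i \<le> G i \<and> G i \<le> 1"
    and G_mono: "\<And>i. Suc i < M \<Longrightarrow> G i \<le> G (Suc i)"
    and G_c: "\<And>i. Suc (Suc i) < M \<Longrightarrow> G i \<le> c (Suc (Suc i))"
    and V0: "\<And>k m. 0 \<le> V k m" and V00: "\<And>m. V 0 m = 0"
    and V: "\<And>k m (y::real). 0 < k \<Longrightarrow> k < M \<Longrightarrow> m < M \<Longrightarrow> 0 < V k m \<Longrightarrow> y \<in> {real m / M, real (m + 1) / M} \<Longrightarrow>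
        0 < y \<and> V k m \<le> 1 \<and> ((1 + y\<^sup>2 - (real k / M)\<^sup>2) / (2 * y))\<^sup>2 + (V k m)\<^sup>2 \<le> 1"
    and C1: "\<And>i. i < M \<Longrightarrow> Q * (lune_poly (real i / M)
        - (\<Sum>k\<in>{1..<i}. drop_weight G (c i) i k * (\<Sum>m<i. V k m)) / M) \<le> c i"
    and C2: "\<And>i. i < M \<Longrightarrow> Q * (chord_poly (real i / M)
        - (\<Sum>k\<in>{1..<i}. drop_weight G (c i) i k * V k i)
        - (G i - c i) * (\<Sum>m<i. V (i - 1) m)) \<le> M * (G i - c i)"
    and x: "norm x < 1"
  shows "(\<integral>\<^sup>+z. indicator {z. norm z < 1 \<and> 1 \<le> norm (z - x)} z
      * ennreal (1 - max 0 (f (norm x) - f (norm z))) \<partial>lborel) \<le> ennreal (2 / Q * f (norm x))"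
proof -
  define d where "d = norm x"
  have d: "0 \<le> d" "d < 1" using x by (simp_all add: d_def)
  define i where "i = nat \<lfloor>M * d\<rfloor>"
  have i: "real i \<le> M * d" "M * d < real i + 1" using d M unfolding i_def by (simp_all add: of_nat_nat)
  have "M * d < M" using d M by simp
  then have iM: "i < M" using i by linarith
  define b where "b = real i / M"
  define e where "e = d - b"
  have bd: "0 \<le> b" "b \<le> d" "0 \<le> e" using i M by (simp_all add: b_def e_def field_simps)
  define \<phi> where "\<phi> = (G i - c i) * (M * e)"
  have fd: "f d = c i + \<phi>"
  proof -
    have "M * e = M * d - i" using M by (simp add: e_def b_def right_diff_distrib)
    moreover have "f d = c i + (G i - c i) * (M * d - i)"
      using i M by (intro f[OF iM]) (simp_all add: field_simps)
    ultimately show ?thesis by (simp add: \<phi>_def)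
  qed
  have \<phi>0: "0 \<le> \<phi>" unfolding \<phi>_def using cG[OF iM] bd by simp
  have fs: "0 \<le> f s \<and> f s \<le> 1 \<and> (\<forall>j<M. real j / M \<le> s \<longrightarrow> s < real (j + 1) / M \<longrightarrow> f s \<le> G j)"
    if s: "0 \<le> s" "s < 1" for s
  proof -
    define j where "j = nat \<lfloor>M * s\<rfloor>"
    have j: "real j \<le> M * s" "M * s < real j + 1" using s M unfolding j_def by (simp_all add: of_nat_nat)
    have "M * s < M" using s M by simp
    then have jM: "j < M" using j by linarith
    have cell: "c l \<le> f s \<and> f s \<le> G l" if "l < M" "real l / M \<le> s" "s < real (l + 1) / M" for l
    proof -
      have u: "0 \<le> M * s - l" "M * s - l \<le> 1" using that M by (simp_all add: field_simps)
      have "(G l - c l) * (M * s - l) \<le> (G l - c l) * 1"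
        using cG[OF that(1)] u by (intro mult_left_mono) auto
      moreover have "0 \<le> (G l - c l) * (M * s - l)" using cG[OF that(1)] u by simp
      ultimately show ?thesis using f[OF that] by simp
    qed
    have "c j \<le> f s \<and> f s \<le> G j" using cell[OF jM] j M by (simp add: field_simps)
    then show ?thesis using cG[OF jM] cell by force
  qed
  define D where "D = drop_weight G (f d) i"
  \<comment> \<open>Compared with the drops for the value \<open>c i\<close> at the left end of the
    cell, only the last one changes, by the increase \<phi> of f inside the cell.\<close>
  have D_eq: "D k = drop_weight G (c i) i k + (if k = i - 1 then \<phi> else 0)" for k
    by (simp add: D_def drop_weight_def fd)
  have Dc0: "0 \<le> drop_weight G (c i) i k" if k: "k \<in> {1..<i}" for k
  proof -
    obtain k' where k': "k = Suc k'" using k by (cases k) auto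
    show ?thesis
    proof (cases "k = i - 1")
      case True
      then have "i = Suc (Suc k')" using k' k by auto
      then show ?thesis using G_c[of k'] iM k' by (simp add: drop_weight_def)
    next
      case False
      then show ?thesis using G_mono[of k'] iM k' k by (auto simp: drop_weight_def)
    qed
  qed
  have D0: "0 \<le> D k" if "k \<in> {1..<i}" for k using Dc0[OF that] \<phi>0 by (simp add: D_eq)
  define W where "W k t = V k (nat \<lfloor>M * t\<rfloor>)" for k and t :: real
  have [measurable]: "W k \<in> borel_measurable borel" for k unfolding W_def by measurable
  have W_cell: "W k t = V k m" if "real m / M \<le> t" "t < real (m + 1) / M" for k t m
  proof -
    have "\<lfloor>M * t\<rfloor> = int m" using that M by (intro floor_unique) (simp_all add: field_simps)
    then show ?thesis by (simp add: W_def)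
  qed
  let ?I = "(\<integral>\<^sup>+z. indicator {z. norm z < 1 \<and> 1 \<le> norm (z - (d, 0::real))} z
      * ennreal (1 - max 0 (f d - f (norm z))) \<partial>lborel)"
  let ?L = "(\<integral>\<^sup>+t. ennreal (\<Sum>k\<in>{1..<i}. D k * (2 * W k t)) * indicator {0<..d} t \<partial>lborel)"
  let ?R = "(\<integral>\<^sup>+t. ennreal (2 * sqrt (1 - t\<^sup>2 / 4)) * indicator {0<..d} t \<partial>lborel)"
  have "?I + ?L \<le> ?R"
  proof (rule crescent_integral_bound[where \<rho> = "\<lambda>k. real k / M"])
    show "0 \<le> 1 - max 0 (f d - f s) \<and>
        1 - max 0 (f d - f s) + (\<Sum>k\<in>{1..<i}. D k * indicator {..<real k / M} s) \<le> 1"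
      if s: "0 \<le> s" "s < 1" for s
    proof -
      have "(\<Sum>k\<in>{1..<i}. D k * indicator {..<real k / M} s) \<le> max 0 (f d - f s)"
        unfolding D_def by (rule sum_drop_weight_le[OF M iM _ s]) (use fs[OF s] in auto)
      then show ?thesis using fs[OF s] fs[OF d] by auto
    qed
    show "norm (t - sqrt (1 - v\<^sup>2), v) < real k / M"
      if k: "k \<in> {1..<i}" and t: "0 < t" "t \<le> d" and v: "\<bar>v\<bar> < W k t" for k t v
    proof -
      define m where "m = nat \<lfloor>M * t\<rfloor>"
      have m: "real m \<le> M * t" "M * t < real m + 1" using t M unfolding m_def by (simp_all add: of_nat_nat)
      have "M * t \<le> M * d" using t M by simp
      then have mM: "m < M" using \<open>M * d < M\<close> m by linarith
      have v': "\<bar>v\<bar> < V k m" using v by (simp add: W_def m_def)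
      then have Vp: "0 < V k m" by linarith
      have kM: "0 < k" "k < M" using k iM by auto
      note V' = V[OF kM mM Vp]
      show ?thesis
      proof (rule arc_point_in_disk)
        show "0 < real m / M" using V'[of "real m / M"] by simp
        show "real m / M \<le> t" "t \<le> real (m + 1) / M" using m M by (simp_all add: field_simps)
        show "V k m \<le> 1" using V'[of "real m / M"] by simp
        show "((1 + (real m / M)\<^sup>2 - (real k / M)\<^sup>2) / (2 * (real m / M)))\<^sup>2 + (V k m)\<^sup>2 \<le> 1"
          using V'[of "real m / M"] by simp
        show "((1 + (real (m + 1) / M)\<^sup>2 - (real k / M)\<^sup>2) / (2 * (real (m + 1) / M)))\<^sup>2 + (V k m)\<^sup>2 \<le> 1"
          using V'[of "real (m + 1) / M"] by simp
      qed (use v' kM M in auto)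
    qed
    show "real k / M \<le> 1" if "k \<in> {1..<i}" for k using that iM M by simp
  qed (use d D0 V0 in \<open>auto simp: W_def\<close>)
  also have "?R \<le> (\<integral>\<^sup>+t. ennreal (2 * chord_poly t) * indicator {0..d} t \<partial>lborel)"
  proof (intro nn_integral_mono)
    fix t show "ennreal (2 * sqrt (1 - t\<^sup>2 / 4)) * indicator {0<..d} t \<le> ennreal (2 * chord_poly t) * indicator {0..d} t"
      using sqrt_le_chord_poly[of t] d by (auto simp: indicator_def intro!: ennreal_leI)
  qed
  also have "\<dots> = ennreal (2 * lune_poly d)" using d by (intro nn_integral_chord_poly) auto
  finally have main: "?I + ?L \<le> ennreal (2 * lune_poly d)" .
  define val where "val m = (\<Sum>k\<in>{1..<i}. D k * (2 * V k m))" for m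
  have val0: "0 \<le> val m" for m unfolding val_def using D0 V0 by (intro sum_nonneg) auto
  \<comment> \<open>The cell of t = 0 must not contribute, since 0 lies outside {0<..d}. A positive
    width there would by \<open>V\<close> force the left end 0 to be positive.\<close>
  have val_0: "val 0 = 0"
  proof -
    have "V k 0 = 0" if "k \<in> {1..<i}" for k
      using V[of k 0 0] V0[of k 0] that iM M by force
    then show ?thesis by (simp add: val_def)
  qed
  let ?B = "(\<Sum>m<i. val m / M) + val i * e"
  have "ennreal ?B \<le> ?L"
  proof -
    have "ennreal ?B = (\<Sum>m<i. ennreal (val m) * ennreal (1 / M)) + ennreal (val i) * ennreal e"
      using val0 bd by (simp add: sum_ennreal ennreal_mult'[symmetric] sum_nonneg ennreal_plus[symmetric] del: ennreal_plus)
    also have "\<dots> = (\<integral>\<^sup>+t. (\<Sum>m<i. ennreal (val m) * indicator {real m / M..<real (m + 1) / M} t)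
        + ennreal (val i) * indicator {b..<d} t \<partial>lborel)"
    proof -
      have cell: "emeasure lborel {real m / M..<real (m + 1) / M} = ennreal (1 / M)" for m
        using M by (subst emeasure_lborel_Ico) (simp_all add: divide_right_mono diff_divide_distrib[symmetric])
      have "(\<integral>\<^sup>+t. (\<Sum>m<i. ennreal (val m) * indicator {real m / M..<real (m + 1) / M} t) \<partial>lborel)
          = (\<Sum>m<i. ennreal (val m) * ennreal (1 / M))"
      proof (subst nn_integral_sum)
        show "(\<Sum>m<i. \<integral>\<^sup>+t. ennreal (val m) * indicator {real m / M..<real (m + 1) / M} t \<partial>lborel)
            = (\<Sum>m<i. ennreal (val m) * ennreal (1 / M))"
          by (rule sum.cong[OF refl], subst nn_integral_cmult_indicator) (simp, simp only: cell)
      qed simp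
      moreover have "(\<integral>\<^sup>+t. ennreal (val i) * indicator {b..<d} t \<partial>lborel) = ennreal (val i) * ennreal e"
        using bd by (simp add: nn_integral_cmult_indicator e_def)
      moreover have "(\<lambda>t. \<Sum>m<i. ennreal (val m) * indicator {real m / M..<real (m + 1) / M} t) \<in> borel_measurable lborel"
        by (intro borel_measurable_sum borel_measurable_times_ennreal borel_measurable_const borel_measurable_indicator) simp
      moreover have "(\<lambda>t. ennreal (val i) * indicator {b..<d} t) \<in> borel_measurable lborel"
        by (intro borel_measurable_times_ennreal borel_measurable_const borel_measurable_indicator) simp
      ultimately show ?thesis by (simp only: nn_integral_add)
    qed
    also have "\<dots> \<le> ?L"
    proof (intro nn_integral_mono)
      fix t :: real
      define m where "m = nat \<lfloor>M * t\<rfloor>"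
      let ?l = "(\<Sum>m<i. ennreal (val m) * indicator {real m / M..<real (m + 1) / M} t)
        + ennreal (val i) * indicator {b..<d} t"
      let ?r = "ennreal (\<Sum>k\<in>{1..<i}. D k * (2 * W k t)) * indicator {0<..d} t"
      show "?l \<le> ?r"
      proof (cases "0 \<le> t \<and> t < d")
        case False
        have "t \<notin> {real m / M..<real (m + 1) / M}" if "m < i" for m
        proof
          assume a: "t \<in> {real m / M..<real (m + 1) / M}"
          have "real (m + 1) / M \<le> real i / M" using that M by (intro divide_right_mono) auto
          with a bd have "t < d" by (auto simp: b_def)
          moreover have "0 \<le> t" using a by (meson atLeastLessThan_iff divide_nonneg_nonneg of_nat_0_le_iff order_trans)
          ultimately show False using False by simp
        qed
        moreover have "t \<notin> {b..<d}" using False bd by auto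
        ultimately show ?thesis by simp
      next
        case True
        have m: "real m \<le> M * t" "M * t < real m + 1" using True M unfolding m_def by (simp_all add: of_nat_nat)
        have "M * t < M * d" using True M by simp
        then have mi: "m \<le> i" using m i by linarith
        have cell: "t \<in> {real l / M..<real (l + 1) / M} \<longleftrightarrow> l = m" for l
        proof -
          have "t \<in> {real l / M..<real (l + 1) / M} \<longleftrightarrow> real l \<le> M * t \<and> M * t < real l + 1"
            using M by (simp add: field_simps)
          also have "\<dots> \<longleftrightarrow> l = m" using m by linarith
          finally show ?thesis .
        qed
        have W: "(\<Sum>k\<in>{1..<i}. D k * (2 * W k t)) = val m" by (simp add: W_def val_def m_def)
        have l: "?l = ennreal (val m)"
        proof (cases "m = i")
          case eq: True
          have "(\<Sum>m<i. ennreal (val m) * indicator {real m / M..<real (m + 1) / M} t) = 0"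
            using cell eq by (intro sum.neutral) (auto simp: indicator_def)
          moreover have "t \<in> {b..<d}" using True cell[of i] eq by (auto simp: b_def)
          ultimately show ?thesis using eq by simp
        next
          case False
          then have mlt: "m < i" using mi by simp
          have "(\<Sum>l<i. ennreal (val l) * indicator {real l / M..<real (l + 1) / M} t) = ennreal (val m)"
            unfolding indicator_def cell using mlt by (simp add: if_distrib sum.delta cong: if_cong)
          moreover have "t < b"
          proof -
            have "real (m + 1) / M \<le> real i / M" using mlt M by (intro divide_right_mono) auto
            then show ?thesis using cell[of m] by (auto simp: b_def)
          qed
          ultimately show ?thesis by simp
        qed
        show ?thesis
        proof (cases "t = 0")
          case t0: True
          then have "m = 0" by (simp add: m_def)
          then have "?l = 0" using l val_0 by (simp only: ennreal_0)
          then show ?thesis by (simp only: zero_le)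
        next
          case False
          then show ?thesis unfolding l W using True by simp
        qed
      qed
    qed
    finally show ?thesis .
  qed
  then have "?I + ennreal ?B \<le> ennreal (2 * lune_poly d)" using main by (meson add_left_mono order_trans)
  moreover have B0: "0 \<le> ?B" using val0 bd by (intro add_nonneg_nonneg sum_nonneg) auto
  ultimately have "?I \<le> ennreal (2 * lune_poly d - ?B)"
    by (rule le_ennreal_diffI)
  also have "\<dots> \<le> ennreal (2 / Q * f d)"
  proof (intro ennreal_leI)
    define S where "S k = (\<Sum>m<i. V k m)" for k
    define A1 where "A1 = (\<Sum>k\<in>{1..<i}. drop_weight G (c i) i k * S k)"
    define A2 where "A2 = (\<Sum>k\<in>{1..<i}. drop_weight G (c i) i k * V k i)"
    have S0: "0 \<le> S k" for k unfolding S_def using V0 by (intro sum_nonneg) auto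
    have s1: "(\<Sum>m<i. val m / M) = 2 * (\<Sum>k\<in>{1..<i}. D k * S k) / M"
      unfolding val_def S_def sum_divide_distrib[symmetric]
      by (subst sum.swap) (simp add: sum_distrib_left sum_divide_distrib algebra_simps)
    have s2: "(\<Sum>k\<in>{1..<i}. D k * S k) = A1 + \<phi> * S (i - 1)"
    proof (cases "2 \<le> i")
      case True
      have "(\<Sum>k\<in>{1..<i}. (if k = i - 1 then \<phi> else 0) * S k) = \<phi> * S (i - 1)"
        using True by (subst sum.remove[of _ "i - 1"]) auto
      then show ?thesis unfolding D_eq A1_def by (simp add: distrib_right sum.distrib)
    next
      case False
      \<comment> \<open>For i \<le> 1 there are no drops, and the truncated difference i - 1 selects
        the column 0, which \<open>V00\<close> makes vanish.\<close>
      then have "i - 1 = 0" by simp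
      then have "S (i - 1) = 0" by (simp only: S_def V00 sum.neutral_const)
      then show ?thesis using False by (simp add: A1_def)
    qed
    \<comment> \<open>The omitted part of \<open>val i\<close> is proportional to \<phi>, hence to
      e, and \<open>val i\<close> is itself multiplied by e: this is the quadratic term.\<close>
    have s3: "2 * A2 \<le> val i"
      unfolding val_def A2_def sum_distrib_left
      by (intro sum_mono) (use \<phi>0 V0 in \<open>auto simp: D_eq distrib_right\<close>)
    have "2 * A1 / M + 2 * (\<phi> * S (i - 1)) / M + 2 * A2 * e \<le> ?B"
      unfolding s1 s2 using mult_right_mono[OF s3, of e] bd by (simp add: distrib_left add_divide_distrib)
    moreover have "2 * (\<phi> * S (i - 1)) / M = 2 * ((G i - c i) * e * S (i - 1))" using M by (simp add: \<phi>_def)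
    ultimately have B: "2 * A1 / M + 2 * ((G i - c i) * e * S (i - 1)) + 2 * A2 * e \<le> ?B"
      by (simp only:)
    have U: "lune_poly d \<le> lune_poly b + e * chord_poly b"
      using lune_poly_tangent[OF bd(1,2)] by (simp add: e_def)
    have c1: "Q * (lune_poly b - A1 / M) \<le> c i" using C1[OF iM] by (simp add: b_def A1_def S_def)
    have c2: "Q * (chord_poly b - A2 - (G i - c i) * S (i - 1)) \<le> M * (G i - c i)"
      using C2[OF iM] by (simp add: b_def A2_def S_def)
    have "Q * (2 * lune_poly d - ?B)
        \<le> Q * (2 * (lune_poly b - A1 / M) + 2 * (e * (chord_poly b - A2 - (G i - c i) * S (i - 1))))"
      using B U Q by (intro mult_left_mono) (auto simp: algebra_simps)
    also have "\<dots> = 2 * (Q * (lune_poly b - A1 / M)) + 2 * e * (Q * (chord_poly b - A2 - (G i - c i) * S (i - 1)))"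
      by (simp add: algebra_simps)
    also have "\<dots> \<le> 2 * c i + 2 * e * (M * (G i - c i))"
      using c1 c2 bd by (intro add_mono mult_left_mono) auto
    also have "\<dots> = 2 * f d" by (simp add: fd \<phi>_def)
    finally show "2 * lune_poly d - ?B \<le> 2 / Q * f d" using Q by (simp add: field_simps)
  qed
  finally have "?I \<le> ennreal (2 / Q * f d)" .
  moreover have "(\<integral>\<^sup>+z. indicator {z. norm z < 1 \<and> 1 \<le> norm (z - x)} z
      * ennreal (1 - max 0 (f (norm x) - f (norm z))) \<partial>lborel) = ?I"
  proof -
    define k where "k = (\<lambda>s u::real. indicator {(s, u). s < 1 \<and> 1 \<le> u} (s, u)
      * ennreal (1 - max 0 (f d - f s)))"
    have "(\<lambda>p. k (fst p) (snd p)) \<in> borel_measurable borel"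
      unfolding k_def by measurable
    from nn_integral_two_norms[OF this, of x] show ?thesis
      by (simp add: k_def d_def indicator_def)
  qed
  ultimately show ?thesis by (simp add: d_def)
qed

section \<open>Radial integrals over the unit disk\<close>

lemma emeasure_ball_plane:
  fixes c :: "real \<times> real"
  assumes "0 \<le> r"
  shows "emeasure lborel (ball c r) = ennreal (pi * r\<^sup>2)" "emeasure lborel (cball c r) = ennreal (pi * r\<^sup>2)"
  using assms by (simp_all add: emeasure_ball emeasure_cball unit_ball_vol_2 power2_eq_square)

text \<open>Polar coordinates for radial functions. The law of \<open>norm\<close> on the disk and
  the density 2 * pi * s on [0, 1] agree on half-lines, as both give pi - pi * x^2, the area of the
  annulus outside radius x, and half-lines of finite measure determine a measure.\<close>

lemma nn_integral_norm_unit_disk: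
  fixes \<phi> :: "real \<Rightarrow> ennreal"
  assumes [measurable]: "\<phi> \<in> borel_measurable borel"
  shows "(\<integral>\<^sup>+z. indicator {z. norm z < 1} z * \<phi> (norm z) \<partial>(lborel :: (real \<times> real) measure))
    = (\<integral>\<^sup>+s. ennreal (2 * pi * s) * indicator {0..1} s * \<phi> s \<partial>lborel)"
proof -
  let ?A = "distr (density (lborel :: (real \<times> real) measure) (indicator {z. norm z < 1})) borel norm"
  let ?B = "density lborel (\<lambda>s. ennreal (2 * pi * s) * indicator {0..1} s)"
  have int: "(\<integral>\<^sup>+s. ennreal (2 * pi * s) * indicator {a..1} s \<partial>lborel) = ennreal (pi * 1\<^sup>2 - pi * a\<^sup>2)"
    if "0 \<le> a" "a \<le> 1" for a
    by (rule nn_integral_FTC_Icc) (use that in \<open>auto intro!: derivative_eq_intros\<close>)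
  have A: "emeasure ?A {x<..} = emeasure lborel (ball (0::real\<times>real) 1 - cball 0 x)" for x
  proof -
    have S: "(norm -` {x<..} :: (real\<times>real) set) \<in> sets borel"
      using measurable_sets[of norm "borel :: (real\<times>real) measure" borel "{x<..}"] by simp
    have "emeasure ?A {x<..} = emeasure (density (lborel :: (real \<times> real) measure) (indicator {z. norm z < 1})) (norm -` {x<..})"
      by (subst emeasure_distr) simp_all
    also have "\<dots> = (\<integral>\<^sup>+z. indicator {z. norm z < 1} z * indicator (norm -` {x<..}) z \<partial>(lborel :: (real \<times> real) measure))"
      by (rule emeasure_density) (use S in simp_all)
    also have "\<dots> = (\<integral>\<^sup>+z. indicator (ball (0::real\<times>real) 1 - cball 0 x) z \<partial>lborel)"
      by (rule nn_integral_cong) (auto simp: indicator_def)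
    finally show ?thesis by simp
  qed
  have eq: "emeasure ?A {x<..} = emeasure ?B {x<..}" for x
  proof -
    have B: "emeasure ?B {x<..} = (\<integral>\<^sup>+s. ennreal (2 * pi * s) * indicator {max 0 x..1} s \<partial>lborel)"
    proof -
      have "emeasure ?B {x<..} = (\<integral>\<^sup>+s. ennreal (2 * pi * s) * indicator {0..1} s * indicator {x<..} s \<partial>lborel)"
        by (rule emeasure_density) simp_all
      also have "\<dots> = (\<integral>\<^sup>+s. ennreal (2 * pi * s) * indicator {max 0 x..1} s \<partial>lborel)"
      proof (rule nn_integral_cong_AE)
        show "AE s in lborel. ennreal (2 * pi * s) * indicator {0..1} s * indicator {x<..} s
            = ennreal (2 * pi * s) * indicator {max 0 x..1} s"
          using AE_lborel_singleton[of x] by eventually_elim (auto simp: indicator_def)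
      qed
      finally show ?thesis .
    qed
    consider "x < 0" | "0 \<le> x" "x \<le> 1" | "1 < x" by linarith
    then show ?thesis
    proof cases
      case 1
      then have "ball (0::real\<times>real) 1 - cball 0 x = ball 0 1" by auto
      then show ?thesis unfolding A B using 1 int[of 0] by (simp add: emeasure_ball_plane)
    next
      case 2
      have "emeasure lborel (ball (0::real\<times>real) 1 - cball 0 x) = ennreal pi - ennreal (pi * x\<^sup>2)"
      proof (cases "x = 1")
        case True
        then have "ball (0::real\<times>real) 1 - cball 0 x = {}" by auto
        then have "emeasure lborel (ball (0::real\<times>real) 1 - cball 0 x) = 0" by (simp only: emeasure_empty)
        then show ?thesis using True by simp
      next
        case False
        then have "cball (0::real\<times>real) x \<subseteq> ball 0 1" using 2 by auto
        then show ?thesis using 2 by (subst emeasure_Diff) (auto simp: emeasure_ball_plane)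
      qed
      also have "\<dots> = ennreal (pi - pi * x\<^sup>2)" by (simp add: ennreal_minus)
      finally show ?thesis unfolding A B using 2 int[of x] by simp
    next
      case 3
      then have "ball (0::real\<times>real) 1 - cball 0 x = {}" by auto
      then have "emeasure lborel (ball (0::real\<times>real) 1 - cball 0 x) = 0" by (simp only: emeasure_empty)
      moreover have "{max 0 x..1} = {}" using 3 by auto
      ultimately show ?thesis unfolding A B by simp
    qed
  qed
  have AB: "?A = ?B"
  proof (rule measure_eqI_lessThan)
    fix x
    have "emeasure ?A {x<..} \<le> emeasure lborel (ball (0::real\<times>real) 1)"
      unfolding A by (intro emeasure_mono) auto
    then show "emeasure ?A {x<..} < \<infinity>" by (simp add: emeasure_ball_plane order_le_less_trans)
  qed (use eq in auto)
  have "(\<integral>\<^sup>+z. indicator {z. norm z < 1} z * \<phi> (norm z) \<partial>(lborel :: (real \<times> real) measure)) = (\<integral>\<^sup>+s. \<phi> s \<partial>?A)"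
    by (simp add: nn_integral_distr nn_integral_density)
  also have "\<dots> = (\<integral>\<^sup>+s. ennreal (2 * pi * s) * indicator {0..1} s * \<phi> s \<partial>lborel)"
    unfolding AB by (simp add: nn_integral_density)
  finally show ?thesis .
qed

text \<open>This serves the distances d \<ge> 1. There the metric has reached 1, so the weight 1 -
  max 0 (1 - f s) is f s itself, and the crescent is bounded by the whole disk.\<close>

lemma far_disk_bound:
  fixes M :: nat and c G :: "nat \<Rightarrow> real" and f :: "real \<Rightarrow> real"
  assumes M: "0 < M"
    and f: "\<And>i (s::real). i < M \<Longrightarrow> real i / M \<le> s \<Longrightarrow> s < real (i + 1) / M \<Longrightarrow>
        f s = c i + (G i - c i) * (M * s - i)"
    and f_meas[measurable]: "f \<in> borel_measurable borel"
    and cG: "\<And>i. i < M \<Longrightarrow> 0 \<le> c i \<and> c i \<le> G i"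
  shows "(\<integral>\<^sup>+z. indicator {z. norm z < 1} z * ennreal (f (norm z)) \<partial>(lborel :: (real \<times> real) measure))
    \<le> ennreal (pi / M\<^sup>2 * (\<Sum>i<M. c i * (2 * real i + 1) + (G i - c i) * (real i + 2 / 3)))"
proof -
  define F where "F i s = pi * (c i * s\<^sup>2 + (G i - c i) * (s ^ 3 * (M * (2 / 3)) - i * s\<^sup>2))" for i and s :: real
  let ?f = "\<lambda>i s::real. 2 * pi * s * (c i + (G i - c i) * (M * s - i))"
  have cell: "(\<integral>\<^sup>+s. ennreal (?f i s) * indicator {real i / M..real (i + 1) / M} s \<partial>lborel)
      = ennreal (pi / M\<^sup>2 * (c i * (2 * real i + 1) + (G i - c i) * (real i + 2 / 3)))" if i: "i < M" for i
  proof -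
    have "(\<integral>\<^sup>+s. ennreal (?f i s) * indicator {real i / M..real (i + 1) / M} s \<partial>lborel)
      = ennreal (F i (real (i + 1) / M) - F i (real i / M))"
    proof (rule nn_integral_FTC_Icc)
      show "(F i has_real_derivative ?f i s) (at s)" for s
        unfolding F_def
        by (rule derivative_eq_intros refl)+ (simp add: algebra_simps power2_eq_square)
      show "0 \<le> ?f i s" if "s \<in> {real i / M..real (i + 1) / M}" for s
      proof -
        have "real i / M \<le> s" using that by simp
        then have "0 \<le> M * s - i" "0 \<le> s" using M
          by (simp_all add: field_simps) (meson divide_nonneg_nonneg of_nat_0_le_iff order_trans \<open>real i / M \<le> s\<close>)
        then show ?thesis using cG[OF i] by simp
      qed
      show "real i / M \<le> real (i + 1) / M" by (intro divide_right_mono) auto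
    qed measurable
    also have "F i (real (i + 1) / M) - F i (real i / M)
        = pi / M\<^sup>2 * (c i * (2 * real i + 1) + (G i - c i) * (real i + 2 / 3))"
      unfolding F_def using M by (simp add: field_simps power2_eq_square power3_eq_cube)
    finally show ?thesis .
  qed
  have "(\<integral>\<^sup>+z. indicator {z. norm z < 1} z * ennreal (f (norm z)) \<partial>(lborel :: (real \<times> real) measure))
      = (\<integral>\<^sup>+s. ennreal (2 * pi * s) * indicator {0..1} s * ennreal (f s) \<partial>lborel)"
    by (rule nn_integral_norm_unit_disk) measurable
  also have "\<dots> \<le> (\<integral>\<^sup>+s. (\<Sum>i<M. ennreal (?f i s) * indicator {real i / M..real (i + 1) / M} s) \<partial>lborel)"
  proof (rule nn_integral_mono_AE, use AE_lborel_singleton[of "1::real"] in eventually_elim)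
    fix s :: real assume s1: "s \<noteq> 1"
    show "ennreal (2 * pi * s) * indicator {0..1} s * ennreal (f s)
        \<le> (\<Sum>i<M. ennreal (?f i s) * indicator {real i / M..real (i + 1) / M} s)"
    proof (cases "0 \<le> s \<and> s < 1")
      case False then show ?thesis using s1 by (auto simp: indicator_def)
    next
      case s: True
      define j where "j = nat \<lfloor>M * s\<rfloor>"
      have j: "real j \<le> M * s" "M * s < real j + 1" using s M unfolding j_def by (simp_all add: of_nat_nat)
      have "M * s < M" using s M by simp
      then have jM: "j < M" using j by linarith
      have c: "real j / M \<le> s" "s < real (j + 1) / M" using j M by (simp_all add: field_simps)
      have "ennreal (2 * pi * s) * ennreal (f s) = ennreal (?f j s)"
        using s f[OF jM c] by (simp add: ennreal_mult'[symmetric])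
      also have "\<dots> = ennreal (?f j s) * indicator {real j / M..real (j + 1) / M} s" using c by simp
      also have "\<dots> \<le> (\<Sum>i<M. ennreal (?f i s) * indicator {real i / M..real (i + 1) / M} s)"
        using jM by (intro member_le_sum) auto
      finally show ?thesis using s by simp
    qed
  qed
  also have "\<dots> = (\<Sum>i<M. ennreal (pi / M\<^sup>2 * (c i * (2 * real i + 1) + (G i - c i) * (real i + 2 / 3))))"
    by (subst nn_integral_sum) (simp, rule sum.cong[OF refl], rule cell, simp)
  also have "\<dots> = ennreal (\<Sum>i<M. pi / M\<^sup>2 * (c i * (2 * real i + 1) + (G i - c i) * (real i + 2 / 3)))"
    using cG by (intro sum_ennreal) auto
  also have "(\<Sum>i<M. pi / M\<^sup>2 * (c i * (2 * real i + 1) + (G i - c i) * (real i + 2 / 3)))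
      = pi / M\<^sup>2 * (\<Sum>i<M. c i * (2 * real i + 1) + (G i - c i) * (real i + 2 / 3))"
    by (simp add: sum_distrib_left)
  finally show ?thesis .
qed

subsection \<open>The tabulated cost function\<close>

text \<open>
  The \<open>i\<close>-th entry \<open>(c, g, vs)\<close> belongs to the cell \<open>[i/64, (i + 1)/64)\<close>. On it the metric increases
  linearly from \<open>c/10000\<close> to \<open>g/10000\<close>; the numbers \<open>v/100\<close> for \<open>v\<close> in \<open>vs\<close> bound from below the
  half-width of the arc on which the circle of centre \<open>(t, 0)\<close>, \<open>t\<close> in the cell, runs inside the
  disk of radius \<open>k/64\<close>, \<open>k = 65 - i, \<dots>, 63\<close>. The values are a numerical solution of the integral
  equation for the optimal metric, rounded up.
\<close>

definition cells :: "(int \<times> int \<times> int list) list" where "cells = [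
  (1, 162, []),
  (161, 322, []),
  (322, 483, [85]),
  (483, 644, [73, 93]),
  (644, 805, [64, 85, 96]),
  (805, 966, [58, 78, 90, 97]),
  (965, 1126, [53, 72, 84, 92, 97]),
  (1126, 1287, [49, 67, 79, 88, 94, 98]),
  (1287, 1448, [45, 62, 74, 83, 90, 95, 98]),
  (1447, 1608, [42, 59, 70, 79, 86, 91, 95, 98]),
  (1608, 1769, [40, 56, 67, 75, 82, 88, 92, 96, 98]),
  (1768, 1929, [38, 53, 64, 72, 79, 85, 89, 93, 96, 98]),
  (1928, 2089, [36, 50, 61, 69, 76, 82, 86, 90, 94, 96, 98]),
  (2088, 2249, [34, 48, 58, 66, 73, 79, 84, 88, 91, 94, 96, 98]),
  (2248, 2408, [33, 46, 56, 64, 70, 76, 81, 85, 89, 92, 94, 96, 98]),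
  (2408, 2568, [31, 44, 53, 61, 68, 73, 78, 82, 86, 89, 92, 94, 96, 98]),
  (2568, 2728, [30, 42, 51, 59, 65, 71, 76, 80, 84, 87, 90, 93, 95, 96, 98]),
  (2727, 2887, [29, 41, 49, 57, 63, 68, 73, 78, 81, 85, 88, 90, 93, 95, 96, 98]),
  (2887, 3047, [28, 39, 48, 55, 61, 66, 71, 75, 79, 83, 86, 88, 91, 93, 95, 96, 97]),
  (3046, 3206, [27, 38, 46, 53, 59, 64, 69, 73, 77, 80, 83, 86, 89, 91, 93, 95, 96, 97]),
  (3205, 3364, [26, 36, 44, 51, 57, 62, 67, 71, 75, 78, 81, 84, 87, 89, 91, 93, 95, 96, 97]),
  (3364, 3523, [25, 35, 43, 49, 55, 60, 65, 69, 73, 76, 79, 82, 85, 87, 89, 91, 93, 95, 96, 97]),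
  (3522, 3681, [24, 34, 42, 48, 53, 58, 63, 67, 71, 74, 77, 80, 83, 85, 88, 90, 92, 93, 95, 96,
    97]),
  (3681, 3840, [23, 33, 40, 46, 52, 57, 61, 65, 69, 72, 75, 78, 81, 83, 86, 88, 90, 92, 93, 95, 96,
    97]),
  (3839, 3998, [22, 32, 39, 45, 50, 55, 59, 63, 67, 70, 73, 76, 79, 82, 84, 86, 88, 90, 92, 93, 94,
    96, 97]),
  (3997, 4155, [22, 31, 38, 44, 49, 53, 58, 61, 65, 68, 71, 74, 77, 80, 82, 84, 86, 88, 90, 92, 93,
    94, 96, 97]),
  (4155, 4313, [21, 30, 37, 42, 47, 52, 56, 60, 63, 67, 70, 73, 75, 78, 80, 83, 85, 87, 88, 90, 92,
    93, 94, 95, 96]),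
  (4312, 4470, [20, 29, 35, 41, 46, 50, 54, 58, 62, 65, 68, 71, 73, 76, 78, 81, 83, 85, 87, 88, 90,
    92, 93, 94, 95, 96]),
  (4469, 4626, [20, 28, 34, 40, 45, 49, 53, 57, 60, 63, 66, 69, 72, 74, 77, 79, 81, 83, 85, 87, 89,
    90, 91, 93, 94, 95, 96]),
  (4626, 4783, [19, 27, 33, 39, 43, 48, 51, 55, 58, 62, 64, 67, 70, 73, 75, 77, 79, 81, 83, 85, 87,
    89, 90, 91, 93, 94, 95, 96]),
  (4782, 4939, [18, 26, 32, 37, 42, 46, 50, 53, 57, 60, 63, 66, 68, 71, 73, 75, 78, 80, 82, 84, 85,
    87, 89, 90, 91, 93, 94, 95, 96]),
  (4939, 5096, [18, 25, 31, 36, 41, 45, 49, 52, 55, 58, 61, 64, 67, 69, 72, 74, 76, 78, 80, 82, 84,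
    85, 87, 88, 90, 91, 92, 93, 95, 95]),
  (5095, 5251, [17, 25, 30, 35, 40, 44, 47, 51, 54, 57, 60, 62, 65, 67, 70, 72, 74, 76, 78, 80, 82,
    84, 85, 87, 88, 90, 91, 92, 93, 94, 95]),
  (5250, 5406, [17, 24, 30, 34, 39, 42, 46, 49, 52, 55, 58, 61, 63, 66, 68, 70, 73, 75, 77, 79, 80,
    82, 84, 85, 87, 88, 90, 91, 92, 93, 94, 95]),
  (5404, 5557, [16, 23, 29, 33, 37, 41, 45, 48, 51, 54, 57, 59, 62, 64, 67, 69, 71, 73, 75, 77, 79,
    81, 82, 84, 85, 87, 88, 89, 91, 92, 93, 94, 95]),
  (5555, 5704, [16, 22, 28, 32, 36, 40, 43, 47, 50, 52, 55, 58, 60, 63, 65, 67, 69, 71, 73, 75, 77,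
    79, 81, 82, 84, 85, 87, 88, 89, 90, 92, 93, 94, 95]),
  (5702, 5847, [15, 22, 27, 31, 35, 39, 42, 45, 48, 51, 54, 56, 59, 61, 63, 66, 68, 70, 72, 74, 76,
    77, 79, 81, 82, 84, 85, 87, 88, 89, 90, 91, 92, 93, 94]),
  (5844, 5985, [15, 21, 26, 30, 34, 38, 41, 44, 47, 50, 52, 55, 57, 60, 62, 64, 66, 68, 70, 72, 74,
    76, 77, 79, 81, 82, 84, 85, 86, 88, 89, 90, 91, 92, 93, 94]),
  (5982, 6118, [14, 20, 25, 29, 33, 37, 40, 43, 46, 48, 51, 53, 56, 58, 60, 63, 65, 67, 69, 71, 72,
    74, 76, 78, 79, 81, 82, 84, 85, 86, 88, 89, 90, 91, 92, 93, 94]),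
  (6116, 6248, [14, 20, 25, 29, 32, 36, 39, 42, 44, 47, 50, 52, 54, 57, 59, 61, 63, 65, 67, 69, 71,
    73, 74, 76, 78, 79, 81, 82, 83, 85, 86, 87, 89, 90, 91, 92, 93, 94]),
  (6244, 6371, [13, 19, 24, 28, 31, 35, 38, 40, 43, 46, 48, 51, 53, 55, 57, 60, 62, 64, 65, 67, 69,
    71, 73, 74, 76, 78, 79, 81, 82, 83, 85, 86, 87, 88, 89, 90, 92, 92, 93]),
  (6368, 6490, [13, 19, 23, 27, 30, 33, 36, 39, 42, 44, 47, 49, 52, 54, 56, 58, 60, 62, 64, 66, 68,
    69, 71, 73, 74, 76, 78, 79, 80, 82, 83, 84, 86, 87, 88, 89, 90, 91, 92, 93]),
  (6487, 6604, [12, 18, 22, 26, 29, 32, 35, 38, 41, 43, 46, 48, 50, 52, 54, 57, 59, 60, 62, 64, 66,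
    68, 70, 71, 73, 74, 76, 77, 79, 80, 82, 83, 84, 85, 87, 88, 89, 90, 91, 92, 93]),
  (6601, 6713, [12, 17, 22, 25, 28, 31, 34, 37, 39, 42, 44, 47, 49, 51, 53, 55, 57, 59, 61, 63, 65,
    66, 68, 70, 71, 73, 74, 76, 77, 79, 80, 82, 83, 84, 85, 86, 88, 89, 90, 91, 92, 93]),
  (6710, 6818, [12, 17, 21, 24, 27, 30, 33, 36, 38, 41, 43, 45, 47, 50, 52, 54, 56, 57, 59, 61, 63,
    65, 66, 68, 70, 71, 73, 74, 76, 77, 79, 80, 81, 83, 84, 85, 86, 87, 88, 89, 90, 91, 92]),
  (6815, 6918, [11, 16, 20, 23, 27, 29, 32, 35, 37, 39, 42, 44, 46, 48, 50, 52, 54, 56, 58, 60, 61,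
    63, 65, 67, 68, 70, 71, 73, 74, 76, 77, 78, 80, 81, 82, 84, 85, 86, 87, 88, 89, 90, 91, 92]),
  (6916, 7015, [11, 16, 19, 23, 26, 28, 31, 34, 36, 38, 40, 43, 45, 47, 49, 51, 53, 55, 56, 58, 60,
    62, 63, 65, 67, 68, 70, 71, 73, 74, 76, 77, 78, 80, 81, 82, 83, 85, 86, 87, 88, 89, 90, 91,
    92]),
  (7012, 7107, [10, 15, 19, 22, 25, 27, 30, 32, 35, 37, 39, 41, 43, 45, 47, 49, 51, 53, 55, 57, 58,
    60, 62, 63, 65, 67, 68, 70, 71, 73, 74, 75, 77, 78, 79, 81, 82, 83, 84, 85, 86, 87, 89, 89, 90,
    91]),
  (7104, 7195, [10, 14, 18, 21, 24, 26, 29, 31, 34, 36, 38, 40, 42, 44, 46, 48, 50, 52, 53, 55, 57,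
    59, 60, 62, 64, 65, 67, 68, 70, 71, 72, 74, 75, 77, 78, 79, 80, 82, 83, 84, 85, 86, 87, 88, 89,
    90, 91]),
  (7192, 7279, [9, 14, 17, 20, 23, 26, 28, 30, 32, 35, 37, 39, 41, 43, 45, 47, 48, 50, 52, 54, 55,
    57, 59, 60, 62, 64, 65, 67, 68, 69, 71, 72, 74, 75, 76, 78, 79, 80, 81, 82, 84, 85, 86, 87, 88,
    89, 90, 91]),
  (7276, 7359, [9, 13, 16, 19, 22, 25, 27, 29, 31, 33, 35, 37, 39, 41, 43, 45, 47, 49, 50, 52, 54,
    56, 57, 59, 60, 62, 63, 65, 66, 68, 69, 71, 72, 73, 75, 76, 77, 79, 80, 81, 82, 83, 84, 85, 87,
    88, 89, 89, 90]),
  (7356, 7436, [9, 13, 16, 19, 21, 24, 26, 28, 30, 32, 34, 36, 38, 40, 42, 44, 45, 47, 49, 51, 52,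
    54, 56, 57, 59, 60, 62, 63, 65, 66, 68, 69, 71, 72, 73, 75, 76, 77, 78, 80, 81, 82, 83, 84, 85,
    86, 87, 88, 89, 90]),
  (7433, 7509, [8, 12, 15, 18, 20, 23, 25, 27, 29, 31, 33, 35, 37, 39, 40, 42, 44, 46, 48, 49, 51,
    53, 54, 56, 57, 59, 60, 62, 63, 65, 66, 68, 69, 70, 72, 73, 74, 76, 77, 78, 79, 80, 82, 83, 84,
    85, 86, 87, 88, 89, 90]),
  (7507, 7580, [8, 11, 14, 17, 19, 22, 24, 26, 28, 30, 32, 34, 36, 37, 39, 41, 43, 44, 46, 48, 49,
    51, 53, 54, 56, 57, 59, 60, 62, 63, 65, 66, 67, 69, 70, 71, 73, 74, 75, 76, 78, 79, 80, 81, 82,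
    83, 84, 85, 86, 87, 88, 89]),
  (7578, 7648, [7, 11, 14, 16, 18, 21, 23, 25, 27, 29, 31, 32, 34, 36, 38, 39, 41, 43, 45, 46, 48,
    49, 51, 53, 54, 56, 57, 59, 60, 62, 63, 64, 66, 67, 68, 70, 71, 72, 74, 75, 76, 77, 79, 80, 81,
    82, 83, 84, 85, 86, 87, 88, 89]),
  (7645, 7712, [7, 10, 13, 15, 18, 20, 22, 24, 26, 27, 29, 31, 33, 35, 36, 38, 40, 41, 43, 45, 46,
    48, 49, 51, 53, 54, 56, 57, 58, 60, 61, 63, 64, 66, 67, 68, 70, 71, 72, 73, 75, 76, 77, 78, 79,
    80, 82, 83, 84, 85, 86, 87, 88, 89]),
  (7710, 7774, [6, 10, 12, 14, 17, 19, 21, 22, 24, 26, 28, 30, 32, 33, 35, 37, 38, 40, 42, 43, 45,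
    46, 48, 49, 51, 52, 54, 55, 57, 58, 60, 61, 63, 64, 65, 67, 68, 69, 71, 72, 73, 74, 75, 77, 78,
    79, 80, 81, 82, 83, 84, 85, 86, 87, 88]),
  (7772, 7833, [6, 9, 11, 14, 16, 18, 19, 21, 23, 25, 27, 28, 30, 32, 34, 35, 37, 38, 40, 42, 43,
    45, 46, 48, 49, 51, 52, 54, 55, 57, 58, 60, 61, 62, 64, 65, 66, 68, 69, 70, 71, 73, 74, 75, 76,
    77, 79, 80, 81, 82, 83, 84, 85, 86, 87, 88]),
  (7831, 7890, [5, 8, 10, 13, 15, 16, 18, 20, 22, 24, 25, 27, 29, 30, 32, 34, 35, 37, 39, 40, 42,
    43, 45, 46, 48, 49, 51, 52, 54, 55, 56, 58, 59, 61, 62, 63, 65, 66, 67, 69, 70, 71, 72, 74, 75,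
    76, 77, 78, 79, 80, 81, 82, 84, 85, 85, 86, 87]),
  (7888, 7945, [5, 7, 10, 12, 14, 15, 17, 19, 21, 22, 24, 26, 27, 29, 31, 32, 34, 35, 37, 39, 40,
    42, 43, 45, 46, 48, 49, 50, 52, 53, 55, 56, 58, 59, 60, 62, 63, 64, 66, 67, 68, 69, 71, 72, 73,
    74, 75, 77, 78, 79, 80, 81, 82, 83, 84, 85, 86, 87]),
  (7942, 7996, [4, 7, 9, 11, 12, 14, 16, 18, 19, 21, 23, 24, 26, 28, 29, 31, 32, 34, 35, 37, 38,
    40, 41, 43, 44, 46, 47, 49, 50, 52, 53, 54, 56, 57, 59, 60, 61, 63, 64, 65, 67, 68, 69, 70, 72,
    73, 74, 75, 76, 77, 78, 80, 81, 82, 83, 84, 85, 86, 87]),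
  (7995, 8047, [4, 6, 8, 10, 11, 13, 15, 16, 18, 20, 21, 23, 24, 26, 28, 29, 31, 32, 34, 35, 37,
    38, 40, 41, 43, 44, 46, 47, 49, 50, 51, 53, 54, 56, 57, 58, 60, 61, 62, 64, 65, 66, 67, 69, 70,
    71, 72, 73, 75, 76, 77, 78, 79, 80, 81, 82, 83, 84, 85, 86]),
  (8045, 8095, [3, 5, 7, 8, 10, 12, 13, 15, 17, 18, 20, 21, 23, 24, 26, 28, 29, 31, 32, 34, 35, 37,
    38, 40, 41, 42, 44, 45, 47, 48, 50, 51, 52, 54, 55, 57, 58, 59, 61, 62, 63, 64, 66, 67, 68, 69,
    71, 72, 73, 74, 75, 76, 78, 79, 80, 81, 82, 83, 84, 85, 86]),
  (8094, 8143, [2, 4, 6, 7, 9, 10, 12, 14, 15, 17, 18, 20, 21, 23, 24, 26, 27, 29, 30, 32, 33, 35,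
    36, 38, 39, 41, 42, 44, 45, 46, 48, 49, 51, 52, 53, 55, 56, 58, 59, 60, 61, 63, 64, 65, 67, 68,
    69, 70, 71, 73, 74, 75, 76, 77, 78, 79, 80, 81, 82, 83, 84, 85])
]"

section \<open>Integer form of the cell inequalities\<close>

fun diff_dot :: "int list \<Rightarrow> int list \<Rightarrow> int" where
  "diff_dot (a # b # as) (s # ss) = (b - a) * s + diff_dot (b # as) ss"
| "diff_dot as ss = 0"

fun last_aligned :: "int list \<Rightarrow> int list \<Rightarrow> int" where
  "last_aligned (a # b # c # as) (s # ss) = last_aligned (b # c # as) ss"
| "last_aligned [a, b] (s # ss) = s"
| "last_aligned as ss = 0"

fun add_lists :: "int list \<Rightarrow> int list \<Rightarrow> int list" where
  "add_lists (a # as) (b # bs) = (a + b) # add_lists as bs"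
| "add_lists as bs = []"

text \<open>The end conditions of \<open>arc_point_in_disk\<close> for height v / 100, radius k / 64
  and the ends i / 64 and (i + 1) / 64, with denominators cleared. An entry 0 claims nothing. The
  final test \<open>k = 64\<close> fixes the length of the row.\<close>

fun arcs_ok :: "int \<Rightarrow> int \<Rightarrow> int list \<Rightarrow> bool" where
  "arcs_ok i k [] = (k = 64)"
| "arcs_ok i k (v # vs) =
    (0 \<le> v \<and> v \<le> 100 \<and> (v = 0 \<or> 0 < i \<and>
      v\<^sup>2 * (4 * i\<^sup>2 * 4096) + 10000 * (4096 + i\<^sup>2 - k\<^sup>2)\<^sup>2 \<le> 10000 * (4 * i\<^sup>2 * 4096) \<and>
      v\<^sup>2 * (4 * (i + 1)\<^sup>2 * 4096) + 10000 * (4096 + (i + 1)\<^sup>2 - k\<^sup>2)\<^sup>2 \<le> 10000 * (4 * (i + 1)\<^sup>2 * 4096))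
    \<and> arcs_ok i (k + 1) vs)"

text \<open>The hypotheses of \<open>near_crescent_bound\<close> for M = 64 with denominators
  cleared: metric values count 1/10000, widths 1/100, Q is 205931 / 200000, and 1920 * 64^5 and 128
  * 64^4 are the denominators of \<open>lune_poly\<close> and \<open>chord_poly\<close> at i / 64.
  The list \<open>l\<close> consists of the upper values of the earlier cells with the last one
  replaced by c, so that its successive differences are the drop weights. \<open>ss\<close> contains
  the widths summed over the earlier cells, \<open>vs\<close> the row of the cell itself, and
  \<open>T\<close> is the entry of \<open>ss\<close> for radius i - 1.\<close>

fun cell_ok :: "int \<Rightarrow> int list \<Rightarrow> int list \<Rightarrow> int list \<Rightarrow> int \<Rightarrow> int \<Rightarrow> bool" where
  "cell_ok i gs ss vs c g = (let l = butlast gs @ [c]; T = last_aligned l ss in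
    0 < c \<and> c \<le> g \<and> g \<le> 10000 \<and>
    (gs \<noteq> [] \<longrightarrow> last gs \<le> g) \<and> (butlast gs \<noteq> [] \<longrightarrow> last (butlast gs) \<le> c) \<and>
    205931 * (10000 * (1920 * 64 ^ 4 * i - 80 * 64\<^sup>2 * i ^ 3 - 3 * i ^ 5) * 100 - diff_dot l ss * (1920 * 64 ^ 4))
      \<le> c * 200000 * (1920 * 64 ^ 5) * 100 \<and>
    205931 * (10000 * (128 * 64 ^ 4 - 16 * 64\<^sup>2 * i\<^sup>2 - i ^ 4) * 100
        - diff_dot l vs * (128 * 64 ^ 4) - (g - c) * T * (128 * 64 ^ 4))
      \<le> 64 * (g - c) * 100 * (128 * 64 ^ 4) * 200000)"

text \<open>The zeros \<open>zs\<close> fill row i at the radii k \<le> 64 - i: at the left end t =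
  i / 64 of the cell, the unit circle about (t, 0) only comes within (64 - i) / 64 of the origin, so
  no arc runs inside these disks. Row 0 starts at 64 because 65 - 0 would demand a list of length
  -1.\<close>

fun cells_ok :: "int \<Rightarrow> int list \<Rightarrow> int list \<Rightarrow> int list \<Rightarrow> (int \<times> int \<times> int list) list \<Rightarrow> bool" where
  "cells_ok i gs ss zs [] = True"
| "cells_ok i gs ss zs ((c, g, vs) # xs) =
    (cell_ok i gs ss (zs @ vs) c g \<and> arcs_ok i (if i = 0 then 64 else 65 - i) vs
      \<and> cells_ok (i + 1) (gs @ [g]) (add_lists ss (zs @ vs)) (tl zs) xs)"

lemma cells_ok_cells: "cells_ok 0 [] (replicate 63 0) (replicate 64 0) cells"
  unfolding cells_def by code_simp

text \<open>The sum of \<open>far_disk_bound\<close> times 30000: the factor 3 clears the fraction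
  2/3, and 10000 is the unit of the table.\<close>

fun radial_sum :: "int \<Rightarrow> (int \<times> int \<times> int list) list \<Rightarrow> int" where
  "radial_sum i [] = 0"
| "radial_sum i ((c, g, vs) # xs) = 3 * c * (2 * i + 1) + (g - c) * (3 * i + 2) + radial_sum (i + 1) xs"

lemma radial_sum_cells: "617932 * radial_sum 0 cells \<le> 382058 * (3 * 4096 * 10000)"
  unfolding cells_def by code_simp

lemma length_cells: "length cells = 64"
  unfolding cells_def by simp

lemma diff_dot_eq:
  "diff_dot as ss = (\<Sum>k<min (length as - 1) (length ss). (as ! Suc k - as ! k) * ss ! k)"
proof (induction as ss rule: diff_dot.induct)
  case (1 a b as s ss)
  have "min (length (a # b # as) - 1) (length (s # ss)) = Suc (min (length (b # as) - 1) (length ss))"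
    by simp
  then show ?case using 1 by (simp only: sum.lessThan_Suc_shift diff_dot.simps) simp
qed simp_all

lemma last_aligned_eq:
  "2 \<le> length as \<Longrightarrow> length as - 2 < length ss \<Longrightarrow> last_aligned as ss = ss ! (length as - 2)"
  by (induction as ss rule: last_aligned.induct) auto

lemma length_add_lists: "length (add_lists as bs) = min (length as) (length bs)"
  by (induction as bs rule: add_lists.induct) auto

lemma nth_add_lists:
  "k < length as \<Longrightarrow> k < length bs \<Longrightarrow> add_lists as bs ! k = as ! k + bs ! k"
proof (induction as bs arbitrary: k rule: add_lists.induct)
  case (1 a as b bs)
  then show ?case by (cases k) auto
qed auto

lemma arcs_okD:
  assumes "arcs_ok i k vs"
  shows "int (length vs) = 64 - k"
    and "j < length vs \<Longrightarrow> arcs_ok i (k + int j) (drop j vs)"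
  using assms
proof (induction vs arbitrary: k j)
  case (Cons v vs)
  {
    case 1
    then show ?case using Cons.IH(1)[of "k + 1"] by simp
  next
    case 2
    then show ?case using Cons.IH(2)[of "j - 1" "k + 1"] by (cases j) (auto simp: algebra_simps)
  }
qed auto

section \<open>From the table to real-valued cell data\<close>

definition cell_lo :: "nat \<Rightarrow> int" where "cell_lo i = fst (cells ! i)"
definition cell_hi :: "nat \<Rightarrow> int" where "cell_hi i = fst (snd (cells ! i))"
definition cell_row :: "nat \<Rightarrow> int list" where
  "cell_row i = replicate (64 - i) 0 @ snd (snd (cells ! i))"

primrec row_sum :: "nat \<Rightarrow> int list" where
  "row_sum 0 = replicate 63 0"
| "row_sum (Suc i) = add_lists (row_sum i) (cell_row i)"

text \<open>The check is one recursion with accumulators. This invariant identifies the accumulators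
  after i rows, which makes the check of each single cell available.\<close>

lemma cells_ok_drop:
  "i \<le> 64 \<Longrightarrow> cells_ok (int i) (map cell_hi [0..<i]) (row_sum i) (replicate (64 - i) 0) (drop i cells)"
proof (induction i)
  case 0
  then show ?case using cells_ok_cells by simp
next
  case (Suc i)
  then have i: "i < length cells" by (simp add: length_cells)
  obtain c g vs where x: "cells ! i = (c, g, vs)" by (cases "cells ! i") auto
  have d: "drop i cells = (c, g, vs) # drop (Suc i) cells"
    using Cons_nth_drop_Suc[OF i] x by simp
  have z: "tl (replicate (64 - i) 0) = replicate (64 - Suc i) (0::int)"
    using Suc.prems by (cases "64 - i") auto
  show ?case using Suc.IH Suc.prems unfolding d
    by (simp add: z cell_hi_def cell_row_def x add.commute)
qed

lemma cell_facts:
  assumes "i < 64"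
  shows "cell_ok (int i) (map cell_hi [0..<i]) (row_sum i) (cell_row i) (cell_lo i) (cell_hi i)"
    and "arcs_ok (int i) (if i = 0 then 64 else 65 - int i) (snd (snd (cells ! i)))"
proof -
  have i: "i < length cells" using assms by (simp add: length_cells)
  obtain c g vs where x: "cells ! i = (c, g, vs)" by (cases "cells ! i") auto
  have d: "drop i cells = (c, g, vs) # drop (Suc i) cells"
    using Cons_nth_drop_Suc[OF i] x by simp
  have ok: "cells_ok (int i) (map cell_hi [0..<i]) (row_sum i) (replicate (64 - i) 0) (drop i cells)"
    using assms by (intro cells_ok_drop) simp
  show "cell_ok (int i) (map cell_hi [0..<i]) (row_sum i) (cell_row i) (cell_lo i) (cell_hi i)"
    using ok unfolding d cells_ok.simps by (simp only: cell_lo_def cell_hi_def cell_row_def x fst_conv snd_conv)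
  show "arcs_ok (int i) (if i = 0 then 64 else 65 - int i) (snd (snd (cells ! i)))"
    using ok unfolding d cells_ok.simps by (simp add: x)
qed

lemma length_arcs: "i < 64 \<Longrightarrow> length (snd (snd (cells ! i))) = i - 1"
  using arcs_okD(1)[OF cell_facts(2)[of i]] by (cases i) auto

lemma length_cell_row: "i < 64 \<Longrightarrow> 63 \<le> length (cell_row i)"
  by (auto simp: cell_row_def length_arcs)

lemma length_row_sum: "i \<le> 64 \<Longrightarrow> length (row_sum i) = 63"
proof (induction i)
  case (Suc i)
  then show ?case using length_cell_row[of i] by (simp add: length_add_lists)
qed simp

text \<open>The value 0 outside the table supplies the vanishing column k = 0 that
  \<open>near_crescent_bound\<close> asks for.\<close>

definition arc_width :: "nat \<Rightarrow> nat \<Rightarrow> real" where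
  "arc_width k m = (if 0 < k \<and> k < 64 \<and> m < 64 then cell_row m ! (k - 1) / 100 else 0)"

lemma cell_row_eq:
  "0 < k \<Longrightarrow> k < 64 \<Longrightarrow> m < 64 \<Longrightarrow> real_of_int (cell_row m ! (k - 1)) = 100 * arc_width k m"
  by (simp add: arc_width_def)

lemma row_sum_eq:
  "0 < k \<Longrightarrow> k < 64 \<Longrightarrow> i \<le> 64 \<Longrightarrow> real_of_int (row_sum i ! (k - 1)) = 100 * (\<Sum>m<i. arc_width k m)"
proof (induction i)
  case (Suc i)
  then show ?case
    using length_row_sum[of i] length_cell_row[of i] cell_row_eq[of k i]
    by (simp add: nth_add_lists distrib_left)
qed simp

lemma arc_width_nonneg: "0 \<le> arc_width k m"
  and arc_width_inside:
    "0 < arc_width k m \<Longrightarrow> y \<in> {real m / 64, real (m + 1) / 64} \<Longrightarrow>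
      0 < y \<and> arc_width k m \<le> 1 \<and> ((1 + y\<^sup>2 - (real k / 64)\<^sup>2) / (2 * y))\<^sup>2 + (arc_width k m)\<^sup>2 \<le> 1"
proof -
  have "0 \<le> arc_width k m \<and> (0 < arc_width k m \<longrightarrow> y \<in> {real m / 64, real (m + 1) / 64} \<longrightarrow>
      0 < y \<and> arc_width k m \<le> 1 \<and> ((1 + y\<^sup>2 - (real k / 64)\<^sup>2) / (2 * y))\<^sup>2 + (arc_width k m)\<^sup>2 \<le> 1)" for y
  proof (cases "0 < k \<and> k < 64 \<and> m < 64 \<and> 64 < k + m")
    case False
    have "cell_row m ! (k - 1) = 0" if "0 < k" "k < 64" "m < 64" "k + m \<le> 64"
      using that by (simp add: cell_row_def nth_append)
    then have "arc_width k m = 0" using False by (auto simp: arc_width_def)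
    then show ?thesis by simp
  next
    case True
    define vs where "vs = snd (snd (cells ! m))"
    \<comment> \<open>Row m lists the radii from 65 - m on, so radius k is its entry k + m - 65.
      Adding first keeps the subtraction on \<open>nat\<close> exact.\<close>
    define j where "j = k + m - 65"
    have m0: "0 < m" using True by linarith
    have "length vs = m - 1" using True length_arcs[of m] by (simp add: vs_def)
    then have j: "j < length vs" using True unfolding j_def by linarith
    have "k - 1 - (64 - m) = j" "\<not> k - 1 < 64 - m" using True by (auto simp: j_def)
    then have row: "cell_row m ! (k - 1) = vs ! j"
      by (simp add: cell_row_def nth_append vs_def)
    have "arcs_ok (int m) (65 - int m) vs"
      using cell_facts(2)[of m] True m0 by (simp add: vs_def)
    from arcs_okD(2)[OF this j] have "arcs_ok (int m) (65 - int m + int j) (drop j vs)" .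
    moreover have "65 - int m + int j = int k" using True by (simp add: j_def)
    moreover have "drop j vs = vs ! j # drop (Suc j) vs" using j by (simp add: Cons_nth_drop_Suc)
    ultimately have ok: "arcs_ok (int m) (int k) (vs ! j # drop (Suc j) vs)" by simp
    define v where "v = vs ! j"
    have v: "arc_width k m = v / 100" using True row by (simp add: arc_width_def v_def)
    have bnd: "0 \<le> v" "v \<le> 100" using ok by (simp_all add: v_def)
    have conv: "((1 + y\<^sup>2 - (real k / 64)\<^sup>2) / (2 * y))\<^sup>2 + (real_of_int v / 100)\<^sup>2 \<le> 1"
      if y: "y = real_of_int x / 64" "0 < x"
        and le: "v\<^sup>2 * (4 * x\<^sup>2 * 4096) + 10000 * (4096 + x\<^sup>2 - (int k)\<^sup>2)\<^sup>2 \<le> 10000 * (4 * x\<^sup>2 * 4096)"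
      for x
    proof -
      have "real_of_int (v\<^sup>2 * (4 * x\<^sup>2 * 4096) + 10000 * (4096 + x\<^sup>2 - (int k)\<^sup>2)\<^sup>2)
          \<le> real_of_int (10000 * (4 * x\<^sup>2 * 4096))"
        using le by (simp only: of_int_le_iff)
      then have le': "(real_of_int v)\<^sup>2 * (4 * (real_of_int x)\<^sup>2 * 4096)
          + 10000 * (4096 + (real_of_int x)\<^sup>2 - (real k)\<^sup>2)\<^sup>2 \<le> 10000 * (4 * (real_of_int x)\<^sup>2 * 4096)"
        by simp
      have e: "((1 + y\<^sup>2 - (real k / 64)\<^sup>2) / (2 * y))\<^sup>2
          = (4096 + (real_of_int x)\<^sup>2 - (real k)\<^sup>2)\<^sup>2 / (4 * (real_of_int x)\<^sup>2 * 4096)"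
      proof -
        have "(1 + y\<^sup>2 - (real k / 64)\<^sup>2) / (2 * y)
            = (4096 + (real_of_int x)\<^sup>2 - (real k)\<^sup>2) / (2 * real_of_int x * 64)"
          unfolding y(1) using y(2) by (simp add: field_simps power2_eq_square)
        then show ?thesis by (simp add: power_divide power_mult_distrib)
      qed
      show ?thesis unfolding e using le' y(2) by (simp add: power_divide field_simps)
    qed
    show ?thesis
    proof (intro conjI impI)
      show "0 \<le> arc_width k m" "arc_width k m \<le> 1" using bnd by (simp_all add: v)
      assume p: "0 < arc_width k m" and y: "y \<in> {real m / 64, real (m + 1) / 64}"
      have "v \<noteq> 0" using p v by auto
      then have ok': "v\<^sup>2 * (4 * (int m)\<^sup>2 * 4096) + 10000 * (4096 + (int m)\<^sup>2 - (int k)\<^sup>2)\<^sup>2 \<le> 10000 * (4 * (int m)\<^sup>2 * 4096)"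
        "v\<^sup>2 * (4 * (int m + 1)\<^sup>2 * 4096) + 10000 * (4096 + (int m + 1)\<^sup>2 - (int k)\<^sup>2)\<^sup>2 \<le> 10000 * (4 * (int m + 1)\<^sup>2 * 4096)"
        using ok unfolding v_def arcs_ok.simps by blast+
      show "0 < y" using y m0 by auto
      from y show "((1 + y\<^sup>2 - (real k / 64)\<^sup>2) / (2 * y))\<^sup>2 + (arc_width k m)\<^sup>2 \<le> 1"
        unfolding v using conv[OF _ _ ok'(1)] conv[OF _ _ ok'(2)] m0 by auto
    qed
  qed
  then show "0 \<le> arc_width k m"
    and "0 < arc_width k m \<Longrightarrow> y \<in> {real m / 64, real (m + 1) / 64} \<Longrightarrow>
      0 < y \<and> arc_width k m \<le> 1 \<and> ((1 + y\<^sup>2 - (real k / 64)\<^sup>2) / (2 * y))\<^sup>2 + (arc_width k m)\<^sup>2 \<le> 1"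
    by blast+
qed

text \<open>It jumps from 0.8143 to 1 at s = 1. Between neighbouring cells it may fall by a few
  units of the table, which is why the checks compare the lower value of a cell only with the upper
  value two cells before it.\<close>

definition disk_metric :: "real \<Rightarrow> real" where
  "disk_metric s = (if 1 \<le> s then 1 else
     let i = nat \<lfloor>64 * s\<rfloor> in (real_of_int (cell_lo i) + real_of_int (cell_hi i - cell_lo i) * (64 * s - real i)) / 10000)"

lemma cell_bounds:
  assumes "i < 64"
  shows "0 < cell_lo i" "cell_lo i \<le> cell_hi i" "cell_hi i \<le> 10000"
    "Suc i < 64 \<Longrightarrow> cell_hi i \<le> cell_hi (Suc i)"
    "Suc (Suc i) < 64 \<Longrightarrow> cell_hi i \<le> cell_lo (Suc (Suc i))"
proof -
  show "0 < cell_lo i" "cell_lo i \<le> cell_hi i" "cell_hi i \<le> 10000"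
    using cell_facts(1)[OF assms] unfolding cell_ok.simps Let_def by auto
  show "cell_hi i \<le> cell_hi (Suc i)" if "Suc i < 64"
    using cell_facts(1)[OF that] unfolding cell_ok.simps Let_def by simp
  have "butlast (map cell_hi [0..<Suc (Suc i)]) = map cell_hi [0..<Suc i]"
    by (simp add: butlast_append)
  then show "cell_hi i \<le> cell_lo (Suc (Suc i))" if "Suc (Suc i) < 64"
    using cell_facts(1)[OF that] unfolding cell_ok.simps Let_def by simp
qed

lemma disk_metric_cell:
  assumes "i < 64" "real i / 64 \<le> s" "s < real (i + 1) / 64"
  shows "disk_metric s = real_of_int (cell_lo i) / 10000 + (cell_hi i / 10000 - cell_lo i / 10000) * (64 * s - i)"
proof -
  have "\<lfloor>64 * s\<rfloor> = int i" using assms by (intro floor_unique) simp_all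
  moreover have "s < 1"
  proof -
    have "real (i + 1) / 64 \<le> 1" using assms(1) by simp
    then show ?thesis using assms(3) by linarith
  qed
  ultimately show ?thesis by (simp add: disk_metric_def add_divide_distrib diff_divide_distrib)
qed

text \<open>The lower bound, valid even at distance 0, comes from the positive integers in the
  table. It later turns an additive error s into at most 10000 * s times the metric.\<close>

lemma disk_metric_bounds:
  assumes "0 \<le> s"
  shows "1 / 10000 \<le> disk_metric s" "disk_metric s \<le> 1"
proof -
  have "1 / 10000 \<le> disk_metric s \<and> disk_metric s \<le> 1"
  proof (cases "1 \<le> s")
    case False
    define i where "i = nat \<lfloor>64 * s\<rfloor>"
    have i: "real i \<le> 64 * s" "64 * s < real i + 1" using assms unfolding i_def by (simp_all add: of_nat_nat)
    then have i64: "i < 64" using False by linarith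
    note e = disk_metric_cell[OF i64, of s]
    have b: "0 < cell_lo i" "cell_lo i \<le> cell_hi i" "cell_hi i \<le> 10000" using cell_bounds[OF i64] by auto
    have "0 \<le> real_of_int (cell_hi i - cell_lo i) * (64 * s - i)" using b i by simp
    moreover have "real_of_int (cell_hi i - cell_lo i) * (64 * s - i) \<le> real_of_int (cell_hi i - cell_lo i) * 1"
      using b i by (intro mult_left_mono) auto
    ultimately show ?thesis using e i b by (simp add: field_simps)
  qed (simp add: disk_metric_def)
  then show "1 / 10000 \<le> disk_metric s" "disk_metric s \<le> 1" by auto
qed

lemma disk_metric_far: "1 \<le> s \<Longrightarrow> disk_metric s = 1"
  by (simp add: disk_metric_def)

lemma borel_measurable_disk_metric [measurable]: "disk_metric \<in> borel_measurable borel"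
  unfolding disk_metric_def Let_def by measurable

lemma diff_dot_drop_weight:
  assumes i: "i < 64" and ss: "63 \<le> length ss"
    and R: "\<And>k. 0 < k \<Longrightarrow> k < i \<Longrightarrow> real_of_int (ss ! (k - 1)) = 100 * R k"
  shows "real_of_int (diff_dot (butlast (map cell_hi [0..<i]) @ [cell_lo i]) ss)
    = 10 ^ 6 * (\<Sum>k\<in>{1..<i}. drop_weight (\<lambda>i. cell_hi i / 10000) (cell_lo i / 10000) i k * R k)"
proof -
  define l where "l = butlast (map cell_hi [0..<i]) @ [cell_lo i]"
  have l: "min (length l - 1) (length ss) = i - 1" using i ss by (simp add: l_def)
  have nth: "l ! k = (if k = i - 1 then cell_lo i else cell_hi k)" if "k \<le> i - 1" for k
    using that i by (auto simp: l_def nth_append nth_butlast)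
  have "real_of_int (diff_dot l ss)
      = (\<Sum>k<i - 1. 10 ^ 6 * (drop_weight (\<lambda>i. cell_hi i / 10000) (cell_lo i / 10000) i (Suc k) * R (Suc k)))"
    unfolding diff_dot_eq l of_int_sum
  proof (rule sum.cong[OF refl])
    fix k assume k: "k \<in> {..<i - 1}"
    have "real_of_int (ss ! k) = 100 * R (Suc k)" using R[of "Suc k"] k by simp
    moreover have "real_of_int (l ! Suc k - l ! k)
        = 10000 * drop_weight (\<lambda>i. cell_hi i / 10000) (cell_lo i / 10000) i (Suc k)"
      using k by (auto simp: nth drop_weight_def right_diff_distrib)
    ultimately show "real_of_int ((l ! Suc k - l ! k) * ss ! k)
        = 10 ^ 6 * (drop_weight (\<lambda>i. cell_hi i / 10000) (cell_lo i / 10000) i (Suc k) * R (Suc k))"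
      by simp
  qed
  also have "\<dots> = 10 ^ 6 * (\<Sum>k\<in>{1..<i}. drop_weight (\<lambda>i. cell_hi i / 10000) (cell_lo i / 10000) i k * R k)"
    (is "(\<Sum>k<i - 1. 10 ^ 6 * ?F (Suc k)) = _")
  proof (cases i)
    case (Suc n)
    have "(\<Sum>k\<in>{1..<Suc n}. ?F k) = (\<Sum>k<n. ?F (Suc k))"
      using sum.shift_bounds_Suc_ivl[of ?F 0 n] by (simp only: One_nat_def lessThan_atLeast0)
    then show ?thesis using Suc by (simp only: sum_distrib_left diff_Suc_1)
  qed simp
  finally show ?thesis by (simp add: l_def)
qed

lemma butlast_cells_last_aligned:
  assumes "i < 64"
  shows "real_of_int (last_aligned (butlast (map cell_hi [0..<i]) @ [cell_lo i]) (row_sum i))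
    = 100 * (\<Sum>m<i. arc_width (i - 1) m)"
proof (cases "2 \<le> i")
  case True
  have e: "i - 1 - 1 = i - 2" by simp
  have "last_aligned (butlast (map cell_hi [0..<i]) @ [cell_lo i]) (row_sum i) = row_sum i ! (i - 2)"
    using True assms length_row_sum[of i] by (subst last_aligned_eq) auto
  then show ?thesis using row_sum_eq[of "i - 1" i] True assms unfolding e by simp
next
  case False
  then have "i = 0 \<or> i = 1" by auto
  then show ?thesis by (auto simp: arc_width_def)
qed

lemma near_disk_metric:
  fixes x :: "real \<times> real"
  assumes "norm x < 1"
  shows "(\<integral>\<^sup>+z. indicator {z. norm z < 1 \<and> 1 \<le> norm (z - x)} z
      * ennreal (1 - max 0 (disk_metric (norm x) - disk_metric (norm z))) \<partial>lborel)
    \<le> ennreal (pi * (382058 / 617932) * disk_metric (norm x))"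
proof -
  let ?c = "\<lambda>i. real_of_int (cell_lo i) / 10000" and ?G = "\<lambda>i. real_of_int (cell_hi i) / 10000"
  let ?Q = "205931 / 200000 :: real"
  have "(\<integral>\<^sup>+z. indicator {z. norm z < 1 \<and> 1 \<le> norm (z - x)} z
      * ennreal (1 - max 0 (disk_metric (norm x) - disk_metric (norm z))) \<partial>lborel)
    \<le> ennreal (2 / ?Q * disk_metric (norm x))"
  proof (rule near_crescent_bound[where M = 64 and c = ?c and G = ?G and V = arc_width])
    show "disk_metric s = ?c i + (?G i - ?c i) * (real 64 * s - real i)"
      if "i < 64" "real i / real 64 \<le> s" "s < real (i + 1) / real 64" for i s
      using disk_metric_cell[of i s] that by simp
    show "0 \<le> ?c i \<and> ?c i \<le> ?G i \<and> ?G i \<le> 1" if "i < 64" for i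
      using cell_bounds(1-3)[OF that] by simp
    show "?G i \<le> ?G (Suc i)" if "Suc i < 64" for i using cell_bounds(4)[of i] that by simp
    show "?G i \<le> ?c (Suc (Suc i))" if "Suc (Suc i) < 64" for i using cell_bounds(5)[of i] that by simp
    show "0 < y \<and> arc_width k m \<le> 1 \<and> ((1 + y\<^sup>2 - (real k / real 64)\<^sup>2) / (2 * y))\<^sup>2 + (arc_width k m)\<^sup>2 \<le> 1"
      if "0 < arc_width k m" "y \<in> {real m / real 64, real (m + 1) / real 64}" for k m y
      using arc_width_inside[of k m y] that by simp
    show "?Q * (lune_poly (real i / real 64) - (\<Sum>k\<in>{1..<i}. drop_weight ?G (?c i) i k * (\<Sum>m<i. arc_width k m)) / real 64) \<le> ?c i"
      if i: "i < 64" for i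
    proof -
      define D where "D = (\<Sum>k\<in>{1..<i}. drop_weight ?G (?c i) i k * (\<Sum>m<i. arc_width k m))"
      define dd where "dd = diff_dot (butlast (map cell_hi [0..<i]) @ [cell_lo i]) (row_sum i)"
      have dd: "real_of_int dd = 10 ^ 6 * D"
        unfolding dd_def D_def using i length_row_sum[of i] row_sum_eq by (intro diff_dot_drop_weight) auto
      have "205931 * (10000 * (1920 * 64 ^ 4 * int i - 80 * 64\<^sup>2 * int i ^ 3 - 3 * int i ^ 5) * 100 - dd * (1920 * 64 ^ 4))
          \<le> cell_lo i * 200000 * (1920 * 64 ^ 5) * 100"
        using cell_facts(1)[OF i] unfolding cell_ok.simps Let_def dd_def by blast
      then have "real_of_int (205931 * (10000 * (1920 * 64 ^ 4 * int i - 80 * 64\<^sup>2 * int i ^ 3 - 3 * int i ^ 5) * 100 - dd * (1920 * 64 ^ 4)))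
          \<le> real_of_int (cell_lo i * 200000 * (1920 * 64 ^ 5) * 100)"
        by (simp only: of_int_le_iff)
      then have "205931 * (10000 * (1920 * 64 ^ 4 * real i - 80 * 64\<^sup>2 * real i ^ 3 - 3 * real i ^ 5) * 100 - 10 ^ 6 * D * (1920 * 64 ^ 4))
          \<le> real_of_int (cell_lo i) * 200000 * (1920 * 64 ^ 5) * 100"
        by (simp only: of_int_mult of_int_diff of_int_power of_int_numeral of_int_of_nat_eq dd)
      moreover have "lune_poly (real i / 64) = (1920 * 64 ^ 4 * real i - 80 * 64\<^sup>2 * real i ^ 3 - 3 * real i ^ 5) / (1920 * 64 ^ 5)"
        unfolding lune_poly_def by (simp add: power_divide field_simps)
      ultimately show ?thesis unfolding D_def[symmetric] by (simp add: field_simps)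
    qed
    show "?Q * (chord_poly (real i / real 64) - (\<Sum>k\<in>{1..<i}. drop_weight ?G (?c i) i k * arc_width k i)
        - (?G i - ?c i) * (\<Sum>m<i. arc_width (i - 1) m)) \<le> real 64 * (?G i - ?c i)"
      if i: "i < 64" for i
    proof -
      define E where "E = (\<Sum>k\<in>{1..<i}. drop_weight ?G (?c i) i k * arc_width k i)"
      define S where "S = (\<Sum>m<i. arc_width (i - 1) m)"
      define l where "l = butlast (map cell_hi [0..<i]) @ [cell_lo i]"
      define dd where "dd = diff_dot l (cell_row i)"
      define T where "T = last_aligned l (row_sum i)"
      have dd: "real_of_int dd = 10 ^ 6 * E"
        unfolding dd_def E_def l_def using i length_cell_row[of i] cell_row_eq[of _ i]
        by (intro diff_dot_drop_weight) auto
      have T: "real_of_int T = 100 * S"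
        unfolding T_def S_def l_def using butlast_cells_last_aligned[OF i] .
      have "205931 * (10000 * (128 * 64 ^ 4 - 16 * 64\<^sup>2 * (int i)\<^sup>2 - int i ^ 4) * 100
          - dd * (128 * 64 ^ 4) - (cell_hi i - cell_lo i) * T * (128 * 64 ^ 4))
        \<le> 64 * (cell_hi i - cell_lo i) * 100 * (128 * 64 ^ 4) * 200000"
        using cell_facts(1)[OF i] unfolding cell_ok.simps Let_def dd_def T_def l_def by blast
      then have "real_of_int (205931 * (10000 * (128 * 64 ^ 4 - 16 * 64\<^sup>2 * (int i)\<^sup>2 - int i ^ 4) * 100
          - dd * (128 * 64 ^ 4) - (cell_hi i - cell_lo i) * T * (128 * 64 ^ 4)))
        \<le> real_of_int (64 * (cell_hi i - cell_lo i) * 100 * (128 * 64 ^ 4) * 200000)"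
        by (simp only: of_int_le_iff)
      then have "205931 * (10000 * (128 * 64 ^ 4 - 16 * 64\<^sup>2 * (real i)\<^sup>2 - real i ^ 4) * 100
          - 10 ^ 6 * E * (128 * 64 ^ 4) - (real_of_int (cell_hi i) - real_of_int (cell_lo i)) * (100 * S) * (128 * 64 ^ 4))
        \<le> 64 * (real_of_int (cell_hi i) - real_of_int (cell_lo i)) * 100 * (128 * 64 ^ 4) * 200000"
        by (simp only: of_int_mult of_int_diff of_int_power of_int_numeral of_int_of_nat_eq dd T)
      moreover have "chord_poly (real i / 64) = (128 * 64 ^ 4 - 16 * 64\<^sup>2 * (real i)\<^sup>2 - real i ^ 4) / (128 * 64 ^ 4)"
        unfolding chord_poly_def by (simp add: power_divide field_simps)
      ultimately show ?thesis unfolding E_def[symmetric] S_def[symmetric] by (simp add: field_simps)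
    qed
  qed (use assms arc_width_nonneg in \<open>auto simp: arc_width_def\<close>)
  also have "\<dots> \<le> ennreal (pi * (382058 / 617932) * disk_metric (norm x))"
  proof (intro ennreal_leI mult_right_mono)
    \<comment> \<open>Q is a rational slightly above 2 * 617932 / (382058 * pi), so pi enters only
      here and not in the integer checks.\<close>
    show "2 / ?Q \<le> pi * (382058 / 617932)" using pi_approx(1) by simp
    show "0 \<le> disk_metric (norm x)" using disk_metric_bounds(1)[of "norm x"] by simp
  qed
  finally show ?thesis .
qed

lemma radial_sum_drop:
  "i \<le> 64 \<Longrightarrow> real_of_int (radial_sum (int i) (drop i cells))
    = (\<Sum>j\<in>{i..<64}. 3 * real_of_int (cell_lo j) * (2 * real j + 1) + (real_of_int (cell_hi j) - real_of_int (cell_lo j)) * (3 * real j + 2))"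
proof (induction i rule: inc_induct)
  case (step i)
  then have i: "i < length cells" by (simp add: length_cells)
  obtain c g vs where x: "cells ! i = (c, g, vs)" by (cases "cells ! i") auto
  have d: "drop i cells = (c, g, vs) # drop (Suc i) cells"
    using Cons_nth_drop_Suc[OF i] x by simp
  show ?case using step unfolding d
    by (simp add: sum.atLeast_Suc_lessThan cell_lo_def cell_hi_def x add.commute)
qed (simp add: length_cells)

lemma far_disk_metric:
  "(\<integral>\<^sup>+z. indicator {z. norm z < 1} z * ennreal (disk_metric (norm z)) \<partial>(lborel :: (real \<times> real) measure))
    \<le> ennreal (pi * (382058 / 617932))"
proof -
  let ?c = "\<lambda>i. real_of_int (cell_lo i) / 10000" and ?G = "\<lambda>i. real_of_int (cell_hi i) / 10000"
  let ?S = "\<Sum>i<64. ?c i * (2 * real i + 1) + (?G i - ?c i) * (real i + 2 / 3)"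
  have "(\<integral>\<^sup>+z. indicator {z. norm z < 1} z * ennreal (disk_metric (norm z)) \<partial>(lborel :: (real \<times> real) measure))
      \<le> ennreal (pi / real (64\<^sup>2) * ?S)"
  proof (rule far_disk_bound)
    show "disk_metric s = ?c i + (?G i - ?c i) * (real 64 * s - real i)"
      if "i < 64" "real i / real 64 \<le> s" "s < real (i + 1) / real 64" for i s
      using disk_metric_cell[of i s] that by simp
    show "0 \<le> ?c i \<and> ?c i \<le> ?G i" if "i < 64" for i
      using cell_bounds(1-3)[OF that] by simp
  qed simp_all
  also have "\<dots> \<le> ennreal (pi * (382058 / 617932))"
  proof (intro ennreal_leI)
    have "?S = (\<Sum>j<64. (3 * real_of_int (cell_lo j) * (2 * real j + 1) + (real_of_int (cell_hi j) - real_of_int (cell_lo j)) * (3 * real j + 2)) / 30000)"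
      by (intro sum.cong) (simp_all add: field_simps)
    also have "\<dots> = real_of_int (radial_sum 0 cells) / 30000"
      using radial_sum_drop[of 0] by (simp add: sum_divide_distrib lessThan_atLeast0)
    finally have S: "?S = real_of_int (radial_sum 0 cells) / 30000" .
    have "real_of_int (617932 * radial_sum 0 cells) \<le> real_of_int (382058 * (3 * 4096 * 10000))"
      using radial_sum_cells by (simp only: of_int_le_iff)
    then have "?S / 4096 \<le> 382058 / 617932" unfolding S by simp
    then have "pi * (?S / 4096) \<le> pi * (382058 / 617932)" by (rule mult_left_mono) simp
    then show "pi / real (64\<^sup>2) * ?S \<le> pi * (382058 / 617932)" by simp
  qed
  finally show ?thesis .
qed

subsection \<open>Areas on the torus\<close>

abbreviation lattice_vectors :: "(real \<times> real) set" where
  "lattice_vectors \<equiv> \<int> \<times> \<int>"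

lemma lattice_vectors_closed: "closed lattice_vectors" "lattice_vectors \<noteq> {}" "countable lattice_vectors"
proof -
  show "closed lattice_vectors" by (intro closed_Times closed_Ints)
  show "lattice_vectors \<noteq> {}" using Ints_0 by blast
  have "countable (\<int> :: real set)" by (simp add: Ints_def)
  then show "countable lattice_vectors" by simp
qed

lemma torus_dist_le: "l \<in> lattice_vectors \<Longrightarrow> torus_dist x y \<le> norm (x - y - l)"
  unfolding torus_dist_def by (metis dist_norm infdist_le)

lemma torus_dist_attained: "\<exists>l\<in>lattice_vectors. torus_dist x y = norm (x - y - l)"
  unfolding torus_dist_def using infdist_attains_inf[OF lattice_vectors_closed(1,2)] by (metis dist_norm)

lemma torus_dist_nonneg [simp]: "0 \<le> torus_dist x y"
  by (simp add: torus_dist_def infdist_nonneg)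

lemma torus_dist_commute: "torus_dist x y = torus_dist y x"
proof -
  have "torus_dist x y \<le> torus_dist y x" for x y
  proof -
    obtain l where l: "l \<in> lattice_vectors" "torus_dist y x = norm (y - x - l)"
      using torus_dist_attained by blast
    have "- l \<in> lattice_vectors" using l(1) by auto
    then have "torus_dist x y \<le> norm (x - y - (- l))" by (rule torus_dist_le)
    also have "\<dots> = norm (y - x - l)"
      using norm_minus_cancel[of "y - x - l"] by (simp add: algebra_simps)
    finally show ?thesis using l by simp
  qed
  then show ?thesis by (simp add: order_antisym)
qed

lemma borel_measurable_torus_dist [measurable (raw)]:
  assumes "f \<in> borel_measurable M" "g \<in> borel_measurable M"
  shows "(\<lambda>x. torus_dist (f x) (g x)) \<in> borel_measurable M"
proof -
  have "(\<lambda>x. infdist (f x - g x) lattice_vectors) \<in> borel_measurable M"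
    using borel_measurable_diff[OF assms]
    by (rule borel_measurable_continuous_on[rotated]) (intro continuous_intros)
  then show ?thesis by (simp add: torus_dist_def)
qed

lemma sets_unit_torus [measurable, simp]: "unit_torus \<in> sets borel"
  unfolding unit_torus_def by (intro borel_Times) auto

lemma space_torus_measure [simp]: "space torus_measure = unit_torus"
  by (simp add: torus_measure_def space_restrict_space)

lemma measurable_torus_measure_borel [measurable]: "(\<lambda>x. x) \<in> torus_measure \<rightarrow>\<^sub>M borel"
  unfolding torus_measure_def by (rule measurable_restrict_space1) simp

lemma prob_space_torus_measure: "prob_space torus_measure"
proof
  have "emeasure torus_measure (space torus_measure) = emeasure lborel unit_torus"
    unfolding space_torus_measure unfolding torus_measure_def by (rule emeasure_restrict_space) auto
  also have "\<dots> = emeasure (lborel \<Otimes>\<^sub>M lborel) ({0..<1::real} \<times> {0..<1::real})"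
    unfolding lborel_prod unit_torus_def ..
  also have "\<dots> = 1" by (subst lborel.emeasure_pair_measure_Times) auto
  finally show "emeasure torus_measure (space torus_measure) = 1" .
qed

lemma nn_integral_plane_translate:
  fixes f :: "real \<times> real \<Rightarrow> ennreal"
  assumes [measurable]: "f \<in> borel_measurable borel"
  shows "(\<integral>\<^sup>+z. f (z + a) \<partial>lborel) = (\<integral>\<^sup>+z. f z \<partial>lborel)"
proof -
  have "(\<integral>\<^sup>+z. f z \<partial>lborel) = (\<integral>\<^sup>+z. f z \<partial>distr lborel borel ((+) a))" by (simp only: lborel_distr_plus)
  also have "\<dots> = (\<integral>\<^sup>+z. f (a + z) \<partial>lborel)" by (rule nn_integral_distr) simp_all
  finally show ?thesis by (simp add: add.commute)
qed

lemma nn_integral_plane_scale: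
  fixes f :: "real \<times> real \<Rightarrow> ennreal"
  assumes [measurable]: "f \<in> borel_measurable borel" and u: "0 < u"
  shows "(\<integral>\<^sup>+z. f (z /\<^sub>R u) \<partial>lborel) = ennreal (u\<^sup>2) * (\<integral>\<^sup>+z. f z \<partial>lborel)"
proof -
  let ?T = "\<lambda>x::real\<times>real. 0 + u *\<^sub>R x"
  have "(\<integral>\<^sup>+z. f (z /\<^sub>R u) \<partial>lborel)
      = (\<integral>\<^sup>+z. f (z /\<^sub>R u) \<partial>density (distr lborel borel ?T) (\<lambda>_. \<bar>u\<bar> ^ DIM(real \<times> real)))"
    using lborel_affine[of u "0 :: real \<times> real"] u by simp
  also have "\<dots> = (\<integral>\<^sup>+z. ennreal (u\<^sup>2) * f (z /\<^sub>R u) \<partial>distr lborel borel ?T)"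
    using u by (subst nn_integral_density) (auto simp: ennreal_power power2_eq_square)
  also have "\<dots> = ennreal (u\<^sup>2) * (\<integral>\<^sup>+z. f (z /\<^sub>R u) \<partial>distr lborel borel ?T)"
    by (rule nn_integral_cmult) simp
  also have "(\<integral>\<^sup>+z. f (z /\<^sub>R u) \<partial>distr lborel borel ?T) = (\<integral>\<^sup>+z. f (?T z /\<^sub>R u) \<partial>lborel)"
    by (rule nn_integral_distr) simp_all
  finally show ?thesis using u by simp
qed

text \<open>Unfolding the torus: the translates of the fundamental domain tile the plane.\<close>

lemma nn_integral_torus_le_plane:
  assumes \<Phi>[measurable]: "\<Phi> \<in> borel_measurable borel"
    and le: "\<And>z. z \<in> unit_torus \<Longrightarrow> \<exists>l\<in>lattice_vectors. F z \<le> \<Phi> (z - y - l)"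
  shows "(\<integral>\<^sup>+z. F z \<partial>torus_measure) \<le> (\<integral>\<^sup>+z. \<Phi> z \<partial>lborel)"
proof -
  let ?C = "count_space lattice_vectors"
  have U: "unit_torus \<inter> space lborel \<in> sets lborel" by simp
  have "(\<integral>\<^sup>+z. F z \<partial>torus_measure) = (\<integral>\<^sup>+z. F z * indicator unit_torus z \<partial>lborel)"
    unfolding torus_measure_def by (rule nn_integral_restrict_space[OF U])
  also have "\<dots> \<le> (\<integral>\<^sup>+z. (\<integral>\<^sup>+l. \<Phi> (z - y - l) * indicator unit_torus z \<partial>?C) \<partial>lborel)"
  proof (rule nn_integral_mono)
    fix z :: "real \<times> real"
    show "F z * indicator unit_torus z \<le> (\<integral>\<^sup>+l. \<Phi> (z - y - l) * indicator unit_torus z \<partial>?C)"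
    proof (cases "z \<in> unit_torus")
      case True
      then obtain l where l: "l \<in> lattice_vectors" "F z \<le> \<Phi> (z - y - l)" using le by blast
      have "\<Phi> (z - y - l) \<le> (\<integral>\<^sup>+l. \<Phi> (z - y - l) \<partial>?C)"
        using nn_integral_ge_point[OF l(1), of "\<lambda>l. \<Phi> (z - y - l)"] .
      then show ?thesis using True l(2) by simp
    qed simp
  qed
  also have "\<dots> = (\<integral>\<^sup>+l. (\<integral>\<^sup>+z. \<Phi> (z - y - l) * indicator unit_torus z \<partial>lborel) \<partial>?C)"
    by (rule nn_integral_count_space_nn_integral) (use lattice_vectors_closed in auto)
  also have "\<dots> = (\<integral>\<^sup>+l. (\<integral>\<^sup>+z. \<Phi> z * indicator unit_torus (z + (y + l)) \<partial>lborel) \<partial>?C)"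
  proof (rule nn_integral_cong)
    fix l :: "real \<times> real"
    have "(\<integral>\<^sup>+z. (\<lambda>z. \<Phi> (z - y - l) * indicator unit_torus z) (z + (y + l)) \<partial>lborel)
        = (\<integral>\<^sup>+z. \<Phi> (z - y - l) * indicator unit_torus z \<partial>lborel)"
      by (rule nn_integral_plane_translate) measurable
    then show "(\<integral>\<^sup>+z. \<Phi> (z - y - l) * indicator unit_torus z \<partial>lborel)
        = (\<integral>\<^sup>+z. \<Phi> z * indicator unit_torus (z + (y + l)) \<partial>lborel)"
      by (simp add: algebra_simps)
  qed
  also have "\<dots> = (\<integral>\<^sup>+z. (\<integral>\<^sup>+l. \<Phi> z * indicator unit_torus (z + (y + l)) \<partial>?C) \<partial>lborel)"
    by (rule nn_integral_count_space_nn_integral[symmetric]) (use lattice_vectors_closed in auto)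
  also have "\<dots> \<le> (\<integral>\<^sup>+z. \<Phi> z \<partial>lborel)"
  proof (rule nn_integral_mono)
    fix z :: "real \<times> real"
    have uniq: "l = l'" if "l \<in> lattice_vectors" "l' \<in> lattice_vectors" "z + (y + l) \<in> unit_torus" "z + (y + l') \<in> unit_torus" for l l'
    proof -
      have int: "a = b" if "a \<in> \<int>" "b \<in> \<int>" "0 \<le> c + a" "c + a < 1" "0 \<le> c + b" "c + b < 1" for a b c :: real
      proof -
        have "a - b \<in> \<int>" "\<bar>a - b\<bar> < 1" using that by auto
        then show ?thesis using Ints_nonzero_abs_less1[of "a - b"] by auto
      qed
      have "fst l = fst l'" using int[of "fst l" "fst l'" "fst z + fst y"] that
        by (simp add: unit_torus_def mem_Times_iff add.assoc)
      moreover have "snd l = snd l'" using int[of "snd l" "snd l'" "snd z + snd y"] that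
        by (simp add: unit_torus_def mem_Times_iff add.assoc)
      ultimately show ?thesis by (rule prod_eqI)
    qed
    show "(\<integral>\<^sup>+l. \<Phi> z * indicator unit_torus (z + (y + l)) \<partial>?C) \<le> \<Phi> z"
    proof (cases "\<exists>l0\<in>lattice_vectors. z + (y + l0) \<in> unit_torus")
      case True
      then obtain l0 where l0: "l0 \<in> lattice_vectors" "z + (y + l0) \<in> unit_torus" by blast
      have "(\<integral>\<^sup>+l. \<Phi> z * indicator unit_torus (z + (y + l)) \<partial>?C) = (\<integral>\<^sup>+l. \<Phi> z * indicator {l0} l \<partial>?C)"
      proof (rule nn_integral_cong)
        fix l assume "l \<in> space ?C"
        then have "z + (y + l) \<in> unit_torus \<longleftrightarrow> l = l0" using uniq[OF _ l0(1) _ l0(2)] l0(2) by auto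
        then show "\<Phi> z * indicator unit_torus (z + (y + l)) = \<Phi> z * indicator {l0} l"
          by (simp add: indicator_def)
      qed
      also have "\<dots> = \<Phi> z" using l0 by (simp add: nn_integral_cmult_indicator)
      finally show ?thesis by simp
    next
      case False
      then have "(\<integral>\<^sup>+l. \<Phi> z * indicator unit_torus (z + (y + l)) \<partial>?C) = (\<integral>\<^sup>+l. 0 \<partial>?C)"
        by (intro nn_integral_cong) auto
      then show ?thesis by simp
    qed
  qed
  finally show ?thesis .
qed

text \<open>The one-sided unfolding gives this for every radius, also when the disk wraps around the
  torus and its lifts overlap.\<close>

lemma emeasure_torus_disk_le:
  assumes u: "0 \<le> u"
  shows "emeasure torus_measure {z \<in> unit_torus. torus_dist z y < u} \<le> ennreal (pi * u\<^sup>2)"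
proof -
  have S: "{z \<in> unit_torus. torus_dist z y < u} \<in> sets torus_measure"
  proof -
    have "{z \<in> space torus_measure. torus_dist z y < u} \<in> sets torus_measure" by measurable
    then show ?thesis by simp
  qed
  have "emeasure torus_measure {z \<in> unit_torus. torus_dist z y < u}
      = (\<integral>\<^sup>+z. indicator {z \<in> unit_torus. torus_dist z y < u} z \<partial>torus_measure)"
    using S by simp
  also have "\<dots> \<le> (\<integral>\<^sup>+z. indicator (ball (0::real\<times>real) u) z \<partial>lborel)"
  proof (rule nn_integral_torus_le_plane)
    fix z :: "real \<times> real"
    obtain l where l: "l \<in> lattice_vectors" "torus_dist z y = norm (z - y - l)"
      using torus_dist_attained by blast
    then show "\<exists>l\<in>lattice_vectors. indicator {z \<in> unit_torus. torus_dist z y < u} z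
        \<le> (indicator (ball 0 u) (z - y - l) :: ennreal)"
      by (intro bexI[of _ l]) (auto simp: indicator_def)
  qed (simp add: borel_measurable_indicator)
  also have "\<dots> = ennreal (pi * u\<^sup>2)" using u by (simp add: emeasure_ball_plane)
  finally show ?thesis .
qed

text \<open>Each z is lifted by the lattice vector that realises its distance to y, so it lands in
  the planar disk at its true distance. A fixed lift of x is at least as far from it as x is on the
  torus, so it stays outside the second disk. Thus the torus crescent unfolds into the planar
  one.\<close>

lemma torus_crescent_bound:
  fixes x y :: "real \<times> real" and u :: real
  assumes u: "0 < u"
  defines "d \<equiv> torus_dist x y / u"
  shows "(\<integral>\<^sup>+z. indicator {z. torus_dist z y < u \<and> u \<le> torus_dist z x} z
      * ennreal (1 - max 0 (disk_metric d - disk_metric (torus_dist z y / u))) \<partial>torus_measure)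
    \<le> ennreal (pi * u\<^sup>2 * (382058 / 617932) * disk_metric d)" (is "?I \<le> _")
proof -
  obtain l0 where l0: "l0 \<in> lattice_vectors" "torus_dist x y = norm (x - y - l0)"
    using torus_dist_attained by blast
  define x0 where "x0 = (x - y - l0) /\<^sub>R u"
  have nx0: "norm x0 = d" using u l0 by (simp add: x0_def d_def divide_inverse mult.commute)
  define \<Psi> where "\<Psi> = (\<lambda>z. indicator {z. norm z < 1 \<and> 1 \<le> norm (z - x0)} z
      * ennreal (1 - max 0 (disk_metric d - disk_metric (norm z))))"
  have [measurable]: "\<Psi> \<in> borel_measurable borel" unfolding \<Psi>_def by measurable
  have P: "(\<integral>\<^sup>+z. \<Psi> z \<partial>lborel) \<le> ennreal (pi * (382058 / 617932) * disk_metric d)"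
  proof (cases "d < 1")
    case True
    then show ?thesis using near_disk_metric[of x0] unfolding \<Psi>_def nx0 by simp
  next
    \<comment> \<open>For d \<ge> 1 the metric of d is 1, the weight is the metric of the norm, and
      the condition on the second disk is dropped.\<close>
    case False
    have "(\<integral>\<^sup>+z. \<Psi> z \<partial>lborel)
        \<le> (\<integral>\<^sup>+z. indicator {z. norm z < 1} z * ennreal (disk_metric (norm z)) \<partial>(lborel :: (real \<times> real) measure))"
    proof (rule nn_integral_mono)
      fix z :: "real \<times> real"
      show "\<Psi> z \<le> indicator {z. norm z < 1} z * ennreal (disk_metric (norm z))"
        using False disk_metric_bounds[of "norm z"] unfolding \<Psi>_def
        by (simp add: disk_metric_far indicator_def)
    qed
    then show ?thesis using far_disk_metric False by (simp add: disk_metric_far)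
  qed
  have "?I \<le> (\<integral>\<^sup>+z. \<Psi> (z /\<^sub>R u) \<partial>lborel)"
  proof (rule nn_integral_torus_le_plane)
    fix z :: "real \<times> real"
    obtain l where l: "l \<in> lattice_vectors" "torus_dist z y = norm (z - y - l)"
      using torus_dist_attained by blast
    define v where "v = (z - y - l) /\<^sub>R u"
    have nv: "norm v = torus_dist z y / u" using u l by (simp add: v_def divide_inverse mult.commute)
    have "v - x0 = (z - x - (l - l0)) /\<^sub>R u"
      by (simp add: v_def x0_def scaleR_diff_right)
    moreover have "l - l0 \<in> lattice_vectors" using l(1) l0(1) by auto
    then have "torus_dist z x \<le> norm (z - x - (l - l0))" by (rule torus_dist_le)
    ultimately have nvx: "torus_dist z x / u \<le> norm (v - x0)"
      using u by (simp add: divide_inverse mult.commute mult_right_mono)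
    show "\<exists>l\<in>lattice_vectors. indicator {z. torus_dist z y < u \<and> u \<le> torus_dist z x} z
      * ennreal (1 - max 0 (disk_metric d - disk_metric (torus_dist z y / u))) \<le> \<Psi> ((z - y - l) /\<^sub>R u)"
    proof (intro bexI[OF _ l(1)], fold v_def)
      show "indicator {z. torus_dist z y < u \<and> u \<le> torus_dist z x} z
        * ennreal (1 - max 0 (disk_metric d - disk_metric (torus_dist z y / u))) \<le> \<Psi> v"
      proof (cases "torus_dist z y < u \<and> u \<le> torus_dist z x")
        case True
        then have "norm v < 1" using u unfolding nv by (simp add: divide_less_eq)
        moreover have "1 \<le> torus_dist z x / u" using True u by (simp add: le_divide_eq)
        with nvx have "1 \<le> norm (v - x0)" by linarith
        ultimately have "norm v < 1" "1 \<le> norm (v - x0)" by auto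
        then show ?thesis using True by (simp add: \<Psi>_def nv indicator_def)
      qed simp
    qed
  qed measurable
  also have "\<dots> = ennreal (u\<^sup>2) * (\<integral>\<^sup>+z. \<Psi> z \<partial>lborel)"
    using u by (intro nn_integral_plane_scale) measurable
  also have "\<dots> \<le> ennreal (u\<^sup>2) * ennreal (pi * (382058 / 617932) * disk_metric d)"
    by (rule mult_left_mono[OF P]) simp
  also have "\<dots> = ennreal (pi * u\<^sup>2 * (382058 / 617932) * disk_metric d)"
    by (simp add: ennreal_mult'[symmetric] mult_ac)
  finally show ?thesis .
qed

subsection \<open>Move operators\<close>

locale hard_disks =
  fixes n :: nat and r :: real
  assumes n_pos: "0 < n" and r_pos: "0 < r"
begin

definition Conf :: "(nat \<Rightarrow> real \<times> real) measure" where
  "Conf = (\<Pi>\<^sub>M i\<in>{..<n}. torus_measure)"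

definition free :: "(nat \<Rightarrow> real \<times> real) \<Rightarrow> nat \<Rightarrow> real \<times> real \<Rightarrow> bool" where
  "free x j z \<longleftrightarrow> (\<forall>i<n. i \<noteq> j \<longrightarrow> 2 * r \<le> torus_dist z (x i))"

definition upd :: "nat \<Rightarrow> (nat \<Rightarrow> real \<times> real) \<Rightarrow> real \<times> real \<Rightarrow> nat \<Rightarrow> real \<times> real" where
  "upd j x z = (if free x j z then x(j := z) else x)"

definition disk_area :: real where "disk_area = pi * (2 * r)\<^sup>2"

definition exclusion :: real where "exclusion = n * disk_area"

text \<open>The dynamics is run on all \<open>n\<close>-tuples of points, including those with overlapping disks:
  then the hybrid configurations of path coupling are states as well.\<close>

definition bmeas :: "((nat \<Rightarrow> real \<times> real) \<Rightarrow> real) \<Rightarrow> bool" where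
  "bmeas g \<longleftrightarrow> g \<in> borel_measurable Conf \<and> (\<exists>B. \<forall>x\<in>space Conf. \<bar>g x\<bar> \<le> B)"

definition move :: "nat \<Rightarrow> ((nat \<Rightarrow> real \<times> real) \<Rightarrow> real) \<Rightarrow> (nat \<Rightarrow> real \<times> real) \<Rightarrow> real" where
  "move j g x = (\<integral>z. g (upd j x z) \<partial>torus_measure)"

text \<open>The divisor is n and not \<open>card I\<close>: this makes the operator additive in
  \<open>I\<close> and a contraction by \<open>card I / n\<close>.\<close>

definition moves :: "nat set \<Rightarrow> ((nat \<Rightarrow> real \<times> real) \<Rightarrow> real) \<Rightarrow> (nat \<Rightarrow> real \<times> real) \<Rightarrow> real" where
  "moves I g x = (\<Sum>j\<in>I. move j g x) / n"

sublocale T: prob_space torus_measure by (rule prob_space_torus_measure)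

lemma disk_area_pos: "0 < disk_area" using r_pos by (simp add: disk_area_def)

lemma space_Conf: "space Conf = {..<n} \<rightarrow>\<^sub>E unit_torus"
  by (simp add: Conf_def space_PiM)

lemma Conf_component: "x \<in> space Conf \<Longrightarrow> i < n \<Longrightarrow> x i \<in> unit_torus"
  by (auto simp: space_Conf)

lemma Conf_upd: "x \<in> space Conf \<Longrightarrow> j < n \<Longrightarrow> z \<in> unit_torus \<Longrightarrow> x(j := z) \<in> space Conf"
  by (auto simp: space_Conf PiE_def extensional_def)

lemma upd_in_Conf: "x \<in> space Conf \<Longrightarrow> j < n \<Longrightarrow> z \<in> unit_torus \<Longrightarrow> upd j x z \<in> space Conf"
  by (simp add: upd_def Conf_upd)

lemma measurable_Conf_component [measurable (raw)]:
  assumes "f \<in> M \<rightarrow>\<^sub>M Conf" "i < n"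
  shows "(\<lambda>x. f x i) \<in> borel_measurable M"
proof -
  have "(\<lambda>x. x i) \<in> Conf \<rightarrow>\<^sub>M torus_measure"
    using assms(2) unfolding Conf_def by (intro measurable_component_singleton) simp
  from measurable_compose[OF measurable_compose[OF assms(1) this] measurable_torus_measure_borel]
  show ?thesis by simp
qed

lemma measurable_free [measurable]:
  assumes [measurable]: "f \<in> M \<rightarrow>\<^sub>M Conf" "g \<in> M \<rightarrow>\<^sub>M torus_measure"
  shows "Measurable.pred M (\<lambda>y. free (f y) j (g y))"
proof -
  have [measurable]: "g \<in> borel_measurable M"
    using measurable_compose[OF assms(2) measurable_torus_measure_borel] by simp
  have "Measurable.pred M (\<lambda>y. \<forall>i\<in>{..<n} - {j}. 2 * r \<le> torus_dist (g y) (f y i))"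
    by (rule pred_intros_finite) (auto intro!: borel_measurable_le borel_measurable_const
        borel_measurable_torus_dist measurable_Conf_component assms)
  moreover have "free (f y) j (g y) \<longleftrightarrow> (\<forall>i\<in>{..<n} - {j}. 2 * r \<le> torus_dist (g y) (f y i))" for y
    by (auto simp: free_def)
  ultimately show ?thesis by simp
qed

lemma measurable_upd [measurable (raw)]:
  assumes f[measurable]: "f \<in> M \<rightarrow>\<^sub>M Conf" and g[measurable]: "g \<in> M \<rightarrow>\<^sub>M torus_measure" and j: "j < n"
  shows "(\<lambda>y. upd j (f y) (g y)) \<in> M \<rightarrow>\<^sub>M Conf"
proof -
  have "(\<lambda>y. (f y)(j := g y)) \<in> M \<rightarrow>\<^sub>M Conf"
    unfolding Conf_def
    by (rule measurable_fun_upd[where J = "{..<n}"]) (use f g j in \<open>auto simp: Conf_def\<close>)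
  then show ?thesis unfolding upd_def by measurable
qed

lemma measurable_upd_const:
  assumes x: "x \<in> space Conf" and j: "j < n"
  shows "upd j x \<in> torus_measure \<rightarrow>\<^sub>M Conf"
  using measurable_upd[of "\<lambda>_. x" torus_measure "\<lambda>z. z" j] x j by simp

lemma bmeasD: "bmeas g \<Longrightarrow> g \<in> borel_measurable Conf" by (simp add: bmeas_def)

lemma bmeas_add: "bmeas g \<Longrightarrow> bmeas h \<Longrightarrow> bmeas (\<lambda>x. g x + h x)"
  unfolding bmeas_def
proof (elim conjE exE, intro conjI borel_measurable_add)
  fix A B assume "\<forall>x\<in>space Conf. \<bar>g x\<bar> \<le> A" "\<forall>x\<in>space Conf. \<bar>h x\<bar> \<le> B"
  then show "\<exists>C. \<forall>x\<in>space Conf. \<bar>g x + h x\<bar> \<le> C"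
    by (intro exI[of _ "A + B"]) (auto intro!: order_trans[OF abs_triangle_ineq] add_mono)
qed

lemma bmeas_cmult: "bmeas g \<Longrightarrow> bmeas (\<lambda>x. c * g x)"
  unfolding bmeas_def
proof (elim conjE exE, intro conjI)
  fix B assume "\<forall>x\<in>space Conf. \<bar>g x\<bar> \<le> B"
  then show "\<exists>C. \<forall>x\<in>space Conf. \<bar>c * g x\<bar> \<le> C"
    by (intro exI[of _ "\<bar>c\<bar> * B"]) (auto simp: abs_mult intro!: mult_left_mono)
qed simp

lemma bmeas_diff: "bmeas g \<Longrightarrow> bmeas h \<Longrightarrow> bmeas (\<lambda>x. g x - h x)"
  using bmeas_add[of g "\<lambda>x. - 1 * h x"] bmeas_cmult[of h "- 1"] by simp

lemma integrable_bounded_upd: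
  assumes g: "bmeas g" and f: "f \<in> torus_measure \<rightarrow>\<^sub>M Conf"
  shows "integrable torus_measure (\<lambda>z. g (f z))"
proof -
  obtain B where B: "\<And>x. x \<in> space Conf \<Longrightarrow> \<bar>g x\<bar> \<le> B" using g by (auto simp: bmeas_def)
  show ?thesis
  proof (rule T.integrable_const_bound[of _ B])
    show "AE z in torus_measure. norm (g (f z)) \<le> B"
      using B measurable_space[OF f] by (intro AE_I2) auto
    show "(\<lambda>z. g (f z)) \<in> borel_measurable torus_measure"
      using measurable_compose[OF f bmeasD[OF g]] .
  qed
qed

lemmas integrable_move = integrable_bounded_upd[OF _ measurable_upd_const]

lemma move_bound:
  assumes "bmeas g" "\<And>x. x \<in> space Conf \<Longrightarrow> \<bar>g x\<bar> \<le> B" "x \<in> space Conf" "j < n"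
  shows "\<bar>move j g x\<bar> \<le> B"
proof -
  have "\<bar>move j g x\<bar> \<le> (\<integral>z. \<bar>g (upd j x z)\<bar> \<partial>torus_measure)"
    unfolding move_def by (rule integral_abs_bound)
  also have "\<dots> \<le> (\<integral>z. B \<partial>torus_measure)"
    using assms upd_in_Conf integrable_move[OF assms(1,3,4)] by (intro integral_mono integrable_abs) auto
  finally show ?thesis using T.prob_space by simp
qed

lemma bmeas_move: "bmeas g \<Longrightarrow> j < n \<Longrightarrow> bmeas (move j g)"
proof -
  assume g: "bmeas g" and j: "j < n"
  have [measurable]: "g \<in> borel_measurable Conf" using g by (rule bmeasD)
  have "(\<lambda>(x, z). upd j x z) \<in> Conf \<Otimes>\<^sub>M torus_measure \<rightarrow>\<^sub>M Conf"
    using measurable_upd[OF measurable_fst measurable_snd j] by (simp add: case_prod_beta')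
  from measurable_compose[OF this bmeasD[OF g]]
  have "(\<lambda>(x, z). g (upd j x z)) \<in> borel_measurable (Conf \<Otimes>\<^sub>M torus_measure)"
    by (simp add: case_prod_beta')
  then have "move j g \<in> borel_measurable Conf"
    unfolding move_def by (rule T.borel_measurable_lebesgue_integral)
  moreover obtain B where "\<And>x. x \<in> space Conf \<Longrightarrow> \<bar>g x\<bar> \<le> B" using g by (auto simp: bmeas_def)
  ultimately show "bmeas (move j g)" using move_bound[OF g _ _ j] by (auto simp: bmeas_def)
qed

lemma move_add: "bmeas g \<Longrightarrow> bmeas h \<Longrightarrow> x \<in> space Conf \<Longrightarrow> j < n \<Longrightarrow>
    move j (\<lambda>x. g x + h x) x = move j g x + move j h x"
  unfolding move_def by (intro Bochner_Integration.integral_add integrable_move)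

lemma move_diff: "bmeas g \<Longrightarrow> bmeas h \<Longrightarrow> x \<in> space Conf \<Longrightarrow> j < n \<Longrightarrow>
    move j (\<lambda>x. g x - h x) x = move j g x - move j h x"
  unfolding move_def by (intro Bochner_Integration.integral_diff integrable_move)

lemma move_cmult: "move j (\<lambda>x. c * g x) x = c * move j g x"
  unfolding move_def by simp

lemma move_cong: "(\<And>x. x \<in> space Conf \<Longrightarrow> g x = h x) \<Longrightarrow> x \<in> space Conf \<Longrightarrow> j < n \<Longrightarrow> move j g x = move j h x"
  unfolding move_def by (rule Bochner_Integration.integral_cong) (auto simp: upd_in_Conf)

lemma bmeas_moves: "bmeas g \<Longrightarrow> I \<subseteq> {..<n} \<Longrightarrow> bmeas (moves I g)"
proof -
  assume g: "bmeas g" and I: "I \<subseteq> {..<n}"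
  have "finite I" using I by (rule finite_subset) simp
  then have "bmeas (\<lambda>x. \<Sum>j\<in>I. move j g x)" using I
  proof induction
    case empty then show ?case by (auto simp: bmeas_def)
  next
    case (insert j I)
    then show ?case using bmeas_add[OF bmeas_move[OF g, of j]] by simp
  qed
  from bmeas_cmult[OF this, of "1 / n"] show ?thesis unfolding moves_def by simp
qed

lemma moves_add: "bmeas g \<Longrightarrow> bmeas h \<Longrightarrow> x \<in> space Conf \<Longrightarrow> I \<subseteq> {..<n} \<Longrightarrow>
    moves I (\<lambda>x. g x + h x) x = moves I g x + moves I h x"
  unfolding moves_def by (subst add_divide_distrib[symmetric], subst sum.distrib[symmetric])
    (auto intro!: arg_cong2[where f = "(/)"] sum.cong move_add)

lemma moves_diff: "bmeas g \<Longrightarrow> bmeas h \<Longrightarrow> x \<in> space Conf \<Longrightarrow> I \<subseteq> {..<n} \<Longrightarrow>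
    moves I (\<lambda>x. g x - h x) x = moves I g x - moves I h x"
  unfolding moves_def by (subst diff_divide_distrib[symmetric], subst sum_subtractf[symmetric])
    (auto intro!: arg_cong2[where f = "(/)"] sum.cong move_diff)

lemma moves_cong: "(\<And>x. x \<in> space Conf \<Longrightarrow> g x = h x) \<Longrightarrow> x \<in> space Conf \<Longrightarrow> I \<subseteq> {..<n} \<Longrightarrow>
    moves I g x = moves I h x"
  unfolding moves_def by (auto intro!: arg_cong2[where f = "(/)"] sum.cong move_cong)

lemma moves_bound:
  assumes "bmeas g" "\<And>x. x \<in> space Conf \<Longrightarrow> \<bar>g x\<bar> \<le> B" "x \<in> space Conf" "I \<subseteq> {..<n}"
  shows "\<bar>moves I g x\<bar> \<le> real (card I) / real n * B"
proof -
  have "\<bar>\<Sum>j\<in>I. move j g x\<bar> \<le> (\<Sum>j\<in>I. \<bar>move j g x\<bar>)" by (rule sum_abs)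
  also have "\<dots> \<le> (\<Sum>j\<in>I. B)" using assms by (intro sum_mono move_bound) auto
  finally show ?thesis unfolding moves_def using n_pos by (simp add: divide_right_mono)
qed

lemma bmeas_moves_power: "bmeas g \<Longrightarrow> I \<subseteq> {..<n} \<Longrightarrow> bmeas ((moves I ^^ a) g)"
  by (induction a) (auto intro: bmeas_moves)

lemma moves_power_bound:
  assumes "bmeas g" "\<And>x. x \<in> space Conf \<Longrightarrow> \<bar>g x\<bar> \<le> B" "x \<in> space Conf" "I \<subseteq> {..<n}"
  shows "\<bar>(moves I ^^ a) g x\<bar> \<le> (real (card I) / real n) ^ a * B"
  using assms(3)
proof (induction a arbitrary: x)
  case (Suc a)
  have "\<bar>moves I ((moves I ^^ a) g) x\<bar> \<le> real (card I) / real n * ((real (card I) / real n) ^ a * B)"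
    by (rule moves_bound[OF bmeas_moves_power[OF assms(1,4)] Suc.IH Suc.prems assms(4)])
  then show ?case by (simp add: mult_ac)
qed (use assms in simp)

definition blocked :: "(nat \<Rightarrow> real \<times> real) \<Rightarrow> nat set \<Rightarrow> (real \<times> real) set" where
  "blocked x I = {z \<in> unit_torus. \<exists>i\<in>I. torus_dist z (x i) < 2 * r}"

definition near :: "real \<times> real \<Rightarrow> (real \<times> real) set" where
  "near y = {z \<in> unit_torus. torus_dist z y < 2 * r}"

lemma sets_near [measurable]: "near y \<in> sets torus_measure"
proof -
  have "{z \<in> space torus_measure. torus_dist z y < 2 * r} \<in> sets torus_measure" by measurable
  then show ?thesis by (simp add: near_def)
qed

lemma measure_near: "measure torus_measure (near y) \<le> disk_area"
  unfolding near_def measure_def disk_area_def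
  using emeasure_torus_disk_le[of "2 * r" y] r_pos by (intro enn2real_leI) auto

lemma sets_blocked [measurable]: "finite I \<Longrightarrow> blocked x I \<in> sets torus_measure"
proof -
  assume "finite I"
  moreover have "blocked x I = (\<Union>i\<in>I. near (x i))" by (auto simp: blocked_def near_def)
  ultimately show ?thesis by auto
qed

lemma measure_blocked: "finite I \<Longrightarrow> measure torus_measure (blocked x I) \<le> card I * disk_area"
proof -
  assume I: "finite I"
  have "blocked x I = (\<Union>i\<in>I. near (x i))" by (auto simp: blocked_def near_def)
  then have "measure torus_measure (blocked x I) \<le> (\<Sum>i\<in>I. measure torus_measure (near (x i)))"
    using I by (auto intro!: measure_UNION_le)
  also have "\<dots> \<le> (\<Sum>i\<in>I. disk_area)" by (intro sum_mono measure_near)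
  finally show ?thesis by simp
qed


section \<open>Transpositions of labels\<close>

definition lab :: "nat \<Rightarrow> nat \<Rightarrow> nat \<Rightarrow> nat" where
  "lab i j a = (if a = i then j else if a = j then i else a)"

definition swp :: "nat \<Rightarrow> nat \<Rightarrow> (nat \<Rightarrow> real \<times> real) \<Rightarrow> nat \<Rightarrow> real \<times> real" where
  "swp i j x = (\<lambda>a. x (lab i j a))"

lemma lab_lab [simp]: "lab i j (lab i j a) = a"
  by (auto simp: lab_def)

lemma lab_less: "i < n \<Longrightarrow> j < n \<Longrightarrow> lab i j a < n \<longleftrightarrow> a < n"
  by (auto simp: lab_def)

lemma lab_eq: "lab i j a = lab i j b \<longleftrightarrow> a = b"
  by (metis lab_lab)

lemma swp_swp [simp]: "swp i j (swp i j x) = x"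
  by (simp add: swp_def)

lemma swp_in_Conf: "i < n \<Longrightarrow> j < n \<Longrightarrow> x \<in> space Conf \<Longrightarrow> swp i j x \<in> space Conf"
  by (auto simp: space_Conf PiE_def extensional_def swp_def lab_less)

lemma measurable_swp: "i < n \<Longrightarrow> j < n \<Longrightarrow> swp i j \<in> Conf \<rightarrow>\<^sub>M Conf"
proof -
  assume ij: "i < n" "j < n"
  show ?thesis unfolding Conf_def
  proof (rule measurable_PiM_single')
    fix a assume "a \<in> {..<n}"
    then show "(\<lambda>x. swp i j x a) \<in> Pi\<^sub>M {..<n} (\<lambda>i. torus_measure) \<rightarrow>\<^sub>M torus_measure"
      using ij unfolding swp_def by (intro measurable_component_singleton) (simp add: lab_less)
  next
    show "swp i j \<in> space (Pi\<^sub>M {..<n} (\<lambda>i. torus_measure)) \<rightarrow> {..<n} \<rightarrow>\<^sub>E space torus_measure"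
      using swp_in_Conf[OF ij] by (auto simp: space_PiM space_Conf)
  qed
qed

lemma bmeas_swp: "bmeas g \<Longrightarrow> i < n \<Longrightarrow> j < n \<Longrightarrow> bmeas (\<lambda>x. g (swp i j x))"
  unfolding bmeas_def using measurable_compose[OF measurable_swp] swp_in_Conf by blast

lemma free_swp: "i < n \<Longrightarrow> j < n \<Longrightarrow> free (swp i j x) k z \<longleftrightarrow> free x (lab i j k) z"
  unfolding free_def swp_def by (metis lab_lab lab_less)

lemma upd_swp: "i < n \<Longrightarrow> j < n \<Longrightarrow> upd k (swp i j x) z = swp i j (upd (lab i j k) x z)"
  by (auto simp: upd_def free_swp) (auto simp: swp_def fun_eq_iff lab_eq)

lemma move_swp: "i < n \<Longrightarrow> j < n \<Longrightarrow> move k g (swp i j x) = move (lab i j k) (\<lambda>x. g (swp i j x)) x"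
  unfolding move_def by (simp add: upd_swp)

lemma moves_swp:
  assumes "i < n" "j < n" "lab i j ` I = I"
  shows "moves I g (swp i j x) = moves I (\<lambda>x. g (swp i j x)) x"
proof -
  have "(\<Sum>k\<in>I. move k g (swp i j x)) = (\<Sum>k\<in>I. move (lab i j k) (\<lambda>x. g (swp i j x)) x)"
    using assms by (simp add: move_swp)
  also have "\<dots> = (\<Sum>k\<in>lab i j ` I. move k (\<lambda>x. g (swp i j x)) x)"
    by (rule sum.reindex[symmetric, unfolded comp_def]) (simp add: inj_on_def lab_eq)
  finally show ?thesis by (simp add: moves_def assms(3))
qed

lemma lab_image_all:
  assumes ij: "i < n" "j < n"
  shows "lab i j ` {..<n} = {..<n}"
proof
  show "lab i j ` {..<n} \<subseteq> {..<n}" using ij by (auto simp: lab_less)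
  show "{..<n} \<subseteq> lab i j ` {..<n}"
  proof
    fix a assume "a \<in> {..<n}"
    then show "a \<in> lab i j ` {..<n}" using ij by (intro image_eqI[of _ _ "lab i j a"]) (auto simp: lab_less)
  qed
qed

subsection \<open>Coalescence of two labels\<close>

lemma measurable_upd_upd:
  assumes x: "x \<in> space Conf" and ij: "i < n" "j < n"
  shows "(\<lambda>p. upd j (upd i x (fst p)) (snd p)) \<in> torus_measure \<Otimes>\<^sub>M torus_measure \<rightarrow>\<^sub>M Conf"
    and "(\<lambda>p. upd j (upd i x (snd p)) (fst p)) \<in> torus_measure \<Otimes>\<^sub>M torus_measure \<rightarrow>\<^sub>M Conf"
  using measurable_upd[OF measurable_compose[OF measurable_fst measurable_upd_const[OF x ij(1)]] measurable_snd ij(2)]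
    measurable_upd[OF measurable_compose[OF measurable_snd measurable_upd_const[OF x ij(1)]] measurable_fst ij(2)]
  by simp_all

text \<open>With proposals z for i and w for j, both orders end in the same configuration unless z
  is near \<open>x j\<close>, w is near \<open>x i\<close>, or z and w are near each other. Each
  event has probability at most \<open>disk_area\<close>, and the two values differ by at most 2 *
  B.\<close>

lemma commute_moves_bound:
  assumes g: "bmeas g" and B: "\<And>x. x \<in> space Conf \<Longrightarrow> \<bar>g x\<bar> \<le> B" and x: "x \<in> space Conf"
    and ij: "i < n" "j < n" "i \<noteq> j"
  shows "\<bar>move i (move j g) x - move j (move i g) x\<bar> \<le> 6 * disk_area * B"
proof -
  interpret TT: pair_prob_space torus_measure torus_measure ..
  let ?TT = "torus_measure \<Otimes>\<^sub>M torus_measure"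
  let ?f = "\<lambda>p. g (upd j (upd i x (fst p)) (snd p))"
  \<comment> \<open>The coordinates of p belong to labels here: \<open>fst p\<close> is the proposal
    for i in either order.\<close>
  let ?h = "\<lambda>p. g (upd i (upd j x (snd p)) (fst p))"
  have sp: "fst p \<in> unit_torus" "snd p \<in> unit_torus" if "p \<in> space ?TT" for p
    using that by (auto simp: space_pair_measure)
  have f_bd: "\<bar>?f p\<bar> \<le> B" and h_bd: "\<bar>?h p\<bar> \<le> B" if "p \<in> space ?TT" for p
    using sp[OF that] x ij by (auto intro!: B upd_in_Conf)
  have f_int: "integrable ?TT ?f"
    by (rule TT.integrable_const_bound[of _ B])
      (use f_bd measurable_compose[OF measurable_upd_upd(1)[OF x ij(1,2)] bmeasD[OF g]] in auto)
  have h_int: "integrable ?TT ?h"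
    by (rule TT.integrable_const_bound[of _ B])
      (use h_bd measurable_compose[OF measurable_upd_upd(2)[OF x ij(2,1)] bmeasD[OF g]] in auto)
  have f_eq: "move i (move j g) x = (\<integral>p. ?f p \<partial>?TT)"
    unfolding move_def using TT.integral_fst'[OF f_int] by simp
  have h_eq: "move j (move i g) x = (\<integral>p. ?h p \<partial>?TT)"
    unfolding move_def using TT.integral_snd[of "\<lambda>z w. g (upd i (upd j x w) z)"] h_int
    by (simp add: case_prod_beta')
  define N1 where "N1 = near (x j) \<times> unit_torus"
  define N2 where "N2 = unit_torus \<times> near (x i)"
  define N3 where "N3 = {p \<in> space ?TT. torus_dist (fst p) (snd p) < 2 * r}"
  have [measurable]: "N1 \<in> sets ?TT" "N2 \<in> sets ?TT"
    using sets.top[of torus_measure] by (auto simp: N1_def N2_def)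
  have [measurable]: "N3 \<in> sets ?TT"
  proof -
    have [measurable]: "fst \<in> borel_measurable ?TT" "snd \<in> borel_measurable ?TT"
      using measurable_compose[OF measurable_fst measurable_torus_measure_borel, of torus_measure]
        measurable_compose[OF measurable_snd measurable_torus_measure_borel, of torus_measure]
      by (simp_all)
    show ?thesis unfolding N3_def by measurable
  qed
  have U: "T.prob unit_torus = 1" using T.prob_space by simp
  have times: "measure ?TT (X \<times> Y) = T.prob X * T.prob Y"
    if "X \<in> sets torus_measure" "Y \<in> sets torus_measure" for X Y
    using that unfolding measure_def by (simp add: T.emeasure_pair_measure_Times enn2real_mult)
  have m1: "measure ?TT N1 \<le> disk_area" "measure ?TT N2 \<le> disk_area"
    unfolding N1_def N2_def using measure_near sets.top[of torus_measure]
    by (simp_all add: times U)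
  have m3: "measure ?TT N3 \<le> disk_area"
  proof -
    have "emeasure ?TT N3 = (\<integral>\<^sup>+z. emeasure torus_measure (Pair z -` N3) \<partial>torus_measure)"
      by (rule T.emeasure_pair_measure_alt) measurable
    also have "\<dots> \<le> (\<integral>\<^sup>+z. ennreal disk_area \<partial>torus_measure)"
    proof (rule nn_integral_mono)
      fix z assume z: "z \<in> space torus_measure"
      have "Pair z -` N3 = near z" using z
        by (auto simp: N3_def near_def space_pair_measure torus_dist_commute)
      then show "emeasure torus_measure (Pair z -` N3) \<le> ennreal disk_area"
        using measure_near[of z] by (simp add: T.emeasure_eq_measure ennreal_leI)
    qed
    also have "\<dots> = ennreal disk_area" using T.emeasure_space_1 by simp
    finally show ?thesis unfolding measure_def using disk_area_pos by (intro enn2real_leI) auto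
  qed
  let ?N = "\<lambda>p. indicator N1 p + indicator N2 p + (indicator N3 p :: real)"
  have N_int: "integrable ?TT (\<lambda>p. 2 * B * ?N p)"
    by (intro integrable_mult_right Bochner_Integration.integrable_add)
      (auto intro!: integrable_real_indicator simp: TT.emeasure_eq_measure)
  have B0: "0 \<le> B" using B[OF x] by linarith
  have pw: "\<bar>?f p - ?h p\<bar> \<le> 2 * B * ?N p" if p: "p \<in> space ?TT" for p
  proof (cases "p \<in> N1 \<or> p \<in> N2 \<or> p \<in> N3")
    case True
    have "\<bar>?f p - ?h p\<bar> \<le> 2 * B" using f_bd[OF p] h_bd[OF p] by linarith
    also have "\<dots> \<le> 2 * B * ?N p"
    proof -
      have "1 \<le> ?N p" using True by (auto simp: indicator_def)
      then show ?thesis using B0 mult_left_mono[of 1 "?N p" "2 * B"] by simp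
    qed
    finally show ?thesis .
  next
    case False
    obtain z w where zw: "p = (z, w)" by (cases p) auto
    have zw_in: "z \<in> unit_torus" "w \<in> unit_torus" using sp[OF p] zw by auto
    have far: "2 * r \<le> torus_dist z (x j)" "2 * r \<le> torus_dist w (x i)"
      "2 * r \<le> torus_dist z w" "2 * r \<le> torus_dist w z"
      using False p zw_in by (auto simp: zw N1_def N2_def N3_def near_def torus_dist_commute)
    have "free (upd i x z) j w \<longleftrightarrow> free x j w"
      using far ij by (auto simp: free_def upd_def)
    moreover have "free (upd j x w) i z \<longleftrightarrow> free x i z"
      using far ij by (auto simp: free_def upd_def)
    ultimately have "upd j (upd i x z) w = upd i (upd j x w) z"
      using ij by (auto simp: upd_def fun_upd_twist)
    then show ?thesis using B0 by (simp add: zw)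
  qed
  have "\<bar>move i (move j g) x - move j (move i g) x\<bar> = \<bar>\<integral>p. ?f p - ?h p \<partial>?TT\<bar>"
    unfolding f_eq h_eq using f_int h_int by simp
  also have "\<dots> \<le> (\<integral>p. \<bar>?f p - ?h p\<bar> \<partial>?TT)" by (rule integral_abs_bound)
  also have "\<dots> \<le> (\<integral>p. 2 * B * ?N p \<partial>?TT)"
    using pw f_int h_int N_int by (intro integral_mono) auto
  also have "\<dots> = 2 * B * (measure ?TT N1 + measure ?TT N2 + measure ?TT N3)"
  proof -
    have "integrable ?TT (indicator N :: _ \<Rightarrow> real)" if "N \<in> sets ?TT" for N
      using that by (simp add: TT.emeasure_eq_measure)
    then have "(\<integral>p. ?N p \<partial>?TT) = measure ?TT N1 + measure ?TT N2 + measure ?TT N3"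
      by (simp add: Bochner_Integration.integral_add)
    moreover have "(\<integral>p. 2 * B * ?N p \<partial>?TT) = 2 * B * (\<integral>p. ?N p \<partial>?TT)"
      by (rule Bochner_Integration.integral_mult_right_zero)
    ultimately show ?thesis by simp
  qed
  also have "\<dots> \<le> 2 * B * (3 * disk_area)" using m1 m3 B0 by (intro mult_left_mono) auto
  finally show ?thesis by (simp add: mult_ac)
qed

text \<open>If both proposed points are free, interchanging the order in which the labels \<open>i\<close> and \<open>j\<close>
  use them interchanges the labels in the result, so that an antisymmetric function cancels.\<close>

lemma double_move_antisymmetric:
  assumes g: "bmeas g" and B: "\<And>x. x \<in> space Conf \<Longrightarrow> \<bar>g x\<bar> \<le> B" and x: "x \<in> space Conf"
    and ij: "i < n" "j < n" "i \<noteq> j"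
    and anti: "\<And>x. x \<in> space Conf \<Longrightarrow> g (swp i j x) = - g x"
    and dens: "exclusion + disk_area \<le> 1"
  shows "\<bar>move i (move j g) x + move j (move i g) x\<bar>
    \<le> (2 - 2 * (1 - exclusion) * (1 - exclusion - disk_area)) * B"
proof -
  interpret TT: pair_prob_space torus_measure torus_measure ..
  let ?TT = "torus_measure \<Otimes>\<^sub>M torus_measure"
  let ?f = "\<lambda>p. g (upd j (upd i x (fst p)) (snd p))"
  \<comment> \<open>The coordinates of p belong to times here: \<open>fst p\<close> is the first
    proposal, whichever label uses it.\<close>
  let ?h = "\<lambda>p. g (upd i (upd j x (fst p)) (snd p))"
  have sp: "fst p \<in> unit_torus" "snd p \<in> unit_torus" if "p \<in> space ?TT" for p
    using that by (auto simp: space_pair_measure)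
  have f_bd: "\<bar>?f p\<bar> \<le> B" and h_bd: "\<bar>?h p\<bar> \<le> B" if "p \<in> space ?TT" for p
    using sp[OF that] x ij by (auto intro!: B upd_in_Conf)
  have f_int: "integrable ?TT ?f"
    by (rule TT.integrable_const_bound[of _ B])
      (use f_bd measurable_compose[OF measurable_upd_upd(1)[OF x ij(1,2)] bmeasD[OF g]] in auto)
  have h_int: "integrable ?TT ?h"
    by (rule TT.integrable_const_bound[of _ B])
      (use h_bd measurable_compose[OF measurable_upd_upd(1)[OF x ij(2,1)] bmeasD[OF g]] in auto)
  have eq: "move i (move j g) x + move j (move i g) x = (\<integral>p. ?f p + ?h p \<partial>?TT)"
    unfolding move_def using TT.integral_fst'[OF f_int] TT.integral_fst'[OF h_int] f_int h_int by simp
  \<comment> \<open>Both points avoid all n old positions, those of i and j included, because the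
    disk that moves second still occupies its old place during the first move. Hence the bound in
    terms of \<open>exclusion\<close>.\<close>
  define G where "G = {p \<in> space ?TT. fst p \<notin> blocked x {..<n} \<and> snd p \<notin> blocked x {..<n}
    \<and> 2 * r \<le> torus_dist (fst p) (snd p)}"
  have [measurable]: "G \<in> sets ?TT"
  proof -
    have [measurable]: "fst \<in> borel_measurable ?TT" "snd \<in> borel_measurable ?TT"
      using measurable_compose[OF measurable_fst measurable_torus_measure_borel, of torus_measure]
        measurable_compose[OF measurable_snd measurable_torus_measure_borel, of torus_measure]
      by (simp_all)
    show ?thesis unfolding G_def by measurable
  qed
  define F where "F = unit_torus - blocked x {..<n}"
  have F[measurable]: "F \<in> sets torus_measure"
    unfolding F_def using sets.top[of torus_measure] by auto
  have mF: "1 - exclusion \<le> measure torus_measure F"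
    unfolding F_def using T.prob_compl[of "blocked x {..<n}"] measure_blocked[of "{..<n}" x]
    by (simp add: exclusion_def)
  have B0: "0 \<le> B" using B[OF x] by linarith
  have mG: "(1 - exclusion) * (1 - exclusion - disk_area) \<le> measure ?TT G"
  proof -
    have G_sec: "1 - exclusion - disk_area \<le> measure torus_measure (Pair z -` G)" if z: "z \<in> F" for z
    proof -
      have zU: "z \<in> unit_torus" using z by (simp add: F_def)
      have eq: "Pair z -` G = F - near z" using z
        by (auto simp: G_def F_def near_def space_pair_measure torus_dist_commute not_less)
      have "measure torus_measure (F - near z) \<ge> measure torus_measure F - measure torus_measure (near z)"
        using T.finite_measure_Diff'[of F "near z"] T.finite_measure_mono[of "F \<inter> near z" "near z"] by auto
      then show ?thesis unfolding eq using mF measure_near[of z] by linarith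
    qed
    have "ennreal ((1 - exclusion) * (1 - exclusion - disk_area))
        \<le> (\<integral>\<^sup>+z. ennreal (1 - exclusion - disk_area) * indicator F z \<partial>torus_measure)"
    proof -
      have "(1 - exclusion) * (1 - exclusion - disk_area) \<le> (1 - exclusion - disk_area) * measure torus_measure F"
        using mF dens by (subst mult.commute) (intro mult_left_mono; simp)
      then show ?thesis using dens
        by (simp add: nn_integral_cmult_indicator T.emeasure_eq_measure ennreal_mult'[symmetric] ennreal_leI)
    qed
    also have "\<dots> \<le> (\<integral>\<^sup>+z. emeasure torus_measure (Pair z -` G) \<partial>torus_measure)"
      using G_sec by (intro nn_integral_mono) (auto simp: T.emeasure_eq_measure indicator_def intro!: ennreal_leI)
    also have "\<dots> = emeasure ?TT G" by (rule T.emeasure_pair_measure_alt[symmetric]) measurable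
    finally show ?thesis by (simp add: TT.emeasure_eq_measure)
  qed
  have pw: "\<bar>?f p + ?h p\<bar> \<le> 2 * B * (1 - indicator G p)" if p: "p \<in> space ?TT" for p
  proof (cases "p \<in> G")
    case False
    then show ?thesis using f_bd[OF p] h_bd[OF p] by (simp add: abs_le_iff)
  next
    case True
    obtain z w where zw: "p = (z, w)" by (cases p) auto
    have zw_in: "z \<in> unit_torus" "w \<in> unit_torus" using sp[OF p] zw by auto
    have far: "2 * r \<le> torus_dist z (x k)" "2 * r \<le> torus_dist w (x k)" if "k < n" for k
      using True zw_in that by (auto simp: zw G_def blocked_def not_less)
    have zwf: "2 * r \<le> torus_dist w z" using True by (simp add: zw G_def torus_dist_commute)
    have u1: "upd i x z = x(i := z)" "upd j x z = x(j := z)" using far by (auto simp: upd_def free_def)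
    have u2: "upd j (x(i := z)) w = x(i := z, j := w)" "upd i (x(j := z)) w = x(j := z, i := w)"
      using far zwf by (auto simp: upd_def free_def)
    have "x(j := z, i := w) = swp i j (x(i := z, j := w))"
      using ij(3) by (auto simp: swp_def lab_def fun_eq_iff)
    then have "g (x(j := z, i := w)) = - g (x(i := z, j := w))"
      using anti[of "x(i := z, j := w)"] x ij zw_in by (simp add: Conf_upd)
    then show ?thesis using True by (simp add: zw u1 u2)
  qed
  have "\<bar>move i (move j g) x + move j (move i g) x\<bar> \<le> (\<integral>p. \<bar>?f p + ?h p\<bar> \<partial>?TT)"
    unfolding eq by (rule integral_abs_bound)
  also have "\<dots> \<le> (\<integral>p. 2 * B * (1 - indicator G p) \<partial>?TT)"
    using pw f_int h_int by (intro integral_mono) (auto simp: TT.emeasure_eq_measure intro!: integrable_real_indicator)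
  also have "\<dots> = 2 * B * (1 - measure ?TT G)"
  proof -
    have "integrable ?TT (indicator G :: _ \<Rightarrow> real)" by (simp add: TT.emeasure_eq_measure)
    then have "(\<integral>p. 1 - indicator G p \<partial>?TT) = 1 - measure ?TT G"
      by (simp add: Bochner_Integration.integral_diff TT.prob_space)
    moreover have "(\<integral>p. 2 * B * (1 - indicator G p) \<partial>?TT) = 2 * B * (\<integral>p. 1 - indicator G p \<partial>?TT)"
      by (rule Bochner_Integration.integral_mult_right_zero)
    ultimately show ?thesis by simp
  qed
  also have "\<dots> \<le> 2 * B * (1 - (1 - exclusion) * (1 - exclusion - disk_area))"
    using mG B0 by (intro mult_left_mono) auto
  finally show ?thesis by (simp add: algebra_simps)
qed


section \<open>Decay of label-antisymmetric functions\<close>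

abbreviation step :: "((nat \<Rightarrow> real \<times> real) \<Rightarrow> real) \<Rightarrow> (nat \<Rightarrow> real \<times> real) \<Rightarrow> real" where
  "step \<equiv> moves {..<n}"

lemma moves_split:
  assumes "finite J" "I \<inter> J = {}" "finite I"
  shows "moves (I \<union> J) g x = moves I g x + moves J g x"
  unfolding moves_def using assms by (simp add: sum.union_disjoint add_divide_distrib)

lemma commute_move_moves_bound:
  assumes g: "bmeas g" and B: "\<And>x. x \<in> space Conf \<Longrightarrow> \<bar>g x\<bar> \<le> B" and x: "x \<in> space Conf"
    and i: "i < n" "i \<notin> I" and I: "I \<subseteq> {..<n}"
  shows "\<bar>move i (moves I g) x - moves I (move i g) x\<bar> \<le> real (card I) / real n * (6 * disk_area * B)"
proof -
  have fin: "finite I" using I by (rule finite_subset) simp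
  have "move i (moves I g) x = (\<Sum>j\<in>I. move i (move j g) x) / n"
  proof -
    have "bmeas (\<lambda>x. \<Sum>j\<in>J. move j g x) \<and> move i (\<lambda>x. \<Sum>j\<in>J. move j g x) x = (\<Sum>j\<in>J. move i (move j g) x)"
      if "finite J" "J \<subseteq> {..<n}" for J
      using that
    proof induction
      case empty
      show ?case using move_cmult[of i 0 "\<lambda>_. 0" x] by (auto simp: bmeas_def)
    next
      case (insert j J)
      have b: "bmeas (move j g)" using insert by (intro bmeas_move g) auto
      show ?case using insert bmeas_add[OF b] move_add[OF b, of "\<lambda>x. \<Sum>j\<in>J. move j g x" x i] x i by auto
    qed
    from this[OF fin I] show ?thesis
      unfolding moves_def using move_cmult[of i "1 / n" "\<lambda>x. \<Sum>j\<in>I. move j g x" x] by simp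
  qed
  then have "move i (moves I g) x - moves I (move i g) x
      = (\<Sum>j\<in>I. move i (move j g) x - move j (move i g) x) / n"
    by (simp add: moves_def sum_subtractf diff_divide_distrib)
  also have "\<bar>\<dots>\<bar> \<le> (\<Sum>j\<in>I. \<bar>move i (move j g) x - move j (move i g) x\<bar>) / n"
    using n_pos by (simp add: divide_right_mono sum_abs)
  also have "\<dots> \<le> (\<Sum>j\<in>I. 6 * disk_area * B) / n"
    using i I by (intro divide_right_mono sum_mono commute_moves_bound[OF g B x]) auto
  finally show ?thesis by simp
qed

lemma commute_move_moves_power_bound:
  assumes g: "bmeas g" and B: "\<And>x. x \<in> space Conf \<Longrightarrow> \<bar>g x\<bar> \<le> B" and x: "x \<in> space Conf"
    and i: "i < n" "i \<notin> I" and I: "I \<subseteq> {..<n}"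
  shows "\<bar>move i ((moves I ^^ a) g) x - (moves I ^^ a) (move i g) x\<bar>
    \<le> a * (real (card I) / real n) ^ a * (6 * disk_area * B)"
  using x
proof (induction a arbitrary: x)
  case (Suc a)
  let ?\<theta> = "real (card I) / real n"
  let ?g = "(moves I ^^ a) g"
  have bg: "bmeas ?g" using g I by (rule bmeas_moves_power)
  have b1: "bmeas (move i ?g)" using bg i(1) by (rule bmeas_move)
  have b2: "bmeas ((moves I ^^ a) (move i g))" using g i I by (intro bmeas_moves_power bmeas_move)
  have "\<bar>move i (moves I ?g) x - moves I (move i ?g) x\<bar> \<le> ?\<theta> * (6 * disk_area * (?\<theta> ^ a * B))"
    by (rule commute_move_moves_bound[OF bg _ Suc.prems i I]) (rule moves_power_bound[OF g B _ I])
  moreover have "\<bar>moves I (\<lambda>x. move i ?g x - (moves I ^^ a) (move i g) x) x\<bar>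
      \<le> ?\<theta> * (a * ?\<theta> ^ a * (6 * disk_area * B))"
    by (rule moves_bound[OF bmeas_diff[OF b1 b2] Suc.IH Suc.prems I])
  moreover have "moves I (\<lambda>x. move i ?g x - (moves I ^^ a) (move i g) x) x
      = moves I (move i ?g) x - moves I ((moves I ^^ a) (move i g)) x"
    by (rule moves_diff[OF b1 b2 Suc.prems I])
  ultimately have "\<bar>move i (moves I ?g) x - moves I ((moves I ^^ a) (move i g)) x\<bar>
      \<le> ?\<theta> * (6 * disk_area * (?\<theta> ^ a * B)) + ?\<theta> * (a * ?\<theta> ^ a * (6 * disk_area * B))"
    by linarith
  also have "\<dots> = Suc a * ?\<theta> ^ Suc a * (6 * disk_area * B)"
  proof -
    have "t * (6 * d * (s * B)) + t * (a * s * (6 * d * B)) = Suc a * (t * s) * (6 * d * B)" for s t d :: real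
      by (simp add: algebra_simps)
    from this[of ?\<theta> disk_area "?\<theta> ^ a"] show ?thesis by (simp only: power_Suc)
  qed
  finally show ?case by simp
qed simp

lemma bmeas_step: "bmeas g \<Longrightarrow> bmeas (step g)" by (auto intro: bmeas_moves)

lemma bmeas_step_power: "bmeas g \<Longrightarrow> bmeas ((step ^^ t) g)" by (auto intro: bmeas_moves_power)

lemma step_power_bound:
  assumes "bmeas g" "\<And>x. x \<in> space Conf \<Longrightarrow> \<bar>g x\<bar> \<le> B" "x \<in> space Conf"
  shows "\<bar>(step ^^ t) g x\<bar> \<le> B"
  using moves_power_bound[OF assms order_refl, of t] n_pos by simp

lemma step_power_swp:
  assumes ij: "i < n" "j < n"
  shows "(step ^^ t) g (swp i j x) = (step ^^ t) (\<lambda>x. g (swp i j x)) x"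
proof (induction t arbitrary: x)
  case (Suc t)
  have "(\<lambda>x. (step ^^ t) g (swp i j x)) = (step ^^ t) (\<lambda>x. g (swp i j x))" using Suc by auto
  then show ?case using moves_swp[OF ij lab_image_all[OF ij], of "(step ^^ t) g" x] by simp
qed simp

lemma step_power_antisymmetric:
  assumes g: "bmeas g" and ij: "i < n" "j < n" and x: "x \<in> space Conf"
    and anti: "\<And>x. x \<in> space Conf \<Longrightarrow> g (swp i j x) = - g x"
  shows "(step ^^ t) g (swp i j x) = - (step ^^ t) g x"
proof -
  have "(step ^^ t) (\<lambda>x. g (swp i j x)) x = - (step ^^ t) g x"
    using x
  proof (induction t arbitrary: x)
    case 0 then show ?case using anti by simp
  next
    case (Suc t)
    have "step ((step ^^ t) (\<lambda>x. g (swp i j x))) x = step (\<lambda>x. - 1 * (step ^^ t) g x) x"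
      using Suc by (intro moves_cong) auto
    also have "\<dots> = - step ((step ^^ t) g) x"
      unfolding moves_def move_cmult by (simp add: sum_negf)
    finally show ?case by simp
  qed
  then show ?thesis by (simp add: step_power_swp[OF ij])
qed

lemma moves_pair: "i \<noteq> j \<Longrightarrow> moves {i, j} g x = (move i g x + move j g x) / n"
  by (simp add: moves_def)

text \<open>The operator \<open>Q\<close> moves the disks other than \<open>i\<close> and \<open>j\<close>, so that \<open>step = Q + R\<close> with
  \<open>R = moves {i, j}\<close>. Almost commuting with \<open>move i\<close> and \<open>move j\<close>, it brings two moves of the labels
  \<open>i\<close> and \<open>j\<close> together if there are few steps in between.\<close>

lemma pair_moves_bound:
  assumes g: "bmeas g" and B: "\<And>x. x \<in> space Conf \<Longrightarrow> \<bar>g x\<bar> \<le> B" and x: "x \<in> space Conf"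
    and ij: "i < n" "j < n" "i \<noteq> j"
    and anti: "\<And>x. x \<in> space Conf \<Longrightarrow> g (swp i j x) = - g x"
    and dens: "exclusion + disk_area \<le> 1"
  defines "I \<equiv> {..<n} - {i, j}"
  defines "Q \<equiv> moves I" and "\<theta> \<equiv> real (card I) / real n"
  shows "\<bar>move i ((Q ^^ a) (\<lambda>x. move i g x + move j g x)) x + move j ((Q ^^ a) (\<lambda>x. move i g x + move j g x)) x\<bar>
    \<le> \<theta> ^ a * (4 - 2 * (1 - exclusion) * (1 - exclusion - disk_area) + 12 * real a * disk_area) * B"
proof -
  let ?c = "2 * (1 - exclusion) * (1 - exclusion - disk_area)"
  have I: "I \<subseteq> {..<n}" "i \<notin> I" "j \<notin> I" by (auto simp: I_def)
  have bi: "bmeas (move i g)" and bj: "bmeas (move j g)" using g ij by (auto intro: bmeas_move)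
  have bQ: "bmeas h \<Longrightarrow> bmeas ((Q ^^ b) h)" for h b unfolding Q_def using I by (intro bmeas_moves_power)
  have Q_add: "(Q ^^ b) (\<lambda>x. f x + h x) y = (Q ^^ b) f y + (Q ^^ b) h y"
    if "bmeas f" "bmeas h" "y \<in> space Conf" for f h y b
    using that(3)
  proof (induction b arbitrary: y)
    case (Suc b)
    have "Q ((Q ^^ b) (\<lambda>x. f x + h x)) y = Q (\<lambda>y. (Q ^^ b) f y + (Q ^^ b) h y) y"
      unfolding Q_def using Suc I by (intro moves_cong) (auto simp: Q_def)
    then show ?case using moves_add[OF bQ[OF that(1)] bQ[OF that(2)] Suc.prems I(1), of b b] by (simp add: Q_def)
  qed simp
  have bound: "\<bar>(Q ^^ b) h y\<bar> \<le> \<theta> ^ b * C"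
    if "bmeas h" "\<And>x. x \<in> space Conf \<Longrightarrow> \<bar>h x\<bar> \<le> C" "y \<in> space Conf" for h b C y
    unfolding Q_def \<theta>_def using moves_power_bound[OF that I(1)] .
  have mi: "\<bar>move k h y\<bar> \<le> C" if "k \<in> {i, j}" "bmeas h" "\<And>x. x \<in> space Conf \<Longrightarrow> \<bar>h x\<bar> \<le> C" "y \<in> space Conf" for k h C y
    using that ij by (intro move_bound) auto
  have split: "move k ((Q ^^ a) (\<lambda>x. move i g x + move j g x)) x
      = move k ((Q ^^ a) (move i g)) x + move k ((Q ^^ a) (move j g)) x" if k: "k \<in> {i, j}" for k
  proof -
    have "move k ((Q ^^ a) (\<lambda>x. move i g x + move j g x)) x
        = move k (\<lambda>y. (Q ^^ a) (move i g) y + (Q ^^ a) (move j g) y) x"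
      using k ij x Q_add[OF bi bj] by (intro move_cong) auto
    also have "\<dots> = move k ((Q ^^ a) (move i g)) x + move k ((Q ^^ a) (move j g)) x"
      using k ij x by (intro move_add bQ bi bj) auto
    finally show ?thesis .
  qed
  have same: "\<bar>move k ((Q ^^ a) (move k g)) x\<bar> \<le> \<theta> ^ a * B" if k: "k \<in> {i, j}" for k
  proof (rule mi[OF k])
    show "bmeas ((Q ^^ a) (move k g))" using k bi bj bQ by auto
    show "\<bar>(Q ^^ a) (move k g) y\<bar> \<le> \<theta> ^ a * B" if "y \<in> space Conf" for y
      using k bi bj that by (intro bound mi g B) auto
  qed (rule x)
  have comm: "\<bar>move k ((Q ^^ a) (move l g)) x - (Q ^^ a) (move k (move l g)) x\<bar> \<le> a * \<theta> ^ a * (6 * disk_area * B)"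
    if kl: "k \<in> {i, j}" "l \<in> {i, j}" for k l
    unfolding Q_def \<theta>_def
    by (rule commute_move_moves_power_bound) (use kl bi bj ij I x g B in \<open>auto intro!: mi\<close>)
  have "\<bar>(Q ^^ a) (\<lambda>x. move i (move j g) x + move j (move i g) x) x\<bar> \<le> \<theta> ^ a * ((2 - ?c) * B)"
  proof (rule bound)
    show "bmeas (\<lambda>x. move i (move j g) x + move j (move i g) x)"
      using g ij by (intro bmeas_add bmeas_move) auto
    show "\<bar>move i (move j g) y + move j (move i g) y\<bar> \<le> (2 - ?c) * B" if "y \<in> space Conf" for y
      by (rule double_move_antisymmetric[OF g B that ij anti dens])
  qed (rule x)
  moreover have "(Q ^^ a) (\<lambda>x. move i (move j g) x + move j (move i g) x) x
      = (Q ^^ a) (move i (move j g)) x + (Q ^^ a) (move j (move i g)) x"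
    using g ij x by (intro Q_add bmeas_move) auto
  ultimately have "\<bar>move i ((Q ^^ a) (move j g)) x + move j ((Q ^^ a) (move i g)) x\<bar>
      \<le> \<theta> ^ a * ((2 - ?c) * B) + 2 * (a * \<theta> ^ a * (6 * disk_area * B))"
    using comm[of i j] comm[of j i] by simp
  then have "\<bar>move i ((Q ^^ a) (\<lambda>x. move i g x + move j g x)) x + move j ((Q ^^ a) (\<lambda>x. move i g x + move j g x)) x\<bar>
      \<le> 2 * (\<theta> ^ a * B) + (\<theta> ^ a * ((2 - ?c) * B) + 2 * (a * \<theta> ^ a * (6 * disk_area * B)))"
    using split[of i] split[of j] same[of i] same[of j] by simp
  also have "\<dots> = \<theta> ^ a * (4 - ?c + 12 * real a * disk_area) * B" by (simp add: algebra_simps)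
  finally show ?thesis .
qed

lemma abs_add_divide_le: "\<bar>a + b / real n\<bar> \<le> \<bar>a\<bar> + \<bar>b\<bar> / real n"
  using abs_triangle_ineq[of a "b / real n"] by simp

text \<open>An expansion of (Q + R)^L in the moves of i and j. After one such move, m further steps
  bring a second one with weight of order m / n, and each pair loses a multiple of c (claim
  \<open>pairs\<close>); adding up over the first move gives a loss of order c * L^2 / n^2 (claim
  \<open>main\<close>). Both claims carry a prefix Q^a because the induction replaces one step by Q
  or by R. The condition 24 * L * disk_area \<le> c keeps the cost of commuting past at most L
  factors below half the gain.\<close>

lemma label_contraction:
  assumes g: "bmeas g" and B: "\<And>x. x \<in> space Conf \<Longrightarrow> \<bar>g x\<bar> \<le> B" and x: "x \<in> space Conf"
    and ij: "i < n" "j < n" "i \<noteq> j"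
    and anti: "\<And>x. x \<in> space Conf \<Longrightarrow> g (swp i j x) = - g x"
    and dens: "exclusion + disk_area \<le> 1"
  defines "c \<equiv> 2 * (1 - exclusion) * (1 - exclusion - disk_area)"
  assumes L: "24 * real L * disk_area \<le> c" "2 * L \<le> n"
  shows "\<bar>(step ^^ L) g x\<bar> \<le> (1 - c * L * (real L - 1) / (16 * (real n)\<^sup>2)) * B"
proof -
  define I where "I = {..<n} - {i, j}"
  define Q where "Q = moves I"
  define \<theta> where "\<theta> = real (card I) / real n"
  have cardI: "card I = n - 2" using ij by (simp add: I_def card_Diff_subset)
  have n2: "2 \<le> n" using ij by linarith
  have \<theta>: "\<theta> = 1 - 2 / n" using n_pos n2 by (simp add: \<theta>_def cardI of_nat_diff field_simps)
  have \<theta>0: "0 \<le> \<theta>" by (simp add: \<theta>_def)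
  have B0: "0 \<le> B" using B[OF x] by linarith
  have c0: "0 \<le> c" using dens disk_area_pos unfolding c_def by (intro mult_nonneg_nonneg) auto
  have I: "I \<subseteq> {..<n}" by (auto simp: I_def)
  have bQ: "bmeas h \<Longrightarrow> bmeas ((Q ^^ b) h)" for h b unfolding Q_def using I by (intro bmeas_moves_power)
  have Q_bound: "\<bar>(Q ^^ b) h y\<bar> \<le> \<theta> ^ b * C"
    if "bmeas h" "\<And>x. x \<in> space Conf \<Longrightarrow> \<bar>h x\<bar> \<le> C" "y \<in> space Conf" for h b C y
    unfolding Q_def \<theta>_def using moves_power_bound[OF that I] .
  define h where "h m = (step ^^ m) g" for m
  define p where "p m = (\<lambda>x. move i (h m) x + move j (h m) x)" for m
  have bh: "bmeas (h m)" for m unfolding h_def by (rule bmeas_step_power[OF g])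
  have h_le: "\<bar>h m x\<bar> \<le> B" if "x \<in> space Conf" for m x
    unfolding h_def by (rule step_power_bound[OF g B that])
  have h_anti: "h m (swp i j x) = - h m x" if "x \<in> space Conf" for m x
    unfolding h_def by (rule step_power_antisymmetric[OF g ij(1,2) that anti])
  have bp: "bmeas (p m)" for m unfolding p_def using bh ij by (intro bmeas_add bmeas_move) auto
  have h_Suc: "(Q ^^ a) (h (Suc m)) y = (Q ^^ Suc a) (h m) y + (Q ^^ a) (p m) y / n" if "y \<in> space Conf" for a m y
    using that
  proof (induction a arbitrary: y)
    case 0
    have "{..<n} = I \<union> {i, j}" using ij by (auto simp: I_def)
    then have "h (Suc m) y = moves I (h m) y + moves {i, j} (h m) y"
      using moves_split[of "{i, j}" I "h m" y] by (simp add: h_def I_def)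
    then show ?case using moves_pair[OF ij(3)] by (simp add: Q_def p_def)
  next
    case (Suc a)
    have "Q ((Q ^^ a) (h (Suc m))) y = Q (\<lambda>y. (Q ^^ Suc a) (h m) y + 1 / n * (Q ^^ a) (p m) y) y"
      unfolding Q_def using Suc I by (intro moves_cong) (auto simp: Q_def)
    also have "\<dots> = Q ((Q ^^ Suc a) (h m)) y + Q (\<lambda>y. 1 / n * (Q ^^ a) (p m) y) y"
      using moves_add[OF bQ[OF bh, of "Suc a"] bmeas_cmult[OF bQ[OF bp]] Suc.prems I] unfolding Q_def .
    also have "Q (\<lambda>y. 1 / n * (Q ^^ a) (p m) y) y = 1 / n * Q ((Q ^^ a) (p m)) y"
      unfolding Q_def moves_def move_cmult by (simp add: sum_distrib_left sum_divide_distrib)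
    finally show ?case by simp
  qed
  have pairs: "\<bar>move i ((Q ^^ a) (h m)) x + move j ((Q ^^ a) (h m)) x\<bar> \<le> \<theta> ^ a * (2 - m * (c / 4) / n) * B"
    if "a + m \<le> L" "x \<in> space Conf" for a m x
    using that
  proof (induction m arbitrary: a x)
    case 0
    have "\<bar>move k ((Q ^^ a) (h 0)) x\<bar> \<le> \<theta> ^ a * B" if "k \<in> {i, j}" for k
      using that ij 0 by (intro move_bound[OF bQ[OF bh]] Q_bound bh h_le) auto
    from this[of i] this[of j] show ?case by simp
  next
    case (Suc m)
    have k: "move k ((Q ^^ a) (h (Suc m))) x = move k ((Q ^^ Suc a) (h m)) x + move k ((Q ^^ a) (p m)) x / n"
      if "k \<in> {i, j}" for k
    proof -
      have "move k ((Q ^^ a) (h (Suc m))) x = move k (\<lambda>y. (Q ^^ Suc a) (h m) y + 1 / n * (Q ^^ a) (p m) y) x"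
        using that ij Suc.prems h_Suc[of _ a m] by (intro move_cong) auto
      also have "\<dots> = move k ((Q ^^ Suc a) (h m)) x + move k (\<lambda>y. 1 / n * (Q ^^ a) (p m) y) x"
        using that ij Suc.prems by (intro move_add bQ bh bp bmeas_cmult) auto
      finally show ?thesis unfolding move_cmult by simp
    qed
    have 1: "\<bar>move i ((Q ^^ Suc a) (h m)) x + move j ((Q ^^ Suc a) (h m)) x\<bar>
        \<le> \<theta> ^ Suc a * (2 - m * (c / 4) / n) * B"
      using Suc.prems by (intro Suc.IH) auto
    have "\<bar>move i ((Q ^^ a) (p m)) x + move j ((Q ^^ a) (p m)) x\<bar>
        \<le> \<theta> ^ a * (4 - c + 12 * real a * disk_area) * B"
      unfolding p_def Q_def I_def \<theta>_def c_def
      by (rule pair_moves_bound[OF bh h_le Suc.prems(2) ij h_anti dens])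
    \<comment> \<open>The commutation error 12 * a * disk_area uses up at most half of the gain
      c.\<close>
    also have "\<dots> \<le> \<theta> ^ a * (4 - c / 2) * B"
    proof -
      have "a \<le> L" using Suc.prems by simp
      then have "24 * real a * disk_area \<le> 24 * real L * disk_area" using disk_area_pos by (intro mult_right_mono) auto
      then show ?thesis using L(1) \<theta>0 B0 by (intro mult_right_mono mult_left_mono) auto
    qed
    finally have 2: "\<bar>move i ((Q ^^ a) (p m)) x + move j ((Q ^^ a) (p m)) x\<bar> / n \<le> \<theta> ^ a * (4 - c / 2) * B / n"
      using n_pos by (simp add: divide_right_mono)
    have "\<bar>move i ((Q ^^ a) (h (Suc m))) x + move j ((Q ^^ a) (h (Suc m))) x\<bar>
        = \<bar>(move i ((Q ^^ Suc a) (h m)) x + move j ((Q ^^ Suc a) (h m)) x)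
          + (move i ((Q ^^ a) (p m)) x + move j ((Q ^^ a) (p m)) x) / n\<bar>"
      using k[of i] k[of j] by (simp add: add_divide_distrib)
    also have "\<dots> \<le> \<bar>move i ((Q ^^ Suc a) (h m)) x + move j ((Q ^^ Suc a) (h m)) x\<bar>
          + \<bar>move i ((Q ^^ a) (p m)) x + move j ((Q ^^ a) (p m)) x\<bar> / n"
      by (rule abs_add_divide_le)
    also have "\<dots> \<le> \<theta> ^ Suc a * (2 - m * (c / 4) / n) * B + \<theta> ^ a * (4 - c / 2) * B / n"
      using 1 2 by linarith
    also have "\<dots> = \<theta> ^ a * B * (\<theta> * (2 - m * (c / 4) / n) + (4 - c / 2) / n)"
      by (simp add: algebra_simps)
    \<comment> \<open>Half of the gain c / (2 * n) pays for the product of 2 / n in \<theta> with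
      the loss accumulated so far, by 2 * m \<le> n. The other half is the new loss c / (4 *
      n).\<close>
    also have "\<dots> \<le> \<theta> ^ a * B * (2 - Suc m * (c / 4) / n)"
    proof (intro mult_left_mono)
      have "2 * real m \<le> n" using Suc.prems L(2) by linarith
      then have "2 * m * (c / 4) \<le> n * (c / 4)" using c0 by (intro mult_right_mono) auto
      then have "2 * m * (c / 4) / (real n)\<^sup>2 \<le> n * (c / 4) / (real n)\<^sup>2" by (rule divide_right_mono) simp
      also have "\<dots> = (c / 4) / n" using n_pos by (simp add: power2_eq_square)
      finally have le: "2 * m * (c / 4) / (real n)\<^sup>2 \<le> (c / 4) / n" .
      have "\<theta> * (2 - m * (c / 4) / n) + (4 - c / 2) / n
          = 2 - m * (c / 4) / n + 2 * m * (c / 4) / (real n)\<^sup>2 - 2 * ((c / 4) / n)"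
        unfolding \<theta> using n_pos by (simp add: field_simps power2_eq_square)
      also have "\<dots> \<le> 2 - Suc m * (c / 4) / n" using le by (simp add: add_divide_distrib distrib_right)
      finally show "\<theta> * (2 - m * (c / 4) / n) + (4 - c / 2) / n \<le> 2 - Suc m * (c / 4) / n" .
      show "0 \<le> \<theta> ^ a * B" using \<theta>0 B0 by simp
    qed
    finally show ?case by (simp add: mult_ac)
  qed
  have main: "\<bar>(Q ^^ a) (h m) x\<bar> \<le> \<theta> ^ a * ((1 - c * m * (real m - 1) / (16 * (real n)\<^sup>2)) * B)"
    if "a + m \<le> L" "x \<in> space Conf" for a m x
    using that
  proof (induction m arbitrary: a x)
    case 0
    have "\<bar>(Q ^^ a) (h 0) x\<bar> \<le> \<theta> ^ a * B" by (rule Q_bound[OF bh h_le 0(2)])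
    then show ?case by simp
  next
    case (Suc m)
    have "\<bar>p m y\<bar> \<le> (2 - m * (c / 4) / n) * B" if "y \<in> space Conf" for y
      using pairs[of 0 m y] that Suc.prems by (simp add: p_def)
    then have "\<bar>(Q ^^ a) (p m) x\<bar> \<le> \<theta> ^ a * ((2 - m * (c / 4) / n) * B)"
      using Suc.prems by (intro Q_bound bp) auto
    then have 2: "\<bar>(Q ^^ a) (p m) x\<bar> / n \<le> \<theta> ^ a * ((2 - m * (c / 4) / n) * B) / n"
      by (rule divide_right_mono) simp
    have 1: "\<bar>(Q ^^ Suc a) (h m) x\<bar> \<le> \<theta> ^ Suc a * ((1 - c * m * (real m - 1) / (16 * (real n)\<^sup>2)) * B)"
      using Suc.prems by (intro Suc.IH) auto
    have "\<bar>(Q ^^ a) (h (Suc m)) x\<bar> \<le> \<bar>(Q ^^ Suc a) (h m) x\<bar> + \<bar>(Q ^^ a) (p m) x\<bar> / n"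
      unfolding h_Suc[OF Suc.prems(2)] by (rule abs_add_divide_le)
    also have "\<dots> \<le> \<theta> ^ Suc a * ((1 - c * m * (real m - 1) / (16 * (real n)\<^sup>2)) * B)
        + \<theta> ^ a * ((2 - m * (c / 4) / n) * B) / n" using 1 2 by linarith
    also have "\<dots> = \<theta> ^ a * B * (\<theta> * (1 - c * m * (real m - 1) / (16 * (real n)\<^sup>2)) + (2 - m * (c / 4) / n) / n)"
      by (simp add: algebra_simps)
    \<comment> \<open>The gain c * m / (4 * n^2) splits into two equal parts: one covers the term of
      order n^(-3), the other is the increment of c * m * (m - 1) / (16 * n^2).\<close>
    also have "\<dots> \<le> \<theta> ^ a * B * (1 - c * Suc m * (real (Suc m) - 1) / (16 * (real n)\<^sup>2))"
    proof (intro mult_left_mono)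
      have "real m - 1 \<le> n" using Suc.prems L(2) by linarith
      then have "c * m * (real m - 1) \<le> c * m * n" using c0 by (intro mult_left_mono) auto
      then have "c * m * (real m - 1) / (8 * real n ^ 3) \<le> c * m * n / (8 * real n ^ 3)"
        by (rule divide_right_mono) simp
      also have "\<dots> = c * m / (8 * (real n)\<^sup>2)" using n_pos by (simp add: power2_eq_square power3_eq_cube)
      finally have le: "c * m * (real m - 1) / (8 * real n ^ 3) \<le> c * m / (8 * (real n)\<^sup>2)" .
      have "\<theta> * (1 - c * m * (real m - 1) / (16 * (real n)\<^sup>2)) + (2 - m * (c / 4) / n) / n
          = 1 - c * m * (real m - 1) / (16 * (real n)\<^sup>2) + c * m * (real m - 1) / (8 * real n ^ 3) - c * m / (4 * (real n)\<^sup>2)"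
        unfolding \<theta> using n_pos by (simp add: field_simps power2_eq_square power3_eq_cube)
      also have "\<dots> \<le> 1 - c * m * (real m - 1) / (16 * (real n)\<^sup>2) - c * m / (8 * (real n)\<^sup>2)"
        using le by (simp add: field_simps)
      also have "\<dots> = 1 - c * Suc m * (real (Suc m) - 1) / (16 * (real n)\<^sup>2)"
        using n_pos by (simp add: field_simps)
      finally show "\<theta> * (1 - c * m * (real m - 1) / (16 * (real n)\<^sup>2)) + (2 - m * (c / 4) / n) / n
          \<le> 1 - c * Suc m * (real (Suc m) - 1) / (16 * (real n)\<^sup>2)" .
      show "0 \<le> \<theta> ^ a * B" using \<theta>0 B0 by simp
    qed
    finally show ?case by (simp add: mult_ac)
  qed
  show ?thesis using main[of 0 L x] x by (simp add: h_def)
qed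

end

subsection \<open>Path coupling\<close>

text \<open>Coupling by averaging: \<open>S\<close> and \<open>S'\<close> are the sets of proposals accepted by only one of the two
  chains. Proposals in \<open>S'\<close> are paired with a proposal chosen uniformly from the larger set \<open>S\<close>.\<close>

lemma (in prob_space) paired_rejections_bound:
  fixes G G' w :: "'a \<Rightarrow> real"
  assumes S[measurable]: "S \<in> sets M" "S' \<in> sets M" and le: "prob S' \<le> prob S"
    and int: "integrable M G" "integrable M G'" "integrable M w"
    and F: "\<And>z. z \<in> S \<Longrightarrow> G z - gy \<le> F + A * w z + s"
    and FF: "\<And>z z'. z \<in> S \<Longrightarrow> z' \<in> S' \<Longrightarrow> G z - G' z' \<le> F + A * w z + s"
    and F0: "gx - gy \<le> F" and s: "0 \<le> s"
  shows "(\<integral>z. indicator S z * (G z - gy) \<partial>M) + (\<integral>z. indicator S' z * (gx - G' z) \<partial>M)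
    \<le> (prob S + prob S') * F + A * (\<integral>z. indicator S z * w z \<partial>M) + s"
proof -
  define \<alpha> \<beta> where "\<alpha> = prob S" and "\<beta> = prob S'"
  define \<Gamma> \<Gamma>' W where "\<Gamma> = (\<integral>z. indicator S z * G z \<partial>M)" and "\<Gamma>' = (\<integral>z. indicator S' z * G' z \<partial>M)"
    and "W = (\<integral>z. indicator S z * w z \<partial>M)"
  have i[simp]: "integrable M (indicator X :: 'a \<Rightarrow> real)" if "X \<in> sets M" for X
    using that by (simp add: emeasure_eq_measure)
  have iS[simp]: "integrable M (\<lambda>z. indicator X z * h z)" if "X \<in> sets M" "integrable M h" for X and h :: "'a \<Rightarrow> real"
    using integrable_mult_indicator[OF that] by simp
  have iSc: "(\<integral>z. indicator X z * c \<partial>M) = prob X * c" if "X \<in> sets M" for X and c :: real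
    using that by (simp add: emeasure_eq_measure)
  have e1: "(\<integral>z. indicator S z * (G z - gy) \<partial>M) = \<Gamma> - \<alpha> * gy"
    using int by (simp add: right_diff_distrib \<Gamma>_def \<alpha>_def Bochner_Integration.integral_diff)
  have e2: "(\<integral>z. indicator S' z * (gx - G' z) \<partial>M) = \<beta> * gx - \<Gamma>'"
    using int by (simp add: right_diff_distrib \<Gamma>'_def \<beta>_def Bochner_Integration.integral_diff)
  have bd: "(\<integral>z. indicator S z * (F + A * w z + s) \<partial>M) = \<alpha> * F + A * W + \<alpha> * s"
  proof -
    have "(\<integral>z. indicator S z * (F + A * w z + s) \<partial>M)
        = (\<integral>z. (indicator S z * F + A * (indicator S z * w z)) + indicator S z * s \<partial>M)"
      by (intro Bochner_Integration.integral_cong) (auto simp: algebra_simps)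
    also have "\<dots> = \<alpha> * F + A * W + \<alpha> * s"
      using int by (simp add: Bochner_Integration.integral_add \<alpha>_def W_def)
    finally show ?thesis .
  qed
  have iB: "integrable M (\<lambda>z. indicator S z * (F + A * w z + s))" using int by simp
  have iG: "integrable M (\<lambda>z. indicator S z * (G z - c))" for c using int by simp
  have "(\<integral>z. indicator S z * (G z - gy) \<partial>M) \<le> (\<integral>z. indicator S z * (F + A * w z + s) \<partial>M)"
    by (rule integral_mono[OF iG iB]) (auto simp: indicator_def F)
  then have E: "\<Gamma> - \<alpha> * F - A * W - \<alpha> * s \<le> \<alpha> * gy" unfolding e1 bd by linarith
  have G': "\<Gamma> - \<alpha> * F - A * W - \<alpha> * s \<le> \<alpha> * G' z'" if z': "z' \<in> S'" for z'
  proof -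
    have "(\<integral>z. indicator S z * (G z - G' z') \<partial>M) \<le> (\<integral>z. indicator S z * (F + A * w z + s) \<partial>M)"
      by (rule integral_mono[OF iG iB]) (auto simp: indicator_def FF z')
    moreover have "(\<integral>z. indicator S z * (G z - G' z') \<partial>M) = \<Gamma> - \<alpha> * G' z'"
      using int by (simp add: right_diff_distrib \<Gamma>_def \<alpha>_def Bochner_Integration.integral_diff)
    ultimately show ?thesis unfolding bd by linarith
  qed
  let ?E = "\<Gamma> - \<alpha> * F - A * W - \<alpha> * s"
  have "(\<integral>z. indicator S' z * ?E \<partial>M) \<le> (\<integral>z. \<alpha> * (indicator S' z * G' z) \<partial>M)"
  proof (rule integral_mono)
    show "integrable M (\<lambda>z. indicator S' z * ?E)" "integrable M (\<lambda>z. \<alpha> * (indicator S' z * G' z))"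
      using int by simp_all
    show "indicator S' z * ?E \<le> \<alpha> * (indicator S' z * G' z)" for z
      using G' by (simp add: indicator_def)
  qed
  then have G'2: "\<beta> * ?E \<le> \<alpha> * \<Gamma>'" by (simp add: \<beta>_def \<Gamma>'_def)
  have "(\<Gamma> - \<alpha> * gy) + (\<beta> * gx - \<Gamma>') \<le> (\<alpha> + \<beta>) * F + A * W + s"
  proof (cases "\<alpha> = 0")
    case True
    then have b: "\<beta> = 0" using le by (simp add: \<alpha>_def \<beta>_def measure_le_0_iff)
    have null: "(\<integral>z. indicator X z * h z \<partial>M) = 0" if X: "X \<in> sets M" "prob X = 0" for X and h :: "'a \<Rightarrow> real"
    proof -
      have "AE z in M. z \<notin> X" using X by (intro AE_I[of _ _ X]) (auto simp: emeasure_eq_measure)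
      then have "AE z in M. indicator X z * h z = 0" by eventually_elim simp
      then show ?thesis by (rule integral_eq_zero_AE)
    qed
    have "\<Gamma> = 0" "\<Gamma>' = 0" "W = 0" unfolding \<Gamma>_def \<Gamma>'_def W_def
      using True b by (auto intro!: null simp: \<alpha>_def \<beta>_def)
    then show ?thesis using True b s by simp
  next
    case False
    then have a: "0 < \<alpha>" by (simp add: \<alpha>_def zero_less_measure_iff)
    have ab: "\<beta> / \<alpha> \<le> 1" using a le by (simp add: \<alpha>_def \<beta>_def)
    \<comment> \<open>The fraction \<beta> / \<alpha> of the mass of S is matched with proposals in
      S'; the rest is compared with the value \<open>gy\<close> of the chain that stays put.\<close>
    have "\<beta> / \<alpha> * ?E \<le> \<Gamma>'" using G'2 a by (simp add: field_simps)
    then have "\<Gamma> - \<Gamma>' \<le> ?E * (1 - \<beta> / \<alpha>) + (\<alpha> * F + A * W + \<alpha> * s)" by (simp add: algebra_simps)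
    also have "?E * (1 - \<beta> / \<alpha>) \<le> (\<alpha> * gy) * (1 - \<beta> / \<alpha>)" using E ab by (intro mult_right_mono) auto
    also have "\<dots> = \<alpha> * gy - \<beta> * gy" using a by (simp add: field_simps)
    finally have "(\<Gamma> - \<alpha> * gy) + (\<beta> * gx - \<Gamma>') \<le> \<beta> * (gx - gy) + (\<alpha> * F + A * W + \<alpha> * s)"
      by (simp add: algebra_simps)
    also have "\<dots> \<le> \<beta> * F + (\<alpha> * F + A * W + 1 * s)"
      using F0 s prob_le_1 by (intro add_mono mult_left_mono mult_right_mono order_refl) (auto simp: \<beta>_def \<alpha>_def)
    finally show ?thesis by (simp add: algebra_simps)
  qed
  then show ?thesis unfolding e1 e2 by (simp add: \<alpha>_def \<beta>_def W_def)
qed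

context hard_disks
begin

section \<open>Lipschitz functions and the one-step contraction\<close>

definition cost :: "real \<times> real \<Rightarrow> real \<times> real \<Rightarrow> real" where
  "cost y z = disk_metric (torus_dist y z / (2 * r))"

text \<open>As in path coupling, only tuples that differ in one disk are compared. A metric on all
  tuples is never formed; \<open>lipschitz_osc\<close> adds up along a path that changes the disks
  one by one, whose points may be overlapping tuples.\<close>

definition lipschitz :: "real \<Rightarrow> ((nat \<Rightarrow> real \<times> real) \<Rightarrow> real) \<Rightarrow> bool" where
  "lipschitz A g \<longleftrightarrow> (\<forall>x\<in>space Conf. \<forall>y\<in>space Conf. \<forall>i<n. (\<forall>k. k \<noteq> i \<longrightarrow> x k = y k) \<longrightarrow>
     \<bar>g x - g y\<bar> \<le> A * cost (x i) (y i))"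

text \<open>The price of relabelling: how far g is from being a function of the unlabelled
  configuration.\<close>

definition label_osc :: "real \<Rightarrow> ((nat \<Rightarrow> real \<times> real) \<Rightarrow> real) \<Rightarrow> bool" where
  "label_osc s g \<longleftrightarrow> (\<forall>x\<in>space Conf. \<forall>i<n. \<forall>j<n. \<bar>g x - g (swp i j x)\<bar> \<le> s)"

lemma cost_commute: "cost y z = cost z y" by (simp add: cost_def torus_dist_commute)

lemma cost_bounds: "1 / 10000 \<le> cost y z" "cost y z \<le> 1"
  using disk_metric_bounds[of "torus_dist y z / (2 * r)"] r_pos by (simp_all add: cost_def)

lemma borel_measurable_cost [measurable (raw)]:
  assumes [measurable]: "f \<in> borel_measurable M" "h \<in> borel_measurable M"
  shows "(\<lambda>x. cost (f x) (h x)) \<in> borel_measurable M"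
  unfolding cost_def by measurable

lemma lipschitzD:
  "lipschitz A g \<Longrightarrow> x \<in> space Conf \<Longrightarrow> y \<in> space Conf \<Longrightarrow> i < n \<Longrightarrow> (\<And>k. k \<noteq> i \<Longrightarrow> x k = y k) \<Longrightarrow>
    \<bar>g x - g y\<bar> \<le> A * cost (x i) (y i)"
  unfolding lipschitz_def by blast

lemma lipschitzD1:
  assumes "lipschitz A g" "0 \<le> A" "x \<in> space Conf" "y \<in> space Conf" "i < n" "\<And>k. k \<noteq> i \<Longrightarrow> x k = y k"
  shows "\<bar>g x - g y\<bar> \<le> A"
proof -
  have "\<bar>g x - g y\<bar> \<le> A * cost (x i) (y i)" using assms by (intro lipschitzD) auto
  also have "\<dots> \<le> A * 1" using assms(2) cost_bounds by (intro mult_left_mono) auto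
  finally show ?thesis by simp
qed

text \<open>A moved disk at \<open>z\<close> is matched either with its own label or with the displaced disk \<open>i\<close>.\<close>

lemma hybrid_bound:
  assumes lip: "lipschitz A g" and A: "0 \<le> A" and osc: "label_osc s g"
    and xy: "x \<in> space Conf" "y \<in> space Conf" and ij: "i < n" "j < n" "i \<noteq> j"
    and eq: "\<And>k. k \<noteq> i \<Longrightarrow> x k = y k" and zv: "z \<in> unit_torus" "v \<in> unit_torus"
  shows "\<bar>g (x(j := z)) - g (y(j := v))\<bar>
    \<le> A * cost (x i) (y i) + A * (1 - max 0 (cost (x i) (y i) - cost z (y i))) + s"
proof -
  have in_C[simp]: "x(j := z) \<in> space Conf" "y(j := v) \<in> space Conf" "y(j := z) \<in> space Conf" "y(j := x i) \<in> space Conf"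
    using xy ij zv Conf_component[OF xy(1) ij(1)] by (auto intro: Conf_upd)
  have sw[simp]: "swp i j (x(j := z)) \<in> space Conf" using ij by (intro swp_in_Conf) auto
  have s0: "0 \<le> s" using osc xy ij unfolding label_osc_def by (meson abs_ge_zero order_trans)
  have "\<bar>g (x(j := z)) - g (y(j := z))\<bar> \<le> A * cost ((x(j := z)) i) ((y(j := z)) i)"
    using eq ij by (intro lipschitzD[OF lip]) auto
  moreover have "\<bar>g (y(j := z)) - g (y(j := v))\<bar> \<le> A"
    using ij by (intro lipschitzD1[OF lip A, of _ _ j]) auto
  ultimately have 1: "\<bar>g (x(j := z)) - g (y(j := v))\<bar> \<le> A * cost (x i) (y i) + A"
    using ij by simp
  \<comment> \<open>The second route interchanges the labels, which puts z at i and
    \<open>x i\<close> at j. The result differs from \<open>y(j := x i)\<close> at i alone, by z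
    against \<open>y i\<close>; the final change at j costs at most A.\<close>
  have "\<bar>g (x(j := z)) - g (swp i j (x(j := z)))\<bar> \<le> s"
    using osc ij in_C(1) unfolding label_osc_def by blast
  moreover have "\<bar>g (swp i j (x(j := z))) - g (y(j := x i))\<bar>
      \<le> A * cost (swp i j (x(j := z)) i) ((y(j := x i)) i)"
    by (rule lipschitzD[OF lip sw in_C(4) ij(1)]) (use ij eq in \<open>auto simp: swp_def lab_def\<close>)
  moreover have "swp i j (x(j := z)) i = z" by (simp add: swp_def lab_def)
  moreover have "\<bar>g (y(j := x i)) - g (y(j := v))\<bar> \<le> A"
    using ij by (intro lipschitzD1[OF lip A, of _ _ j]) auto
  ultimately have 2: "\<bar>g (x(j := z)) - g (y(j := v))\<bar> \<le> s + A * cost z (y i) + A"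
    using ij by simp
  show ?thesis
  proof (cases "cost (x i) (y i) \<le> cost z (y i)")
    case True then show ?thesis using 1 s0 by simp
  next
    case False then show ?thesis using 2 by (simp add: algebra_simps)
  qed
qed

lemma rejection_weight_bound:
  assumes S: "S \<in> sets torus_measure" "S \<subseteq> near y - near x"
  shows "(\<integral>z. indicator S z * (1 - max 0 (cost x y - cost z y)) \<partial>torus_measure)
    \<le> disk_area * (382058 / 617932) * cost x y"
proof -
  let ?w = "\<lambda>z. 1 - max 0 (cost x y - cost z y)"
  have w0: "0 \<le> ?w z" for z using cost_bounds(2)[of x y] cost_bounds(1)[of z y] by auto
  have "(\<integral>\<^sup>+z. ennreal (indicator S z * ?w z) \<partial>torus_measure)
      \<le> (\<integral>\<^sup>+z. indicator {z. torus_dist z y < 2 * r \<and> 2 * r \<le> torus_dist z x} z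
        * ennreal (1 - max 0 (disk_metric (torus_dist x y / (2 * r)) - disk_metric (torus_dist z y / (2 * r)))) \<partial>torus_measure)"
    using S(2) by (intro nn_integral_mono) (auto simp: indicator_def near_def cost_def)
  also have "\<dots> \<le> ennreal (pi * (2 * r)\<^sup>2 * (382058 / 617932) * disk_metric (torus_dist x y / (2 * r)))"
    using r_pos by (intro torus_crescent_bound) simp
  finally have "(\<integral>\<^sup>+z. ennreal (indicator S z * ?w z) \<partial>torus_measure) \<le> ennreal (disk_area * (382058 / 617932) * cost x y)"
    by (simp add: disk_area_def cost_def)
  moreover have "0 \<le> disk_area * (382058 / 617932) * cost x y"
    using disk_area_pos cost_bounds(1)[of x y] by simp
  moreover have "(\<integral>z. indicator S z * ?w z \<partial>torus_measure) = enn2real (\<integral>\<^sup>+z. ennreal (indicator S z * ?w z) \<partial>torus_measure)"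
    using S(1) w0 by (intro integral_eq_nn_integral) auto
  ultimately show ?thesis using enn2real_leI by presburger
qed

lemma sets_free: "x \<in> space Conf \<Longrightarrow> {z \<in> unit_torus. free x j z} \<in> sets torus_measure"
  using measurable_free[of "\<lambda>_. x" torus_measure "\<lambda>z. z" j] by (simp add: pred_def)

text \<open>The chains share a proposal unless only one of them accepts it: S lies in the crescent
  of \<open>y i\<close>, S' in that of \<open>x i\<close>. Pairing the two sets charges the crescent
  integral once, for the set of larger measure, instead of once for each. If that set is S', the
  pairing is applied to -g with the chains interchanged.\<close>

lemma other_move_bound:
  assumes g: "bmeas g" and lip: "lipschitz A g" and A: "0 \<le> A" and osc: "label_osc s g"
    and xy: "x \<in> space Conf" "y \<in> space Conf" and ij: "i < n" "j < n" "i \<noteq> j"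
    and eq: "\<And>k. k \<noteq> i \<Longrightarrow> x k = y k"
  shows "move j g x - move j g y \<le> A * cost (x i) (y i) * (1 + disk_area * (382058 / 617932)) + s"
proof -
  define F where "F = A * cost (x i) (y i)"
  define S where "S = {z \<in> unit_torus. free x j z} - {z \<in> unit_torus. free y j z}"
  define S' where "S' = {z \<in> unit_torus. free y j z} - {z \<in> unit_torus. free x j z}"
  have [measurable]: "S \<in> sets torus_measure" "S' \<in> sets torus_measure"
    unfolding S_def S'_def using sets_free xy by auto
  have s0: "0 \<le> s" using osc xy ij unfolding label_osc_def by (meson abs_ge_zero order_trans)
  have F0: "0 \<le> F" using A cost_bounds(1)[of "x i" "y i"] by (simp add: F_def)
  have S_near: "S \<subseteq> near (y i) - near (x i)"
    using ij eq by (auto simp: S_def free_def near_def not_less) (metis linorder_not_less)+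
  have S'_near: "S' \<subseteq> near (x i) - near (y i)"
    using ij eq by (auto simp: S'_def free_def near_def not_less) (metis linorder_not_less)+
  define G where "G = (\<lambda>z. g (x(j := z)))"
  define G' where "G' = (\<lambda>z. g (y(j := z)))"
  have m: "(\<lambda>z. x(j := z)) \<in> torus_measure \<rightarrow>\<^sub>M Conf" if "x \<in> space Conf" for x
    using that ij unfolding Conf_def
    by (intro measurable_fun_upd[where J = "{..<n}"]) (auto simp: Conf_def)
  have Gint: "integrable torus_measure G" "integrable torus_measure G'"
    unfolding G_def G'_def by (intro integrable_bounded_upd[OF g] m xy)+
  define w where "w = (\<lambda>z. 1 - max 0 (cost (x i) (y i) - cost z (y i)))"
  define w' where "w' = (\<lambda>z. 1 - max 0 (cost (y i) (x i) - cost z (x i)))"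
  have wint: "integrable torus_measure w" "integrable torus_measure w'"
  proof -
    have "\<bar>1 - max 0 (cost a b - cost c b)\<bar> \<le> 1" for a b c
      using cost_bounds(2)[of a b] cost_bounds(1)[of c b] by auto
    then show "integrable torus_measure w" "integrable torus_measure w'"
      unfolding w_def w'_def by (intro T.integrable_const_bound[of _ 1]; simp)+
  qed
  have hy: "\<bar>G z - g (y(j := v))\<bar> \<le> F + A * w z + s" if "z \<in> unit_torus" "v \<in> unit_torus" for z v
    unfolding G_def F_def w_def by (rule hybrid_bound[OF lip A osc xy ij eq that])
  have hx: "\<bar>G' z - g (x(j := v))\<bar> \<le> F + A * w' z + s" if "z \<in> unit_torus" "v \<in> unit_torus" for z v
    using hybrid_bound[OF lip A osc xy(2,1) ij eq[symmetric] that]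
    by (simp add: G'_def F_def w'_def cost_commute[of "x i" "y i"])
  have yj: "y j \<in> unit_torus" "x j \<in> unit_torus" using xy ij by (auto intro: Conf_component)
  have gxy: "g x - g y \<le> F"
    using lipschitzD[OF lip xy ij(1) eq] by (simp add: F_def)
  let ?J = "(\<integral>z. indicator S z * (G z - g y) \<partial>torus_measure) + (\<integral>z. indicator S' z * (g x - G' z) \<partial>torus_measure)"
  let ?W = "disk_area * (382058 / 617932) * cost (x i) (y i)"
  have "?J \<le> (T.prob S + T.prob S') * F + A * ?W + s"
  proof (cases "T.prob S' \<le> T.prob S")
    case True
    have "?J \<le> (T.prob S + T.prob S') * F + A * (\<integral>z. indicator S z * w z \<partial>torus_measure) + s"
    proof (rule T.paired_rejections_bound)
      \<comment> \<open>The choice v = \<open>y j\<close> represents the chain that rejects, since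
        y(j := y j) is y.\<close>
      show "G z - g y \<le> F + A * w z + s" if "z \<in> S" for z
        using hy[of z "y j"] that yj by (simp add: S_def abs_le_iff)
      show "G z - G' z' \<le> F + A * w z + s" if "z \<in> S" "z' \<in> S'" for z z'
        using hy[of z z'] that by (simp add: S_def S'_def G'_def abs_le_iff)
    qed (use Gint wint True gxy s0 in auto)
    also have "\<dots> \<le> (T.prob S + T.prob S') * F + A * ?W + s"
      using rejection_weight_bound[OF _ S_near] A by (intro add_mono mult_left_mono) (auto simp: w_def)
    finally show ?thesis .
  next
    case False
    have "(\<integral>z. indicator S' z * ((- G' z) - (- g x)) \<partial>torus_measure) + (\<integral>z. indicator S z * ((- g y) - (- G z)) \<partial>torus_measure)
        \<le> (T.prob S' + T.prob S) * F + A * (\<integral>z. indicator S' z * w' z \<partial>torus_measure) + s"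
    proof (rule T.paired_rejections_bound)
      show "- G' z - - g x \<le> F + A * w' z + s" if "z \<in> S'" for z
        using hx[of z "x j"] that yj by (simp add: S'_def abs_le_iff)
      show "- G' z' - - G z \<le> F + A * w' z' + s" if "z' \<in> S'" "z \<in> S" for z z'
        using hx[of z' z] that by (simp add: S_def S'_def G_def abs_le_iff)
    qed (use Gint wint False gxy s0 in auto)
    also have "\<dots> \<le> (T.prob S' + T.prob S) * F + A * (disk_area * (382058 / 617932) * cost (y i) (x i)) + s"
      using rejection_weight_bound[OF _ S'_near] A by (intro add_mono mult_left_mono) (auto simp: w'_def)
    finally show ?thesis by (simp add: add.commute cost_commute[of "y i" "x i"])
  qed
  moreover have "move j g x - move j g y \<le> ?J + (1 - T.prob S - T.prob S') * F"
  proof -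
    have iS: "integrable torus_measure (indicator X :: _ \<Rightarrow> real)" if "X \<in> sets torus_measure" for X
      using that by (simp add: T.emeasure_eq_measure)
    have iSh: "integrable torus_measure (\<lambda>z. indicator X z * h z)"
      if "X \<in> sets torus_measure" "integrable torus_measure h" for X and h :: "_ \<Rightarrow> real"
      using integrable_mult_indicator[OF that] by simp
    have i1: "integrable torus_measure (\<lambda>z. indicator S z * (G z - g y))"
      and i2: "integrable torus_measure (\<lambda>z. indicator S' z * (g x - G' z))"
      using Gint by (auto intro!: iSh)
    have i3: "integrable torus_measure (\<lambda>z. (1 - indicator S z - indicator S' z) * F)"
      by (rule integrable_mult_left) (intro Bochner_Integration.integrable_diff iS; simp)
    have "move j g x - move j g y = (\<integral>z. g (upd j x z) - g (upd j y z) \<partial>torus_measure)"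
      unfolding move_def using integrable_move[OF g] xy ij by simp
    also have "\<dots> \<le> (\<integral>z. (indicator S z * (G z - g y) + indicator S' z * (g x - G' z))
        + (1 - indicator S z - indicator S' z) * F \<partial>torus_measure)"
    proof (intro integral_mono)
      fix z assume "z \<in> space torus_measure"
      then have z: "z \<in> unit_torus" by simp
      show "g (upd j x z) - g (upd j y z) \<le> (indicator S z * (G z - g y) + indicator S' z * (g x - G' z))
        + (1 - indicator S z - indicator S' z) * F"
      proof -
        consider "free x j z" "free y j z" | "free x j z" "\<not> free y j z" | "\<not> free x j z" "free y j z"
          | "\<not> free x j z" "\<not> free y j z" by blast
        then show ?thesis
        proof cases
          case 1
          have "\<bar>g (x(j := z)) - g (y(j := z))\<bar> \<le> A * cost ((x(j := z)) i) ((y(j := z)) i)"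
            using eq ij xy z by (intro lipschitzD[OF lip]) (auto intro: Conf_upd)
          then show ?thesis using 1 ij by (simp add: upd_def S_def S'_def F_def)
        qed (use z gxy in \<open>auto simp: upd_def S_def S'_def G_def G'_def\<close>)
      qed
    qed (use i1 i2 i3 integrable_move[OF g] xy ij in auto)
    also have "\<dots> = ?J + (\<integral>z. (1 - indicator S z - indicator S' z) * F \<partial>torus_measure)"
      using i1 i2 i3 by (simp add: Bochner_Integration.integral_add)
    also have "(\<integral>z. (1 - indicator S z - indicator S' z) * F \<partial>torus_measure) = (1 - T.prob S - T.prob S') * F"
    proof -
      have "(\<integral>z. 1 - indicator S z - indicator S' z \<partial>torus_measure) = 1 - T.prob S - T.prob S'"
      proof -
        have "S \<inter> unit_torus = S" "S' \<inter> unit_torus = S'" by (auto simp: S_def S'_def)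
        then show ?thesis using iS[of S] iS[of S'] T.prob_space by (simp add: Bochner_Integration.integral_diff)
      qed
      moreover have "(\<integral>z. (1 - indicator S z - indicator S' z) * F \<partial>torus_measure)
          = (\<integral>z. 1 - indicator S z - indicator S' z \<partial>torus_measure) * F"
        by (rule Bochner_Integration.integral_mult_left_zero)
      ultimately show ?thesis by (simp only:)
    qed
    finally show ?thesis .
  qed
  ultimately have "move j g x - move j g y \<le> F + A * ?W + s" by (simp add: algebra_simps)
  then show ?thesis by (simp add: F_def algebra_simps)
qed

text \<open>Both chains accept the same proposals for disk i, and an accepted one makes them equal.
  Only a blocked proposal preserves the discrepancy.\<close>

lemma same_move_bound:
  assumes g: "bmeas g" and lip: "lipschitz A g" and A: "0 \<le> A"
    and xy: "x \<in> space Conf" "y \<in> space Conf" and i: "i < n"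
    and eq: "\<And>k. k \<noteq> i \<Longrightarrow> x k = y k"
  shows "move i g x - move i g y \<le> exclusion * (A * cost (x i) (y i))"
proof -
  define F where "F = A * cost (x i) (y i)"
  have F0: "0 \<le> F" using A cost_bounds(1)[of "x i" "y i"] by (simp add: F_def)
  define N where "N = blocked x ({..<n} - {i})"
  have [measurable]: "N \<in> sets torus_measure" by (simp add: N_def)
  have iN: "integrable torus_measure (\<lambda>z. indicator N z * F)"
    by (simp add: T.emeasure_eq_measure)
  have gxy: "g x - g y \<le> F" using lipschitzD[OF lip xy i eq] by (simp add: F_def)
  have "move i g x - move i g y = (\<integral>z. g (upd i x z) - g (upd i y z) \<partial>torus_measure)"
    unfolding move_def using integrable_move[OF g] xy i by simp
  also have "\<dots> \<le> (\<integral>z. indicator N z * F \<partial>torus_measure)"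
  proof (intro integral_mono)
    fix z assume "z \<in> space torus_measure"
    then have z: "z \<in> unit_torus" by simp
    have fr: "free y i z = free x i z" using eq by (auto simp: free_def)
    have "x(i := z) = y(i := z)" using eq by auto
    moreover have "free x i z \<longleftrightarrow> z \<notin> N" using z by (auto simp: free_def N_def blocked_def not_less)
    ultimately show "g (upd i x z) - g (upd i y z) \<le> indicator N z * F"
      using gxy by (auto simp: upd_def fr)
  qed (use iN integrable_move[OF g] xy i in auto)
  also have "\<dots> = T.prob N * F"
  proof -
    have "N \<inter> unit_torus = N" by (auto simp: N_def blocked_def)
    then show ?thesis by simp
  qed
  also have "\<dots> \<le> exclusion * F"
  proof (intro mult_right_mono F0)
    have "T.prob N \<le> card ({..<n} - {i}) * disk_area" unfolding N_def by (rule measure_blocked) simp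
    also have "\<dots> \<le> n * disk_area"
      using disk_area_pos card_mono[of "{..<n}" "{..<n} - {i}"] by (intro mult_right_mono) auto
    finally show "T.prob N \<le> exclusion" by (simp add: exclusion_def)
  qed
  finally show ?thesis by (simp add: F_def)
qed

text \<open>The margin 1 / 100000 is what 0.617932 and 0.382058 leave of 1: coalescence outweighs
  new discrepancies by this amount. The error s is at most 10000 * s * cost because the cost is
  bounded below, and so joins the Lipschitz constant.\<close>

lemma step_contraction:
  assumes g: "bmeas g" and lip: "lipschitz A g" and A: "0 \<le> A" and osc: "label_osc s g"
    and ex: "exclusion \<le> 617932 / 1000000"
  shows "lipschitz ((1 - 1 / (100000 * n)) * A + 10000 * s) (moves {..<n} g)"
proof -
  have one: "moves {..<n} g x - moves {..<n} g y \<le> ((1 - 1 / (100000 * n)) * A + 10000 * s) * cost (x i) (y i)"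
    if xy: "x \<in> space Conf" "y \<in> space Conf" and i: "i < n" and eq: "\<And>k. k \<noteq> i \<Longrightarrow> x k = y k" for x y i
  proof -
    define F where "F = A * cost (x i) (y i)"
    have F0: "0 \<le> F" using A cost_bounds(1)[of "x i" "y i"] by (simp add: F_def)
    have s0: "0 \<le> s" using osc xy i unfolding label_osc_def by (meson abs_ge_zero order_trans)
    have "(\<Sum>j<n. move j g x) - (\<Sum>j<n. move j g y) = (\<Sum>j<n. move j g x - move j g y)"
      by (simp add: sum_subtractf)
    also have "\<dots> = (move i g x - move i g y) + (\<Sum>j\<in>{..<n} - {i}. move j g x - move j g y)"
      using i by (simp add: sum.remove)
    also have "\<dots> \<le> exclusion * F + (\<Sum>j\<in>{..<n} - {i}. F * (1 + disk_area * (382058 / 617932)) + s)"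
    proof (intro add_mono sum_mono)
      show "move i g x - move i g y \<le> exclusion * F"
        unfolding F_def by (rule same_move_bound[OF g lip A xy i eq])
      show "move j g x - move j g y \<le> F * (1 + disk_area * (382058 / 617932)) + s" if "j \<in> {..<n} - {i}" for j
        unfolding F_def by (rule other_move_bound[OF g lip A osc xy i _ _ eq]) (use that in auto)
    qed
    also have "\<dots> = exclusion * F + (real n - 1) * (F * (1 + disk_area * (382058 / 617932)) + s)"
      using i by (simp add: of_nat_diff Suc_leI)
    also have "\<dots> \<le> (n - 1 / 100000) * F + n * s"
    proof -
      define K where "K = disk_area * (382058 / 617932)"
      have "(real n - 1) * s \<le> n * s" using s0 by (intro mult_right_mono) auto
      moreover have "(real n - 1) * (F * K) \<le> n * (F * K)"
        using F0 disk_area_pos by (intro mult_right_mono) (auto simp: K_def)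
      moreover have "exclusion * F + n * (F * K) = exclusion * (1 + 382058 / 617932) * F"
        by (simp add: K_def exclusion_def algebra_simps)
      moreover have "exclusion * (1 + 382058 / 617932) * F \<le> (1 - 1 / 100000) * F"
        using ex F0 by (intro mult_right_mono) auto
      moreover have "(real n - 1) * (F * (1 + K) + s) = n * F - F + (real n - 1) * (F * K) + (real n - 1) * s"
        by (simp add: algebra_simps)
      moreover have "(n - 1 / 100000) * F = n * F - F + (1 - 1 / 100000) * F" by (simp add: algebra_simps)
      \<comment> \<open>The linear conclusion is stated for abstract variables, so that the products
        above enter as atoms.\<close>
      moreover have "a + b \<le> c + c'"
        if "c' \<ge> d" "e' \<ge> e" "a + e' = a'" "a' \<le> a''" "b = m + e + d" "c = m + a''" for a a' a'' b c c' d e e' m :: real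
        using that by linarith
      ultimately show ?thesis unfolding K_def[symmetric] by blast
    qed
    finally have "moves {..<n} g x - moves {..<n} g y \<le> ((n - 1 / 100000) * F + n * s) / n"
      unfolding moves_def diff_divide_distrib[symmetric] using n_pos by (intro divide_right_mono) auto
    also have "\<dots> = (1 - 1 / (100000 * n)) * F + s" using n_pos by (simp add: field_simps)
    also have "\<dots> \<le> (1 - 1 / (100000 * n)) * F + 10000 * s * cost (x i) (y i)"
      using mult_left_mono[OF cost_bounds(1)[of "x i" "y i"] s0] by simp
    finally show ?thesis by (simp add: F_def algebra_simps)
  qed
  show ?thesis unfolding lipschitz_def
  proof (intro ballI allI impI)
    fix x y i assume xy: "x \<in> space Conf" "y \<in> space Conf" "i < n" and eq: "\<forall>k. k \<noteq> i \<longrightarrow> x k = y k"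
    show "\<bar>moves {..<n} g x - moves {..<n} g y\<bar> \<le> ((1 - 1 / (100000 * n)) * A + 10000 * s) * cost (x i) (y i)"
      using one[OF xy, of] one[OF xy(2,1,3)] eq cost_commute[of "x i" "y i"] by (simp add: abs_le_iff)
  qed
qed


subsection \<open>The chain on configurations\<close>

abbreviation Omega :: "(nat \<Rightarrow> real \<times> real) set" where "Omega \<equiv> configurations n r"

lemma Omega_eq: "Omega = {x \<in> space Conf. \<forall>i<n. \<forall>j<n. i \<noteq> j \<longrightarrow> 2 * r \<le> torus_dist (x i) (x j)}"
  by (simp add: configurations_def space_Conf)

lemma Omega_sets [measurable]: "Omega \<in> sets Conf"
proof -
  have "Measurable.pred Conf (\<lambda>x. \<forall>i\<in>{..<n}. \<forall>j\<in>{..<n} - {i}. 2 * r \<le> torus_dist (x i) (x j))"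
    by (intro pred_intros_finite) (auto intro!: borel_measurable_le borel_measurable_const
        borel_measurable_torus_dist measurable_Conf_component)
  moreover have "Omega = {x \<in> space Conf. \<forall>i\<in>{..<n}. \<forall>j\<in>{..<n} - {i}. 2 * r \<le> torus_dist (x i) (x j)}"
    by (auto simp: Omega_eq)
  ultimately show ?thesis by (simp add: pred_def)
qed

lemma Omega_Conf: "x \<in> Omega \<Longrightarrow> x \<in> space Conf" by (simp add: Omega_eq)

lemma config_measure_eq: "config_measure n r = restrict_space Conf Omega"
  by (simp add: config_measure_def Conf_def)

lemma space_config_measure: "space (config_measure n r) = Omega"
  using Omega_Conf by (auto simp: config_measure_eq space_restrict_space)

lemma upd_in_Omega: "x \<in> Omega \<Longrightarrow> j < n \<Longrightarrow> z \<in> unit_torus \<Longrightarrow> upd j x z \<in> Omega"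
  by (auto simp: Omega_eq upd_def free_def torus_dist_commute intro!: Conf_upd)

lemma measurable_config_Conf: "g \<in> borel_measurable Conf \<Longrightarrow> g \<in> borel_measurable (config_measure n r)"
  unfolding config_measure_eq by (rule measurable_restrict_space1)

lemma measurable_into_config: "f \<in> M \<rightarrow>\<^sub>M Conf \<Longrightarrow> (\<And>x. x \<in> space M \<Longrightarrow> f x \<in> Omega) \<Longrightarrow> f \<in> M \<rightarrow>\<^sub>M config_measure n r"
  unfolding config_measure_eq by (intro measurable_restrict_space2) auto

abbreviation choice :: "(nat \<times> real \<times> real) measure" where
  "choice \<equiv> uniform_count_measure {..<n} \<Otimes>\<^sub>M torus_measure"

lemma prob_space_uniform: "prob_space (uniform_count_measure {..<n})"
  using n_pos by (intro prob_space_uniform_count_measure) auto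

lemma disk_step_eq: "disk_step n r x = distr choice (config_measure n r) (\<lambda>p. upd (fst p) x (snd p))"
  by (simp add: disk_step_def upd_def free_def case_prod_beta')

lemma measurable_choice_upd:
  "(\<lambda>q. upd (fst (snd q)) (fst q) (snd (snd q))) \<in> config_measure n r \<Otimes>\<^sub>M choice \<rightarrow>\<^sub>M config_measure n r"
proof (rule measurable_into_config)
  let ?N = "config_measure n r \<Otimes>\<^sub>M choice"
  have id: "(\<lambda>x. x) \<in> config_measure n r \<rightarrow>\<^sub>M Conf"
    unfolding config_measure_eq by (rule measurable_restrict_space1) simp
  have "(\<lambda>q. fst (snd q)) \<in> ?N \<rightarrow>\<^sub>M uniform_count_measure {..<n}"
    by measurable
  then have c: "(\<lambda>q. fst (snd q)) \<in> ?N \<rightarrow>\<^sub>M count_space {..<n}"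
    by (simp add: measurable_def space_uniform_count_measure sets_uniform_count_measure)
  show "(\<lambda>q. upd (fst (snd q)) (fst q) (snd (snd q))) \<in> ?N \<rightarrow>\<^sub>M Conf"
  proof (rule measurable_compose_countable'[OF _ c])
    fix j assume "j \<in> {..<n}"
    then show "(\<lambda>q. upd j (fst q) (snd (snd q))) \<in> ?N \<rightarrow>\<^sub>M Conf"
      by (intro measurable_upd measurable_compose[OF measurable_fst id]
          measurable_compose[OF measurable_snd measurable_snd]) auto
  qed simp
  show "upd (fst (snd q)) (fst q) (snd (snd q)) \<in> Omega" if "q \<in> space ?N" for q
    using that by (auto simp: space_pair_measure space_config_measure space_uniform_count_measure intro!: upd_in_Omega)
qed

lemma prob_space_choice: "prob_space choice"
proof -
  interpret U: prob_space "uniform_count_measure {..<n}" by (rule prob_space_uniform)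
  interpret C: pair_prob_space "uniform_count_measure {..<n}" torus_measure ..
  show ?thesis by (rule C.P.prob_space_axioms)
qed

lemma measurable_disk_step: "disk_step n r \<in> config_measure n r \<rightarrow>\<^sub>M subprob_algebra (config_measure n r)"
proof -
  interpret C: prob_space choice by (rule prob_space_choice)
  have "choice \<in> space (subprob_algebra choice)"
    by (rule C.M_in_subprob)
  then have "(\<lambda>x. distr choice (config_measure n r) (\<lambda>p. upd (fst p) x (snd p)))
      \<in> config_measure n r \<rightarrow>\<^sub>M subprob_algebra (config_measure n r)"
    using measurable_choice_upd by (intro measurable_distr2[where M = choice] measurable_const)
      (auto simp: case_prod_beta')
  then show ?thesis by (simp add: disk_step_eq[abs_def])
qed

lemma integral_disk_step:
  assumes g: "bmeas g" and x: "x \<in> Omega"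
  shows "(\<integral>y. g y \<partial>disk_step n r x) = step g x"
proof -
  interpret U: prob_space "uniform_count_measure {..<n}" by (rule prob_space_uniform)
  interpret C: pair_prob_space "uniform_count_measure {..<n}" torus_measure ..
  have xC: "x \<in> space Conf" using x by (rule Omega_Conf)
  have m: "(\<lambda>p. upd (fst p) x (snd p)) \<in> choice \<rightarrow>\<^sub>M config_measure n r"
    using measurable_compose[OF measurable_Pair[OF measurable_const measurable_ident_sets[OF refl]] measurable_choice_upd]
      x space_config_measure by fastforce
  have gm: "g \<in> borel_measurable (config_measure n r)" by (rule measurable_config_Conf[OF bmeasD[OF g]])
  obtain B where B: "\<And>x. x \<in> space Conf \<Longrightarrow> \<bar>g x\<bar> \<le> B" using g by (auto simp: bmeas_def)
  have int: "integrable choice (\<lambda>p. g (upd (fst p) x (snd p)))"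
  proof (rule C.integrable_const_bound[of _ B])
    show "AE p in choice. norm (g (upd (fst p) x (snd p))) \<le> B"
      using measurable_space[OF m] B Omega_Conf by (intro AE_I2) (auto simp: space_config_measure)
  qed (rule measurable_compose[OF m gm])
  have "(\<integral>y. g y \<partial>disk_step n r x) = (\<integral>p. g (upd (fst p) x (snd p)) \<partial>choice)"
    unfolding disk_step_eq by (rule integral_distr[OF m gm])
  also have "\<dots> = (\<integral>j. move j g x \<partial>uniform_count_measure {..<n})"
    unfolding move_def using C.integral_fst'[OF int] by simp
  also have "\<dots> = (\<Sum>j<n. move j g x) / n"
  proof -
    have "(\<integral>j. move j g x \<partial>uniform_count_measure {..<n}) = (\<integral>j. move j g x \<partial>point_measure {..<n} (\<lambda>_. ennreal (1 / n)))"
      by (simp add: uniform_count_measure_def ennreal_divide_numeral divide_ennreal)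
    also have "\<dots> = (\<Sum>j<n. 1 / n * move j g x)"
      by (subst lebesgue_integral_point_measure_finite) auto
    finally show ?thesis by (simp add: sum_divide_distrib)
  qed
  finally show ?thesis by (simp add: moves_def)
qed

lemma sets_disk_step: "sets (disk_step n r y) = sets (config_measure n r)"
  by (simp add: disk_step_eq)

lemma prob_space_disk_step:
  assumes y: "y \<in> Omega"
  shows "prob_space (disk_step n r y)"
proof -
  have m: "(\<lambda>p. upd (fst p) y (snd p)) \<in> choice \<rightarrow>\<^sub>M config_measure n r"
    using measurable_compose[OF measurable_Pair[OF measurable_const measurable_ident_sets[OF refl]] measurable_choice_upd]
      y space_config_measure by fastforce
  show ?thesis unfolding disk_step_eq
    by (rule prob_space.prob_space_distr[OF prob_space_choice m])
qed

lemma disk_chain_facts: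
  assumes x: "x \<in> Omega"
  shows "sets (disk_chain n r x t) = sets (config_measure n r)" "prob_space (disk_chain n r x t)"
proof -
  have "sets (disk_chain n r x t) = sets (config_measure n r) \<and> prob_space (disk_chain n r x t)"
  proof (induction t)
    case 0
    then show ?case using x by (auto simp: space_config_measure intro!: prob_space_return)
  next
    case (Suc t)
    interpret C: prob_space "disk_chain n r x t" using Suc by simp
    have sp: "space (disk_chain n r x t) = Omega" using Suc sets_eq_imp_space_eq space_config_measure by blast
    have ms: "disk_step n r \<in> disk_chain n r x t \<rightarrow>\<^sub>M subprob_algebra (config_measure n r)"
      using measurable_disk_step Suc measurable_cong_sets by blast
    have ne: "space (disk_chain n r x t) \<noteq> {}" using x sp by auto
    have "prob_space (disk_chain n r x t \<bind> disk_step n r)"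
      using sp ms prob_space_disk_step by (intro C.prob_space_bind[where S = "config_measure n r"]) (auto intro!: AE_I2)
    moreover have "sets (disk_chain n r x t \<bind> disk_step n r) = sets (config_measure n r)"
      using ne by (intro sets_bind sets_disk_step)
    ultimately show ?case by simp
  qed
  then show "sets (disk_chain n r x t) = sets (config_measure n r)" "prob_space (disk_chain n r x t)" by auto
qed

text \<open>Duality between kernels and operators. The last step of the chain is the operator
  applied first to g, so the induction runs over all g at once.\<close>

lemma integral_disk_chain:
  assumes x: "x \<in> Omega" and g: "bmeas g"
  shows "(\<integral>y. g y \<partial>disk_chain n r x t) = (step ^^ t) g x"
  using g
proof (induction t arbitrary: g)
  case 0
  then show ?case using x by (simp add: integral_return space_config_measure measurable_config_Conf bmeasD)
next
  case (Suc t)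
  note facts = disk_chain_facts[OF x, of t]
  interpret C: prob_space "disk_chain n r x t" by (rule facts)
  have sp: "space (disk_chain n r x t) = Omega" using facts(1) sets_eq_imp_space_eq space_config_measure by blast
  have ms: "disk_step n r \<in> disk_chain n r x t \<rightarrow>\<^sub>M subprob_algebra (config_measure n r)"
    using measurable_disk_step facts(1) measurable_cong_sets by blast
  obtain B where B: "\<And>x. x \<in> space Conf \<Longrightarrow> \<bar>g x\<bar> \<le> B" using Suc.prems by (auto simp: bmeas_def)
  have "(\<integral>y. g y \<partial>disk_chain n r x (Suc t)) = (\<integral>y. (\<integral>z. g z \<partial>disk_step n r y) \<partial>disk_chain n r x t)"
    unfolding disk_chain.simps
    by (rule integral_bind[where K = "config_measure n r" and B = B and B' = 1])
      (use ms Suc.prems B sp prob_space.emeasure_space_1[OF prob_space_disk_step]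
        in \<open>auto simp: space_config_measure Omega_Conf measurable_config_Conf bmeasD intro!: AE_I2\<close>)
  also have "\<dots> = (\<integral>y. step g y \<partial>disk_chain n r x t)"
    using sp integral_disk_step[OF Suc.prems] by (intro Bochner_Integration.integral_cong) auto
  also have "\<dots> = (step ^^ t) (step g) x" using Suc.IH[OF bmeas_step[OF Suc.prems]] .
  finally show ?case by (simp add: funpow_swap1)
qed



section \<open>Stationarity and total variation\<close>

lemma prob_space_Conf: "prob_space Conf"
  unfolding Conf_def by (intro prob_space_PiM prob_space_torus_measure)

lemma integrable_Omega: "bmeas h \<Longrightarrow> integrable Conf (\<lambda>x. indicator Omega x * h x)"
proof -
  assume h: "bmeas h"
  interpret C: prob_space Conf by (rule prob_space_Conf)
  obtain B where B: "\<And>x. x \<in> space Conf \<Longrightarrow> \<bar>h x\<bar> \<le> B" using h by (auto simp: bmeas_def)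
  have "integrable Conf h"
    by (rule C.integrable_const_bound[of _ B]) (use B bmeasD[OF h] in auto)
  from integrable_mult_indicator[OF Omega_sets this] show ?thesis by simp
qed

text \<open>With the other disks fixed, let b be the area left free for disk j. The move stays put
  with probability 1 - b and otherwise jumps to a uniform point of the free region; both parts
  preserve Lebesgue measure on that region, so the inner Fubini integrals agree.\<close>

lemma stationary_move:
  assumes g: "bmeas g" and j: "j < n"
  shows "(\<integral>x. indicator Omega x * move j g x \<partial>Conf) = (\<integral>x. indicator Omega x * g x \<partial>Conf)"
proof -
  interpret P: product_sigma_finite "\<lambda>_::nat. torus_measure" ..
  let ?J = "{..<n} - {j}"
  let ?P = "\<Pi>\<^sub>M i\<in>?J. torus_measure"
  have ins: "insert j ?J = {..<n}" using j by auto
  have fub: "(\<integral>x. indicator Omega x * h x \<partial>Conf)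
      = (\<integral>x. (\<integral>w. indicator Omega (x(j := w)) * h (x(j := w)) \<partial>torus_measure) \<partial>?P)" if h: "bmeas h" for h
    using P.product_integral_insert[of ?J j "\<lambda>x. indicator Omega x * h x"] integrable_Omega[OF h]
    unfolding ins Conf_def by simp
  show ?thesis
    unfolding fub[OF bmeas_move[OF g j]] fub[OF g]
  proof (rule Bochner_Integration.integral_cong[OF refl])
    fix x assume x: "x \<in> space ?P"
    have xw: "x(j := w) \<in> space Conf" if "w \<in> unit_torus" for w
      using x that j by (auto simp: space_PiM space_Conf PiE_def extensional_def Pi_def)
    obtain w0 where w0: "w0 \<in> unit_torus" using T.not_empty by auto
    \<comment> \<open>The indicator of \<open>Omega\<close> factors into v for the fixed disks and
      \<phi> for the position of disk j.\<close>
    define v where "v = (if \<forall>i\<in>?J. \<forall>k\<in>?J. i \<noteq> k \<longrightarrow> 2 * r \<le> torus_dist (x i) (x k) then 1 else 0 :: real)"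
    define \<phi> where "\<phi> w = (indicator {w \<in> unit_torus. free x j w} w :: real)" for w
    have free_eq: "free (x(j := w)) j z = free x j z" for w z by (auto simp: free_def)
    have "{w \<in> unit_torus. free x j w} = {w \<in> unit_torus. free (x(j := w0)) j w}" using free_eq by simp
    then have S: "{w \<in> unit_torus. free x j w} \<in> sets torus_measure" using sets_free[OF xw[OF w0]] by simp
    have om: "indicator Omega (x(j := w)) = v * \<phi> w" if w: "w \<in> unit_torus" for w
    proof -
      have "x(j := w) \<in> Omega \<longleftrightarrow> (\<forall>i\<in>?J. \<forall>k\<in>?J. i \<noteq> k \<longrightarrow> 2 * r \<le> torus_dist (x i) (x k)) \<and> free x j w"
      proof
        assume L: "x(j := w) \<in> Omega"
        then have d: "2 * r \<le> torus_dist ((x(j := w)) i) ((x(j := w)) k)" if "i < n" "k < n" "i \<noteq> k" for i k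
          using that by (simp add: Omega_eq)
        have "2 * r \<le> torus_dist (x i) (x k)" if "i \<in> ?J" "k \<in> ?J" "i \<noteq> k" for i k
          using d[of i k] that by simp
        moreover have "2 * r \<le> torus_dist w (x i)" if "i < n" "i \<noteq> j" for i
          using d[of j i] that j by simp
        ultimately show "(\<forall>i\<in>?J. \<forall>k\<in>?J. i \<noteq> k \<longrightarrow> 2 * r \<le> torus_dist (x i) (x k)) \<and> free x j w"
          unfolding free_def by blast
      next
        assume R: "(\<forall>i\<in>?J. \<forall>k\<in>?J. i \<noteq> k \<longrightarrow> 2 * r \<le> torus_dist (x i) (x k)) \<and> free x j w"
        have "2 * r \<le> torus_dist ((x(j := w)) i) ((x(j := w)) k)" if ik: "i < n" "k < n" "i \<noteq> k" for i k
        proof -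
          consider "i = j" | "k = j" | "i \<noteq> j" "k \<noteq> j" by blast
          then show ?thesis
          proof cases
            case 1 then show ?thesis using R ik by (simp add: free_def)
          next
            case 2 then show ?thesis using R ik by (simp add: free_def torus_dist_commute[of "x i" w])
          next
            case 3 then show ?thesis using R ik by simp
          qed
        qed
        then show "x(j := w) \<in> Omega" using xw[OF w] by (simp add: Omega_eq)
      qed
      then show ?thesis using w by (simp add: v_def \<phi>_def indicator_def)
    qed
    let ?H = "\<lambda>w. g (x(j := w))"
    have mH: "(\<lambda>w. x(j := w)) \<in> torus_measure \<rightarrow>\<^sub>M Conf"
    proof -
      have "(\<lambda>w. (x(j := w0))(j := w)) \<in> torus_measure \<rightarrow>\<^sub>M Conf"
        unfolding Conf_def
        by (rule measurable_fun_upd[where J = "{..<n}"])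
          (use xw[OF w0] j in \<open>auto simp: Conf_def intro: measurable_const\<close>)
      then show ?thesis by simp
    qed
    have iH: "integrable torus_measure ?H" by (rule integrable_bounded_upd[OF g mH])
    have i\<phi>: "integrable torus_measure \<phi>" unfolding \<phi>_def using S by (simp add: T.emeasure_eq_measure)
    have i\<phi>H: "integrable torus_measure (\<lambda>z. \<phi> z * ?H z)"
      using integrable_mult_indicator[OF S iH] by (simp add: \<phi>_def)
    define a where "a = (\<integral>z. \<phi> z * ?H z \<partial>torus_measure)"
    define b where "b = (\<integral>z. \<phi> z \<partial>torus_measure)"
    have mv: "move j g (x(j := w)) = a + (1 - b) * ?H w" if w: "w \<in> unit_torus" for w
    proof -
      have "move j g (x(j := w)) = (\<integral>z. \<phi> z * ?H z + (1 - \<phi> z) * ?H w \<partial>torus_measure)"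
        unfolding move_def
        by (rule Bochner_Integration.integral_cong) (auto simp: upd_def free_eq \<phi>_def)
      also have "\<dots> = a + (\<integral>z. (1 - \<phi> z) * ?H w \<partial>torus_measure)"
        unfolding a_def using i\<phi> i\<phi>H by (intro Bochner_Integration.integral_add) auto
      also have "(\<integral>z. (1 - \<phi> z) * ?H w \<partial>torus_measure) = (\<integral>z. 1 - \<phi> z \<partial>torus_measure) * ?H w"
        by (rule Bochner_Integration.integral_mult_left_zero)
      also have "(\<integral>z. 1 - \<phi> z \<partial>torus_measure) = 1 - b"
        unfolding b_def using i\<phi> T.prob_space by (subst Bochner_Integration.integral_diff) auto
      finally show ?thesis .
    qed
    have "(\<integral>w. indicator Omega (x(j := w)) * move j g (x(j := w)) \<partial>torus_measure)
        = (\<integral>w. v * (\<phi> w * a + (1 - b) * (\<phi> w * ?H w)) \<partial>torus_measure)"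
      by (rule Bochner_Integration.integral_cong) (auto simp: om mv algebra_simps)
    also have "\<dots> = v * (\<integral>w. \<phi> w * a + (1 - b) * (\<phi> w * ?H w) \<partial>torus_measure)"
      by (rule Bochner_Integration.integral_mult_right_zero)
    also have "(\<integral>w. \<phi> w * a + (1 - b) * (\<phi> w * ?H w) \<partial>torus_measure) = b * a + (1 - b) * a"
      using i\<phi> i\<phi>H by (subst Bochner_Integration.integral_add) (auto simp: a_def b_def)
    also have "\<dots> = a" by (simp add: algebra_simps)
    also have "v * a = (\<integral>w. v * (\<phi> w * ?H w) \<partial>torus_measure)"
      unfolding a_def by (rule Bochner_Integration.integral_mult_right_zero[symmetric])
    also have "\<dots> = (\<integral>w. indicator Omega (x(j := w)) * ?H w \<partial>torus_measure)"
      by (rule Bochner_Integration.integral_cong) (auto simp: om)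
    finally show "(\<integral>w. indicator Omega (x(j := w)) * move j g (x(j := w)) \<partial>torus_measure)
        = (\<integral>w. indicator Omega (x(j := w)) * g (x(j := w)) \<partial>torus_measure)" .
  qed
qed



lemma stationary_step_power:
  assumes g: "bmeas g"
  shows "(\<integral>x. indicator Omega x * (step ^^ t) g x \<partial>Conf) = (\<integral>x. indicator Omega x * g x \<partial>Conf)"
proof (induction t)
  case (Suc t)
  let ?h = "(step ^^ t) g"
  have h: "bmeas ?h" using g by (rule bmeas_step_power)
  have "(\<integral>x. indicator Omega x * step ?h x \<partial>Conf)
      = (\<integral>x. 1 / n * (\<Sum>j<n. indicator Omega x * move j ?h x) \<partial>Conf)"
  proof (rule Bochner_Integration.integral_cong[OF refl])
    fix x
    show "indicator Omega x * step ?h x = 1 / n * (\<Sum>j<n. indicator Omega x * move j ?h x)"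
      unfolding moves_def sum_distrib_left[symmetric] by (simp only: times_divide_eq_left times_divide_eq_right mult_1)
  qed
  also have "\<dots> = 1 / n * (\<integral>x. (\<Sum>j<n. indicator Omega x * move j ?h x) \<partial>Conf)"
    by (rule Bochner_Integration.integral_mult_right_zero)
  also have "(\<integral>x. (\<Sum>j<n. indicator Omega x * move j ?h x) \<partial>Conf)
      = (\<Sum>j<n. \<integral>x. indicator Omega x * move j ?h x \<partial>Conf)"
    by (rule Bochner_Integration.integral_sum) (auto intro: integrable_Omega bmeas_move h)
  also have "\<dots> = n * (\<integral>x. indicator Omega x * ?h x \<partial>Conf)"
    using stationary_move[OF h] by simp
  finally show ?case using Suc n_pos by simp
qed simp

text \<open>By stationarity, the uniform measure of A is the average over \<open>Omega\<close> of
  P^t applied to the indicator of A, and the chain started at x gives the value of this function at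
  x. Its oscillation therefore bounds the distance. The oscillation is taken over all tuples, since
  path coupling also passes through overlapping ones.\<close>

lemma tv_dist_bound:
  assumes x: "x \<in> Omega" and pos: "0 < emeasure Conf Omega" and e: "0 \<le> e"
    and osc: "\<And>g y z. bmeas g \<Longrightarrow> (\<And>x. x \<in> space Conf \<Longrightarrow> 0 \<le> g x \<and> g x \<le> 1) \<Longrightarrow> y \<in> space Conf \<Longrightarrow> z \<in> space Conf \<Longrightarrow>
        \<bar>(step ^^ t) g y - (step ^^ t) g z\<bar> \<le> e"
  shows "tv_dist (disk_chain n r x t) (uniform_config n r) \<le> e"
  unfolding tv_dist_def
proof (rule cSUP_least)
  note facts = disk_chain_facts[OF x, of t]
  interpret C: prob_space Conf by (rule prob_space_Conf)
  interpret D: prob_space "disk_chain n r x t" by (rule facts)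
  show "sets (disk_chain n r x t) \<noteq> {}" by auto
  fix A assume "A \<in> sets (disk_chain n r x t)"
  then have Ac: "A \<in> sets (config_measure n r)" using facts by simp
  then have A: "A \<in> sets Conf" "A \<subseteq> Omega"
    using sets_restrict_space_iff[of Omega Conf A] Omega_sets by (auto simp: config_measure_eq)
  let ?g = "indicator A :: _ \<Rightarrow> real"
  have g: "bmeas ?g" unfolding bmeas_def using A by (auto intro!: exI[of _ 1] simp: indicator_def)
  let ?h = "(step ^^ t) ?g"
  have "D.prob A = (\<integral>y. ?g y \<partial>disk_chain n r x t)"
    using Ac facts(1) sets.Int_space_eq2[of A "disk_chain n r x t"] by simp
  then have D: "D.prob A = ?h x" using integral_disk_chain[OF x g] by simp
  have Om: "0 < C.prob Omega" using pos by (simp add: C.emeasure_eq_measure)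
  have "measure (uniform_config n r) A = C.prob A / C.prob Omega"
  proof -
    have "Omega \<in> sets (config_measure n r)" using Omega_sets by (simp add: config_measure_eq sets_restrict_space_iff)
    moreover have "Omega \<inter> A = A" using A by auto
    moreover have "emeasure (config_measure n r) X = emeasure Conf X" if "X \<subseteq> Omega" for X
      unfolding config_measure_eq using that by (intro emeasure_restrict_space) auto
    ultimately have "emeasure (uniform_config n r) A = emeasure Conf A / emeasure Conf Omega"
      unfolding uniform_config_def using Ac A(2) by (subst emeasure_uniform_measure) auto
    then show ?thesis
      unfolding measure_def using Om by (simp add: C.emeasure_eq_measure divide_ennreal)
  qed
  also have "C.prob A = (\<integral>y. indicator Omega y * ?g y \<partial>Conf)"
  proof -
    have "(\<lambda>y. indicator Omega y * ?g y) = ?g" using A(2) by (auto simp: indicator_def fun_eq_iff)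
    then show ?thesis using A(1) sets.Int_space_eq2[of A Conf] by (simp only: integral_indicator) (simp add: measure_def)
  qed
  also have "\<dots> = (\<integral>y. indicator Omega y * ?h y \<partial>Conf)" using stationary_step_power[OF g] by simp
  finally have U: "measure (uniform_config n r) A = (\<integral>y. indicator Omega y * ?h y \<partial>Conf) / C.prob Omega" .
  have xC: "x \<in> space Conf" using x by (rule Omega_Conf)
  have hx: "\<bar>?h x - ?h y\<bar> \<le> e" if "y \<in> space Conf" for y
    by (rule osc[OF g _ xC that]) (simp add: indicator_def)
  have hb: "bmeas ?h" using g by (rule bmeas_step_power)
  have c: "(\<integral>y. indicator Omega y * c \<partial>Conf) = C.prob Omega * c" for c
    using sets.Int_space_eq2[OF Omega_sets] by simp
  have ic: "integrable Conf (\<lambda>y. indicator Omega y * c)" for c :: real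
    using Omega_sets by (simp add: C.emeasure_eq_measure)
  have "(\<integral>y. indicator Omega y * ?h y \<partial>Conf) \<le> (\<integral>y. indicator Omega y * (?h x + e) \<partial>Conf)"
  proof (rule integral_mono[OF integrable_Omega[OF hb] ic])
    fix y assume "y \<in> space Conf"
    from hx[OF this] have "?h y \<le> ?h x + e" by linarith
    then show "indicator Omega y * ?h y \<le> indicator Omega y * (?h x + e)"
      by (rule mult_left_mono) (rule indicator_pos_le)
  qed
  moreover have "(\<integral>y. indicator Omega y * (?h x - e) \<partial>Conf) \<le> (\<integral>y. indicator Omega y * ?h y \<partial>Conf)"
  proof (rule integral_mono[OF ic integrable_Omega[OF hb]])
    fix y assume "y \<in> space Conf"
    from hx[OF this] have "?h x - e \<le> ?h y" by linarith
    then show "indicator Omega y * (?h x - e) \<le> indicator Omega y * ?h y"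
      by (rule mult_left_mono) (rule indicator_pos_le)
  qed
  ultimately have "measure (uniform_config n r) A \<le> ?h x + e" "?h x - e \<le> measure (uniform_config n r) A"
    unfolding U c pos_divide_le_eq[OF Om] pos_le_divide_eq[OF Om] by (simp_all only: mult.commute)
  then show "\<bar>D.prob A - measure (uniform_config n r) A\<bar> \<le> e" unfolding D by (simp add: abs_le_iff)
qed

end

subsection \<open>Mixing\<close>

lemma (in product_sigma_finite) emeasure_insert_ge:
  assumes I: "finite I" "i \<notin> I" and A: "A \<in> sets (Pi\<^sub>M (insert i I) M)" and B: "B \<in> sets (Pi\<^sub>M I M)"
    and slice: "\<And>x. x \<in> B \<Longrightarrow> c \<le> emeasure (M i) {y \<in> space (M i). x(i := y) \<in> A}"
  shows "c * emeasure (Pi\<^sub>M I M) B \<le> emeasure (Pi\<^sub>M (insert i I) M) A"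
proof -
  have "c * emeasure (Pi\<^sub>M I M) B = (\<integral>\<^sup>+x. c * indicator B x \<partial>Pi\<^sub>M I M)"
    using B by (rule nn_integral_cmult_indicator[symmetric])
  also have "\<dots> \<le> (\<integral>\<^sup>+x. (\<integral>\<^sup>+y. indicator A (x(i := y)) \<partial>M i) \<partial>Pi\<^sub>M I M)"
  proof (rule nn_integral_mono)
    fix x assume x: "x \<in> space (Pi\<^sub>M I M)"
    have "(\<lambda>y. x(i := y)) \<in> M i \<rightarrow>\<^sub>M Pi\<^sub>M (insert i I) M"
      using x by (intro measurable_fun_upd[where J = I]) auto
    then have m: "{y \<in> space (M i). x(i := y) \<in> A} \<in> sets (M i)"
      using measurable_sets[OF _ A] by (auto simp: vimage_def Int_def conj_commute)
    have "(\<integral>\<^sup>+y. indicator A (x(i := y)) \<partial>M i) = (\<integral>\<^sup>+y. indicator {y \<in> space (M i). x(i := y) \<in> A} y \<partial>M i)"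
      by (intro nn_integral_cong) (auto simp: indicator_def)
    also have "\<dots> = emeasure (M i) {y \<in> space (M i). x(i := y) \<in> A}" using m by simp
    finally show "c * indicator B x \<le> (\<integral>\<^sup>+y. indicator A (x(i := y)) \<partial>M i)"
      using slice by (auto simp: indicator_def)
  qed
  also have "\<dots> = (\<integral>\<^sup>+x. indicator A x \<partial>Pi\<^sub>M (insert i I) M)"
    using I A by (intro product_nn_integral_insert[symmetric]) auto
  finally show ?thesis using A by simp
qed

context hard_disks
begin

text \<open>The disks are placed one at a time. The earlier ones together forbid an area of at most
  \<open>exclusion\<close>, so each placement keeps a fraction of at least 1 - exclusion.\<close>

lemma emeasure_Omega_ge:
  assumes e: "exclusion \<le> 1" and m: "m \<le> n"
  shows "configurations m r \<in> sets (\<Pi>\<^sub>M i\<in>{..<m}. torus_measure) \<and>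
    ennreal (1 - exclusion) ^ m \<le> emeasure (\<Pi>\<^sub>M i\<in>{..<m}. torus_measure) (configurations m r)"
  using m
proof (induction m)
  case 0
  interpret P: prob_space "\<Pi>\<^sub>M i\<in>{..<0::nat}. torus_measure" by (intro prob_space_PiM prob_space_torus_measure)
  have eq: "configurations 0 r = space (\<Pi>\<^sub>M i\<in>{..<0::nat}. torus_measure)"
    by (simp add: configurations_def space_PiM)
  show ?case using P.emeasure_space_1 unfolding eq by simp
next
  case (Suc m)
  interpret P: product_sigma_finite "\<lambda>_::nat. torus_measure" ..
  interpret S: hard_disks "Suc m" r using r_pos by unfold_locales auto
  have A: "configurations (Suc m) r \<in> sets (Pi\<^sub>M (insert m {..<m}) (\<lambda>_. torus_measure))"
    using S.Omega_sets by (simp add: S.Conf_def lessThan_Suc)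
  have "ennreal (1 - exclusion) * ennreal (1 - exclusion) ^ m
      \<le> ennreal (1 - exclusion) * emeasure (\<Pi>\<^sub>M i\<in>{..<m}. torus_measure) (configurations m r)"
    using Suc by (intro mult_left_mono) auto
  also have "\<dots> \<le> emeasure (\<Pi>\<^sub>M i\<in>insert m {..<m}. torus_measure) (configurations (Suc m) r)"
  proof (rule P.emeasure_insert_ge[OF _ _ A])
    fix x assume x: "x \<in> configurations m r"
    have b: "measure torus_measure (blocked x {..<m}) \<le> exclusion"
    proof -
      have "measure torus_measure (blocked x {..<m}) \<le> m * disk_area" using measure_blocked[of "{..<m}" x] by simp
      also have "\<dots> \<le> exclusion" unfolding exclusion_def
        using Suc.prems disk_area_pos by (intro mult_right_mono) auto
      finally show ?thesis .
    qed
    have "{y \<in> space torus_measure. x(m := y) \<in> configurations (Suc m) r} = space torus_measure - blocked x {..<m}"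
    proof (intro set_eqI iffI)
      fix y assume "y \<in> {y \<in> space torus_measure. x(m := y) \<in> configurations (Suc m) r}"
      then have y: "y \<in> unit_torus" and c: "x(m := y) \<in> configurations (Suc m) r" by auto
      have "2 * r \<le> torus_dist ((x(m := y)) m) ((x(m := y)) i)" if "i < m" for i
        using c that unfolding configurations_def by (auto simp del: fun_upd_apply)
      then have "2 * r \<le> torus_dist y (x i)" if "i < m" for i using that by fastforce
      then show "y \<in> space torus_measure - blocked x {..<m}" using y by (force simp: blocked_def)
    next
      fix y assume "y \<in> space torus_measure - blocked x {..<m}"
      then have y: "y \<in> unit_torus" and f: "\<forall>i<m. 2 * r \<le> torus_dist y (x i)"
        by (force simp: blocked_def)+
      have f': "2 * r \<le> torus_dist (x i) y" if "i < m" for i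
        using f that by (simp add: torus_dist_commute)
      have d: "2 * r \<le> torus_dist ((x(m := y)) i) ((x(m := y)) k)" if ik: "i < Suc m" "k < Suc m" "i \<noteq> k" for i k
      proof -
        consider "i = m" "k < m" | "k = m" "i < m" | "i < m" "k < m" using ik by linarith
        then show ?thesis
          by cases (use f f' x ik in \<open>auto simp: configurations_def\<close>)
      qed
      have "x(m := y) \<in> {..<Suc m} \<rightarrow>\<^sub>E unit_torus"
        using x y by (auto simp: configurations_def PiE_def extensional_def less_Suc_eq)
      then show "y \<in> {y \<in> space torus_measure. x(m := y) \<in> configurations (Suc m) r}"
        using y d by (simp add: configurations_def del: fun_upd_apply)
    qed
    then have "emeasure torus_measure {y \<in> space torus_measure. x(m := y) \<in> configurations (Suc m) r}
        = ennreal (1 - measure torus_measure (blocked x {..<m}))"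
      using T.prob_compl[OF sets_blocked[of "{..<m}" x]] by (simp add: T.emeasure_eq_measure)
    then show "ennreal (1 - exclusion) \<le> emeasure torus_measure {y \<in> space torus_measure. x(m := y) \<in> configurations (Suc m) r}"
      using b by (simp add: ennreal_leI)
  qed (use Suc in auto)
  finally show ?case using A by (simp add: lessThan_Suc)
qed

lemma emeasure_Omega_pos:
  assumes "exclusion < 1"
  shows "0 < emeasure Conf Omega"
proof -
  have "0 < ennreal (1 - exclusion) ^ n" using assms by (simp add: ennreal_power)
  also have "\<dots> \<le> emeasure Conf Omega" using emeasure_Omega_ge[of n] assms by (simp add: Conf_def)
  finally show ?thesis .
qed

lemma emeasure_config_measure_pos:
  assumes "exclusion < 1"
  shows "0 < emeasure (config_measure n r) Omega"
  using emeasure_Omega_pos[OF assms] Omega_sets unfolding config_measure_eq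
  by (subst emeasure_restrict_space) auto


lemma step_power_diff:
  assumes "bmeas g" "bmeas h" "x \<in> space Conf"
  shows "(step ^^ t) (\<lambda>x. g x - h x) x = (step ^^ t) g x - (step ^^ t) h x"
  using assms(3)
proof (induction t arbitrary: x)
  case (Suc t)
  have "step ((step ^^ t) (\<lambda>x. g x - h x)) x = step (\<lambda>x. (step ^^ t) g x - (step ^^ t) h x) x"
    using Suc by (intro moves_cong) auto
  also have "\<dots> = step ((step ^^ t) g) x - step ((step ^^ t) h) x"
    using Suc.prems by (intro moves_diff bmeas_step_power assms) auto
  finally show ?case by simp
qed simp

text \<open>The difference between g and its relabelled version is antisymmetric under the swap,
  remains so under steps, and shrinks by q in every block of L steps. The additional t steps cannot
  enlarge it, which makes the bound uniform over all later times.\<close>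

lemma label_osc_step_power:
  assumes g: "bmeas g" "\<And>x. x \<in> space Conf \<Longrightarrow> 0 \<le> g x \<and> g x \<le> 1"
    and dens: "exclusion + disk_area \<le> 1"
  defines "c \<equiv> 2 * (1 - exclusion) * (1 - exclusion - disk_area)"
  assumes L: "24 * real L * disk_area \<le> c" "2 * L \<le> n"
    and q: "1 - c * L * (real L - 1) / (16 * (real n)\<^sup>2) \<le> q" "0 \<le> q"
  shows "label_osc (q ^ k) ((step ^^ (t + k * L)) g)"
  unfolding label_osc_def
proof (intro ballI allI impI)
  fix x i j assume x: "x \<in> space Conf" and ij: "i < n" "j < n"
  show "\<bar>(step ^^ (t + k * L)) g x - (step ^^ (t + k * L)) g (swp i j x)\<bar> \<le> q ^ k"
  proof (cases "i = j")
    case True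
    then have "swp i j x = x" by (auto simp: swp_def lab_def fun_eq_iff)
    then show ?thesis using q by simp
  next
    case False
    define \<psi> where "\<psi> = (\<lambda>x. g x - g (swp i j x))"
    have \<psi>: "bmeas \<psi>" unfolding \<psi>_def by (intro bmeas_diff bmeas_swp g ij)
    have anti: "\<psi> (swp i j y) = - \<psi> y" for y by (simp add: \<psi>_def)
    have bound: "\<bar>\<psi> y\<bar> \<le> 1" if "y \<in> space Conf" for y
      using g(2)[OF that] g(2)[OF swp_in_Conf[OF ij that]] by (simp add: \<psi>_def abs_le_iff)
    have pow: "\<bar>(step ^^ (k * L)) \<psi> y\<bar> \<le> q ^ k" if "y \<in> space Conf" for y k
      using that
    proof (induction k arbitrary: y)
      case 0
      then show ?case using bound by simp
    next
      case (Suc k)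
      have "\<bar>(step ^^ L) ((step ^^ (k * L)) \<psi>) y\<bar> \<le> (1 - c * L * (real L - 1) / (16 * (real n)\<^sup>2)) * q ^ k"
        unfolding c_def using L[unfolded c_def]
        by (intro label_contraction[OF bmeas_step_power[OF \<psi>] Suc.IH Suc.prems ij False _ dens]
            step_power_antisymmetric[OF \<psi> ij] anti) auto
      also have "\<dots> \<le> q * q ^ k" using q by (intro mult_right_mono) auto
      finally show ?case by (simp add: funpow_add)
    qed
    have "\<bar>(step ^^ t) ((step ^^ (k * L)) \<psi>) x\<bar> \<le> q ^ k"
      by (rule step_power_bound[OF bmeas_step_power[OF \<psi>] pow x])
    moreover have "(step ^^ (t + k * L)) \<psi> x = (step ^^ (t + k * L)) g x - (step ^^ (t + k * L)) g (swp i j x)"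
      unfolding \<psi>_def step_power_swp[OF ij] by (intro step_power_diff bmeas_swp g ij x)
    ultimately show ?thesis by (simp add: funpow_add)
  qed
qed

lemma lipschitz_mono: "lipschitz A g \<Longrightarrow> A \<le> B \<Longrightarrow> lipschitz B g"
proof -
  assume l: "lipschitz A g" and AB: "A \<le> B"
  have "A * cost y z \<le> B * cost y z" for y z using cost_bounds(1)[of y z] AB by (intro mult_right_mono) auto
  then show ?thesis using l unfolding lipschitz_def by (meson order_trans)
qed

text \<open>10^9 * n * s solves E = (1 - 1 / (100000 * n)) * E + 10000 * s, so it is the level at
  which the relabelling errors of all steps accumulate.\<close>

lemma lipschitz_step_power:
  fixes A s :: real
  assumes g: "bmeas g" and lip: "lipschitz A g" and A: "0 \<le> A" and s: "0 \<le> s"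
    and osc: "\<And>t. label_osc s ((step ^^ t) g)" and ex: "exclusion \<le> 617932 / 1000000"
  shows "lipschitz ((1 - 1 / (100000 * real n)) ^ t * A + 10 ^ 9 * real n * s) ((step ^^ t) g)"
proof (induction t)
  case 0
  have "0 \<le> 10 ^ 9 * real n * s" using s by simp
  then have "A \<le> A + 10 ^ 9 * real n * s" by linarith
  then show ?case using lipschitz_mono[OF lip] by simp
next
  case (Suc t)
  define \<delta> where "\<delta> = 1 - 1 / (100000 * real n)"
  have n: "1 \<le> real n" using n_pos by simp
  then have \<delta>: "0 \<le> \<delta>" unfolding \<delta>_def by (simp add: divide_le_eq)
  have "0 \<le> \<delta> ^ t * A + 10 ^ 9 * real n * s" using \<delta> A s by simp
  from step_contraction[OF bmeas_step_power[OF g] Suc this[unfolded \<delta>_def] osc ex]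
  have "lipschitz (\<delta> * (\<delta> ^ t * A + 10 ^ 9 * real n * s) + 10000 * s) ((step ^^ Suc t) g)"
    by (simp add: \<delta>_def)
  moreover have "\<delta> * (10 ^ 9 * real n * s) + 10000 * s = 10 ^ 9 * real n * s"
    using n by (simp add: \<delta>_def left_diff_distrib)
  then have "\<delta> * (\<delta> ^ t * A + 10 ^ 9 * real n * s) + 10000 * s = \<delta> ^ Suc t * A + 10 ^ 9 * real n * s"
    by (simp add: distrib_left)
  ultimately show ?case unfolding \<delta>_def by simp
qed

lemma lipschitz_osc:
  fixes A :: real and g :: "(nat \<Rightarrow> real \<times> real) \<Rightarrow> real"
  assumes lip: "lipschitz A g" and A: "0 \<le> A" and x: "x \<in> space Conf" and y: "y \<in> space Conf"
  shows "\<bar>g x - g y\<bar> \<le> n * A"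
proof -
  define z where "z m = (\<lambda>k. if k < m then y k else x k)" for m
  have zC: "z m \<in> space Conf" for m
    using x y by (auto simp: z_def space_Conf PiE_def extensional_def)
  have "\<bar>g x - g (z m)\<bar> \<le> m * A" if "m \<le> n" for m
    using that
  proof (induction m)
    case 0 then show ?case by (simp add: z_def)
  next
    case (Suc m)
    have "\<bar>g (z m) - g (z (Suc m))\<bar> \<le> A"
      using Suc.prems by (intro lipschitzD1[OF lip A zC zC, of m]) (auto simp: z_def)
    moreover have "real (Suc m) * A = real m * A + A" by (simp add: distrib_right)
    moreover have "\<bar>g x - g (z m)\<bar> \<le> m * A" using Suc by simp
    ultimately show ?case by linarith
  qed
  moreover have "z n = y" using x y by (auto simp: z_def space_Conf PiE_def extensional_def fun_eq_iff)
  ultimately show ?thesis by force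
qed

text \<open>The k * L steps that act on g first make it nearly symmetric in the labels; the t steps
  after them contract. The contraction starts from Lipschitz constant 10000, because the oscillation
  is at most 1 and every discrepancy costs at least 1 / 10000. The path between two tuples has n
  links, which gives the last factor n in both hypotheses on e.\<close>

lemma mixing_time_le:
  assumes ex: "exclusion \<le> 617932 / 1000000" and dens: "exclusion + disk_area \<le> 1"
  defines "c \<equiv> 2 * (1 - exclusion) * (1 - exclusion - disk_area)"
  assumes L: "24 * real L * disk_area \<le> c" "2 * L \<le> n"
    and q: "1 - c * L * (real L - 1) / (16 * (real n)\<^sup>2) \<le> q" "0 \<le> q"
    and e: "10 ^ 9 * (real n)\<^sup>2 * q ^ k \<le> e / 2" "10 ^ 4 * n * (1 - 1 / (100000 * real n)) ^ t \<le> e / 2"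
  shows "mixing_time n r e \<le> enat (t + k * L)"
proof -
  have e0: "0 \<le> e" using order_trans[OF _ e(1), of 0] q by simp
  have "tv_dist (disk_chain n r x (t + k * L)) (uniform_config n r) \<le> e" if x: "x \<in> Omega" for x
  proof (rule tv_dist_bound[OF x emeasure_Omega_pos e0])
    show "exclusion < 1" using ex by simp
    fix g y z assume g: "bmeas g" "\<And>x. x \<in> space Conf \<Longrightarrow> 0 \<le> g x \<and> g x \<le> 1"
      and yz: "y \<in> space Conf" "z \<in> space Conf"
    define h where "h = (step ^^ (k * L)) g"
    have h: "bmeas h" unfolding h_def by (rule bmeas_step_power[OF g(1)])
    have half: "bmeas (\<lambda>_. 1 / 2)" unfolding bmeas_def by (intro conjI exI[of _ "1 / 2"]) auto
    \<comment> \<open>Centring at 1/2 matters: \<open>step_power_bound\<close> controls absolute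
      values, and the bound 1 for g itself would only give oscillation 2.\<close>
    have hb: "\<bar>h x - 1 / 2\<bar> \<le> 1 / 2" if "x \<in> space Conf" for x
    proof -
      have c: "(step ^^ m) (\<lambda>x. a) x = a" for m a
        using n_pos T.prob_space by (induction m arbitrary: x) (simp_all add: moves_def move_def)
      have "\<bar>(step ^^ (k * L)) (\<lambda>x. g x - 1 / 2) x\<bar> \<le> 1 / 2"
      proof (rule step_power_bound[OF _ _ that])
        show "bmeas (\<lambda>x. g x - 1 / 2)" by (rule bmeas_diff[OF g(1) half])
        show "\<bar>g x - 1 / 2\<bar> \<le> 1 / 2" if "x \<in> space Conf" for x using g(2)[OF that] by linarith
      qed
      moreover have "(step ^^ (k * L)) (\<lambda>x. g x - 1 / 2) x = h x - 1 / 2"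
        using step_power_diff[OF g(1) half that, of "k * L"] c by (simp add: h_def)
      ultimately show ?thesis by simp
    qed
    have h1: "\<bar>h x - h y\<bar> \<le> 1" if "x \<in> space Conf" "y \<in> space Conf" for x y
      using hb[OF that(1)] hb[OF that(2)] by linarith
    have "1 \<le> 10000 * cost u v" for u v using cost_bounds(1)[of u v] by simp
    then have lip: "lipschitz 10000 h" unfolding lipschitz_def using h1 order_trans by blast
    have osc: "label_osc (q ^ k) ((step ^^ m) h)" for m
      using label_osc_step_power[OF g dens L[unfolded c_def] q[unfolded c_def], of k m]
      by (simp add: h_def funpow_add)
    define D where "D = (1 - 1 / (100000 * real n)) ^ t * 10000 + 10 ^ 9 * real n * q ^ k"
    have "lipschitz D ((step ^^ t) h)"
      unfolding D_def by (rule lipschitz_step_power[OF h lip _ _ osc ex]) (use q in auto)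
    moreover have "0 \<le> D"
    proof -
      have "1 \<le> real n" using n_pos by simp
      then have "0 \<le> 1 - 1 / (100000 * real n)" by (simp add: divide_le_eq)
      then show ?thesis unfolding D_def using q by simp
    qed
    ultimately have "\<bar>(step ^^ t) h y - (step ^^ t) h z\<bar> \<le> n * D" using yz by (intro lipschitz_osc)
    also have "n * D = 10 ^ 4 * n * (1 - 1 / (100000 * real n)) ^ t + 10 ^ 9 * (real n)\<^sup>2 * q ^ k"
      by (simp add: D_def distrib_left power2_eq_square)
    also have "\<dots> \<le> e" using e by linarith
    finally show "\<bar>(step ^^ (t + k * L)) g y - (step ^^ (t + k * L)) g z\<bar> \<le> e"
      by (simp add: h_def funpow_add)
  qed
  then show ?thesis unfolding mixing_time_def by (intro INF_lower) simp
qed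

end

section \<open>Numerical choices for densities up to 0.154483\<close>

lemma mult_power_le_of_ln_le:
  assumes "0 < C" "0 < e" "a \<le> 1" "0 \<le> 1 - a" and k: "ln (C / e) \<le> a * real k"
  shows "C * (1 - a) ^ k \<le> e"
proof -
  have "(1 - a) ^ k \<le> exp (- a) ^ k" using assms exp_ge_add_one_self[of "- a"] by (intro power_mono) auto
  also have "\<dots> = exp (- (a * k))" by (simp add: exp_of_nat_mult[symmetric] mult.commute)
  also have "\<dots> \<le> exp (- ln (C / e))" using k by simp
  also have "\<dots> = e / C" using assms by (simp add: exp_minus)
  finally show ?thesis using assms by (simp add: pos_le_divide_eq mult.commute)
qed

lemma hard_disks_disk_radius:
  assumes "0 < \<rho>" "0 < n"
  shows "hard_disks n (disk_radius n \<rho>)" "hard_disks.disk_area (disk_radius n \<rho>) = 4 * \<rho> / n"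
    "hard_disks.exclusion n (disk_radius n \<rho>) = 4 * \<rho>"
proof -
  show h: "hard_disks n (disk_radius n \<rho>)" using assms by unfold_locales (auto simp: disk_radius_def)
  show d: "hard_disks.disk_area (disk_radius n \<rho>) = 4 * \<rho> / n"
  proof -
    have "(disk_radius n \<rho>)\<^sup>2 = \<rho> / (n * pi)" using assms by (simp add: disk_radius_def)
    then show ?thesis by (simp add: hard_disks.disk_area_def[OF h] power_mult_distrib)
  qed
  show "hard_disks.exclusion n (disk_radius n \<rho>) = 4 * \<rho>"
    using assms by (simp add: hard_disks.exclusion_def[OF h] d)
qed

text \<open>The lower bound 4 * 10^9 / e for n absorbs e: the logarithms that determine k and t are
  then at most 3 * ln n and 2 * ln n, so the factor 10^6 does not depend on e. From n = 400 on, the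
  rounding in \<open>n div 100\<close> is harmless.\<close>

lemma mixing_time_disk_radius_le:
  assumes \<rho>: "0 < \<rho>" "\<rho> \<le> 0.154483" and e: "0 < e" "e < 1" and n: "400 \<le> n" "4 * 10 ^ 9 / e \<le> real n"
  obtains T where "mixing_time n (disk_radius n \<rho>) e \<le> enat T" "real T \<le> 10 ^ 6 * (real n * ln n)"
proof -
  have n0: "0 < n" "400 \<le> real n" using n by simp_all
  interpret hard_disks n "disk_radius n \<rho>" using \<rho> n0 by (intro hard_disks_disk_radius)
  have d: "disk_area = 4 * \<rho> / n" and x: "exclusion = 4 * \<rho>"
    using \<rho> n0 by (intro hard_disks_disk_radius; simp)+
  have d1: "disk_area \<le> 1 / 100" unfolding d using \<rho> n0 by (simp add: divide_le_eq)
  define c where "c = 2 * (1 - exclusion) * (1 - exclusion - disk_area)"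
  have c: "0.28 \<le> c"
  proof -
    have "(0.38 :: real) * 0.37 \<le> (1 - exclusion) * (1 - exclusion - disk_area)"
      using \<rho> x d1 by (intro mult_mono) auto
    then show ?thesis unfolding c_def by (simp only: mult.assoc) simp
  qed
  \<comment> \<open>Proportional to n, so that each block loses a constant factor, and small enough
    that 24 * L * disk_area, at most 0.96 * \<rho>, stays below c.\<close>
  define L where "L = n div 100"
  have L: "real L \<le> n / 100" "n / 200 \<le> real L" "n / 200 \<le> real L - 1"
  proof -
    have "100 * L + n mod 100 = n" "n mod 100 < 100" by (simp_all add: L_def)
    then have "real n = 100 * real L + real (n mod 100)" "real (n mod 100) \<le> 99" by linarith+
    then show "real L \<le> n / 100" "n / 200 \<le> real L" "n / 200 \<le> real L - 1" using n0 by linarith+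
  qed
  \<comment> \<open>Slightly less than 0.28 / 640000, the value of c * L * (L - 1) / (16 * n^2) when
    c is replaced by 0.28 and both L and L - 1 by n / 200.\<close>
  define a :: real where "a = 1 / 2500000"
  have q: "1 - c * L * (real L - 1) / (16 * (real n)\<^sup>2) \<le> 1 - a"
  proof -
    have "0.28 * (n / 200) * (n / 200) \<le> c * L * (real L - 1)"
      using c L n0 by (intro mult_mono) auto
    then have "0.28 * (n / 200) * (n / 200) / (16 * (real n)\<^sup>2) \<le> c * L * (real L - 1) / (16 * (real n)\<^sup>2)"
      by (intro divide_right_mono) auto
    moreover have "0.28 * (n / 200) * (n / 200) / (16 * (real n)\<^sup>2) = 0.28 / 640000"
      using n0 by (simp add: power2_eq_square)
    ultimately show ?thesis by (simp add: a_def)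
  qed
  have L1: "24 * real L * disk_area \<le> c"
  proof -
    have "24 * real L * disk_area \<le> 24 * (n / 100) * (4 * \<rho> / n)"
      unfolding d using L \<rho> by (intro mult_right_mono mult_left_mono) auto
    also have "\<dots> = 0.96 * \<rho>" using n0 by simp
    finally show ?thesis using c \<rho> by simp
  qed
  define k where "k = nat \<lceil>2500000 * ln (10 ^ 9 * (real n)\<^sup>2 / (e / 2))\<rceil>"
  define t where "t = nat \<lceil>100000 * n * ln (10 ^ 4 * n / (e / 2))\<rceil>"
  have k1: "ln (10 ^ 9 * (real n)\<^sup>2 / (e / 2)) \<le> a * real k"
    using of_nat_ceiling[of "2500000 * ln (10 ^ 9 * (real n)\<^sup>2 / (e / 2))"] by (simp add: k_def a_def)
  have t1: "ln (10 ^ 4 * n / (e / 2)) \<le> 1 / (100000 * real n) * real t"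
    using of_nat_ceiling[of "100000 * n * ln (10 ^ 4 * n / (e / 2))"] n0 by (simp add: t_def pos_le_divide_eq mult.commute)
  have "mixing_time n (disk_radius n \<rho>) e \<le> enat (t + k * L)"
  proof (rule mixing_time_le[OF _ _ L1[unfolded c_def] _ q[unfolded c_def]])
    show "exclusion \<le> 617932 / 1000000" using \<rho> x by simp
    show "exclusion + disk_area \<le> 1" using \<rho> x d1 by simp
    show "2 * L \<le> n" by (simp add: L_def)
    show "0 \<le> 1 - a" by (simp add: a_def)
    show "10 ^ 9 * (real n)\<^sup>2 * (1 - a) ^ k \<le> e / 2"
      using n0 e k1 by (intro mult_power_le_of_ln_le) (auto simp: a_def)
    show "10 ^ 4 * n * (1 - 1 / (100000 * real n)) ^ t \<le> e / 2"
      using n0 e t1 by (intro mult_power_le_of_ln_le) (auto simp: divide_le_eq)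
  qed
  moreover have "real (t + k * L) \<le> 10 ^ 6 * (real n * ln n)"
  proof -
    have ln1: "1 \<le> ln (real n)"
    proof -
      have "exp 1 \<le> (400 :: real)" using exp_le by linarith
      then have "exp 1 \<le> real n" using n0 by linarith
      then show ?thesis using n0 by (simp add: ln_ge_iff)
    qed
    have en: "4 * 10 ^ 9 \<le> real n * e" using n(2) e by (simp add: pos_divide_le_eq)
    have "10 ^ 9 * (real n)\<^sup>2 / (e / 2) \<le> real n ^ 3"
    proof -
      have "2 * 10 ^ 9 * (real n)\<^sup>2 \<le> (real n * e) * (real n)\<^sup>2" using en by (intro mult_right_mono) auto
      then show ?thesis using e by (simp add: divide_le_eq power2_eq_square power3_eq_cube mult_ac)
    qed
    then have k2: "ln (10 ^ 9 * (real n)\<^sup>2 / (e / 2)) \<le> 3 * ln n"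
      using n0 e ln_realpow[of "real n" 3] ln_le_cancel_iff[of "10 ^ 9 * (real n)\<^sup>2 / (e / 2)" "real n ^ 3"] by simp
    have "10 ^ 4 * n / (e / 2) \<le> real n ^ 2"
    proof -
      have "2 * 10 ^ 4 * real n \<le> (real n * e) * real n" using en by (intro mult_right_mono) auto
      then show ?thesis using e by (simp add: divide_le_eq power2_eq_square mult_ac)
    qed
    then have t2: "ln (10 ^ 4 * n / (e / 2)) \<le> 2 * ln n"
      using n0 e ln_realpow[of "real n" 2] ln_le_cancel_iff[of "10 ^ 4 * n / (e / 2)" "real n ^ 2"] by simp
    have "real t \<le> 100000 * n * (2 * ln n) + 1"
    proof -
      have "0 \<le> 100000 * n * (2 * ln n)" using ln1 by simp
      moreover have "100000 * n * ln (10 ^ 4 * n / (e / 2)) \<le> 100000 * n * (2 * ln n)"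
        using t2 by (intro mult_left_mono) auto
      ultimately show ?thesis unfolding t_def by linarith
    qed
    moreover have "real k \<le> 2500000 * (3 * ln n) + 1"
    proof -
      have "2500000 * ln (10 ^ 9 * (real n)\<^sup>2 / (e / 2)) \<le> 2500000 * (3 * ln n)"
        using k2 by (intro mult_left_mono) auto
      then show ?thesis unfolding k_def using ln1 by linarith
    qed
    then have "real k * real L \<le> (2500000 * (3 * ln n) + 1) * (n / 100)"
      using L ln1 by (intro mult_mono) auto
    moreover define w where "w = real n * ln n"
    moreover have "real n * 1 \<le> real n * ln n" using ln1 by (intro mult_left_mono) auto
    ultimately have "real t \<le> 200000 * w + 1" "real k * real L \<le> 75000 * w + n / 100" "real n \<le> w"
      by (simp_all add: algebra_simps)
    then have "real t + real k * real L \<le> 10 ^ 6 * w" using n0(2) by simp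
    then show ?thesis by (simp add: w_def)
  qed
  ultimately show thesis by (rule that)
qed

lemma mixing_time_bigo_n_ln_n:
  assumes \<rho>: "0 < \<rho>" "\<rho> \<le> 0.154483"
  shows "mixing_time_bigo \<rho> (\<lambda>n. real n * ln (real n))"
  unfolding mixing_time_bigo_def
proof (intro allI impI)
  fix e :: real assume e: "0 < e \<and> e < 1"
  have ev: "\<forall>\<^sub>F n in sequentially. 400 \<le> n \<and> 4 * 10 ^ 9 / e \<le> real n"
    by (intro eventually_conj eventually_ge_at_top
        eventually_compose_filterlim[OF eventually_ge_at_top filterlim_real_sequentially])
  have fin: "mixing_time n (disk_radius n \<rho>) e \<noteq> \<infinity> \<and>
      real (the_enat (mixing_time n (disk_radius n \<rho>) e)) \<le> 10 ^ 6 * (real n * ln n)"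
    if n: "400 \<le> n \<and> 4 * 10 ^ 9 / e \<le> real n" for n
  proof -
    obtain T where T: "mixing_time n (disk_radius n \<rho>) e \<le> enat T" "real T \<le> 10 ^ 6 * (real n * ln n)"
      using mixing_time_disk_radius_le[OF \<rho>] e n by blast
    from T(1) obtain m where "mixing_time n (disk_radius n \<rho>) e = enat m" "m \<le> T"
      by (cases "mixing_time n (disk_radius n \<rho>) e") auto
    then show ?thesis using T(2) by simp
  qed
  show "(\<forall>\<^sub>F n in sequentially. mixing_time n (disk_radius n \<rho>) e \<noteq> \<infinity>) \<and>
      (\<lambda>n. real (the_enat (mixing_time n (disk_radius n \<rho>) e))) \<in> O(\<lambda>n. real n * ln (real n))"
  proof
    show "\<forall>\<^sub>F n in sequentially. mixing_time n (disk_radius n \<rho>) e \<noteq> \<infinity>"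
      using ev by (rule eventually_mono) (use fin in blast)
    show "(\<lambda>n. real (the_enat (mixing_time n (disk_radius n \<rho>) e))) \<in> O(\<lambda>n. real n * ln (real n))"
    proof (rule bigoI[of _ "10 ^ 6"], rule eventually_mono[OF ev])
      fix n :: nat assume n: "400 \<le> n \<and> 4 * 10 ^ 9 / e \<le> real n"
      have "10 ^ 6 * (real n * ln n) \<le> 10 ^ 6 * \<bar>real n * ln n\<bar>" by (intro mult_left_mono) auto
      then show "norm (real (the_enat (mixing_time n (disk_radius n \<rho>) e))) \<le> 10 ^ 6 * norm (real n * ln (real n))"
        using fin[OF n] by simp
    qed
  qed
qed

lemma rapidly_mixing_low_density:
  assumes \<rho>: "0 < \<rho>" "\<rho> \<le> 0.154483"
  shows "rapidly_mixing \<rho>"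
  unfolding rapidly_mixing_def
proof
  show "\<forall>\<^sub>F n in sequentially.
      0 < emeasure (config_measure n (disk_radius n \<rho>)) (configurations n (disk_radius n \<rho>))"
  proof (rule eventually_mono[OF eventually_gt_at_top[of 0]])
    fix n :: nat assume n: "0 < n"
    note h = hard_disks_disk_radius[OF \<rho>(1) n]
    show "0 < emeasure (config_measure n (disk_radius n \<rho>)) (configurations n (disk_radius n \<rho>))"
      using hard_disks.emeasure_config_measure_pos[OF h(1)] h(3) \<rho> by simp
  qed
  have "(\<lambda>n. real n * ln (real n)) \<in> O(\<lambda>n. real n ^ 2)"
  proof (rule bigoI[of _ 1], rule eventually_mono[OF eventually_gt_at_top[of 0]])
    fix n :: nat assume n: "0 < n"
    then have "ln (real n) \<le> real n" "0 \<le> ln (real n)" using ln_bound[of "real n"] by auto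
    then show "norm (real n * ln (real n)) \<le> 1 * norm (real n ^ 2)"
      by (simp add: abs_mult power2_eq_square mult_left_mono)
  qed
  then have "mixing_time_bigo \<rho> (\<lambda>n. real n ^ 2)"
    using mixing_time_bigo_n_ln_n[OF \<rho>] unfolding mixing_time_bigo_def
    by (meson landau_o.big_trans)
  then show "\<exists>k. mixing_time_bigo \<rho> (\<lambda>n. real n ^ k)" ..
qed

theorem theorem2:
  shows "(\<forall>\<rho>::real. 0 < \<rho> \<and> \<rho> \<le> 0.154483 \<longrightarrow>
            mixing_time_bigo \<rho> (\<lambda>n. real n * ln (real n)))
         \<and> ereal 0.154483 \<le> critical_density"
proof
  show "\<forall>\<rho>::real. 0 < \<rho> \<and> \<rho> \<le> 0.154483 \<longrightarrow> mixing_time_bigo \<rho> (\<lambda>n. real n * ln (real n))"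
    using mixing_time_bigo_n_ln_n by blast
  \<comment> \<open>The density 0.154483 itself belongs to the set whose supremum is taken, as
    membership only concerns smaller positive densities.\<close>
  show "ereal 0.154483 \<le> critical_density"
    unfolding critical_density_def using rapidly_mixing_low_density by (intro Sup_upper) auto
qed

end
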